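(* Let $p\ge 5$ be a prime and let $(t_n)_{n\ge 0}$ be the $(p-3)/2$-periodic binary sequence defined in the context. For the $N$th maximum order complexity $M(t_n,N)$ of $(t_n)$ we have $$M(t_n,N)\ge \frac{\log (N/p^{1/2})}{\log 2}- \frac{4\log\log p}{\log 2}+O(1),\quad N=1,2,\ldots,(p-5)/2.$$
   Context: For a prime $p\ge 5$, let $q_0,q_1,\ldots,q_{(p-3)/2}$ be the (nonzero) quadratic residues modulo $p$, represented as integers in increasing order, $1=q_0<q_1<\cdots<q_{(p-3)/2}\le p-1$. The sequence $(t_n)_{n\ge 0}$ with values in $\{0,1\}=\mathbb{F}_2$ is defined by $t_n=1$ if $q_{n+1}=q_n+1$ and $t_n=0$ if $q_{n+1}\ne q_n+1$, for $n=0,1,\ldots,(p-5)/2$, and is continued periodically by $t_{n+(p-3)/2}=t_n$ for all $n\ge 0$. For a positive integer $N$, the $N$th maximum order complexity $M(s_n,N)$ of a binary sequence $(s_n)_{n\ge 0}$ is the smallest positive integer $M$ for which there is a mapping $f:\mathbb{F}_2^M\to\mathbb{F}_2$ with $s_{n+M}=f(s_{n+M-1},\ldots,s_n)$ for $n=0,1,\ldots,N-M-1$. $O(1)$ denotes a quantity bounded in absolute value by an absolute constant (independent of $p$ and $N$); that is, the claim says there is an absolute constant $c>0$ such that the bound holds with $O(1)$ replaced by $-c$. $\log$ is the natural logarithm. *)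

theory Defs
  imports Complex_Main "HOL-Library.Z2" "HOL-Number_Theory.Residues"
begin

definition quad_residues :: "nat \<Rightarrow> nat set" where
  "quad_residues p = {q. 0 < q \<and> q < p \<and> QuadRes (int p) (int q)}"

(* For an odd prime p there are (p - 1) div 2 quadratic residues, so the
   list index below is meaningful for n \<le> (p - 3) div 2. *)
definition qres :: "nat \<Rightarrow> nat \<Rightarrow> nat" where
  "qres p n = sorted_list_of_set (quad_residues p) ! n"

(* Reducing the index modulo the period (p - 3) div 2 gives the periodic
   continuation; only qres p 0, ..., qres p ((p - 3) div 2) are then used.
   The type bit is the field with two elements. *)
definition tseq :: "nat \<Rightarrow> nat \<Rightarrow> bit" where
  "tseq p n = (let k = n mod ((p - 3) div 2) in
     if qres p (k + 1) = qres p k + 1 then 1 else 0)"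

(* The list argument of f is (s (n+M-1), ..., s n), which always has length M;
   values of f on lists of other lengths play no role.  For M \<ge> N
   the recurrence condition is vacuous, so the minimum exists and is at most N
   whenever N is positive. *)
definition max_order_complexity :: "(nat \<Rightarrow> bit) \<Rightarrow> nat \<Rightarrow> nat" where
  "max_order_complexity s N =
     (LEAST M. 0 < M \<and>
        (\<exists>f :: bit list \<Rightarrow> bit. \<forall>n. n + M < N \<longrightarrow>
            s (n + M) = f (map (\<lambda>i. s (n + i)) (rev [0..<M]))))"

end

theory Submission
  imports
    Defs
    "Berlekamp_Zassenhaus.Finite_Field"
    "HOL-Algebra.Algebraic_Closure_Type"
    "HOL-Analysis.FPS_Convergence"
    "HOL-Analysis.Harmonic_Numbers"
    "HOL-Number_Theory.Euler_Criterion"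
begin

hide_const (open) Divisibility.prime Divisibility.irreducible Polynomials.degree
  Polynomials.lead_coeff up_ring.monom up_ring.coeff

text \<open>
  A low complexity forces a long constant stretch. Suppose that the first \<open>N\<close> terms obey a
  recurrence of order \<open>M\<close> and contain \<open>M + 1\<close> consecutive ones. Then the feedback function sends
  the all-ones state to one, so every later term among the first \<open>N\<close> is one as well. A term is
  one exactly when two neighbouring quadratic residues differ by one; hence \<open>M + 1\<close> consecutive
  ones come from \<open>M + 2\<close> consecutive integers that are all residues, and a long stretch of ones
  is a long interval of residues. So two facts about residues are needed. If \<open>2 ^ m * m\<close> times
  \<open>sqrt p * log p\<close> is small compared with \<open>N\<close>, then a run of \<open>m\<close> consecutive residues starts
  below \<open>N / 2\<close> (\<open>consecutive_residues_exist\<close>). And no run of residues is longer than a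
  constant times \<open>sqrt p * log p\<close> (\<open>residue_run_length\<close>). The second fact contradicts the long
  stretch that the first one would produce for a small \<open>M\<close>. So \<open>N\<close> is at most a constant times
  \<open>2 ^ M * M * sqrt p * log p\<close> (\<open>max_order_complexity_tseq_exp\<close>), and one may take \<open>M\<close> to be at
  most of order \<open>log p\<close>; the logarithm of this inequality is the theorem.

  Both facts follow from the estimate \<open>incomplete_legendre_sum\<close> for sums of
  \<open>\<Prod>s\<in>A. Legendre (x + s) p\<close> over an initial interval: the indicator of a run of residues expands
  into such products. Fourier inversion on the interval, at the price of a factor \<open>log p\<close>, reduces
  the estimate to complete sums twisted by an additive character, for which \<open>hybrid_weil\<close> gives
  the bound \<open>card A * sqrt p\<close>.

  This bound is a case of Weil's theorem, proved here by elementary means. The hybrid character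
  extends to a completely multiplicative function on the monic polynomials over the field with
  \<open>p\<close> elements. Its generating function \<open>L\<close> is a polynomial of degree at most \<open>card A\<close>
  (\<open>coeff_sum_hybrid_eq_0\<close>), and the sum in question is its linear coefficient. So it is enough
  that the zeros of \<open>L\<close> have absolute value at least \<open>1 / sqrt p\<close>. By the Euler product
  (\<open>euler_product_identity\<close>) the coefficients of the logarithmic derivative are sums over prime
  powers of degree \<open>k\<close>, which count, with character values as weights, the elements of the field
  with \<open>p ^ k\<close> elements by quadratic character and trace. For even \<open>k = 2 * e\<close> the method of
  Stepanov and Bombieri gives a nonzero polynomial of degree \<open>p ^ (2 * e - 1) / 2 + O(p ^ e)\<close>
  that vanishes on all elements with a given character and trace (\<open>stepanov_polynomial\<close>). There
  are \<open>2 * p\<close> such classes and almost \<open>p ^ (2 * e)\<close> elements in them, so that no class can fall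
  much below the average either, and the power sum of index \<open>2 * e\<close> is \<open>O(p ^ e)\<close>
  (\<open>prime_power_sum_hybrid_bound\<close>). This growth rate excludes zeros of \<open>L\<close> of smaller absolute
  value (\<open>log_derivative_no_small_root\<close>).
\<close>

section \<open>Roots of irreducible polynomials over a prime field\<close>

definition ac_eval :: "'a::field poly \<Rightarrow> 'a alg_closure \<Rightarrow> 'a alg_closure" where
  "ac_eval g b = poly (map_poly to_ac g) b"

interpretation to_ac_hom: field_hom "to_ac :: 'a::field \<Rightarrow> 'a alg_closure"
  by unfold_locales auto

interpretation to_ac_poly_hom: map_poly_inj_idom_hom "to_ac :: 'a::field \<Rightarrow> 'a alg_closure" ..

lemma ac_eval_simps [simp]:
  "ac_eval 0 b = 0" "ac_eval 1 b = 1" "ac_eval [:0, 1:] b = b"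
  "ac_eval [:c, 1:] b = to_ac c + b" "ac_eval [:c:] b = to_ac c"
  "ac_eval (g + h) b = ac_eval g b + ac_eval h b"
  "ac_eval (g - h) b = ac_eval g b - ac_eval h b"
  "ac_eval (- g) b = - ac_eval g b"
  "ac_eval (g * h) b = ac_eval g b * ac_eval h b"
  "ac_eval (g ^ n) b = ac_eval g b ^ n"
  "ac_eval (smult c g) b = to_ac c * ac_eval g b"
  "ac_eval (monom c n) b = to_ac c * b ^ n"
  by (simp_all add: ac_eval_def hom_distribs poly_monom)

lemma ac_eval_sum: "ac_eval (sum g A) b = (\<Sum>i\<in>A. ac_eval (g i) b)"
  by (induction A rule: infinite_finite_induct) auto

lemma ac_eval_prod: "ac_eval (prod g A) b = (\<Prod>i\<in>A. ac_eval (g i) b)"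
  by (induction A rule: infinite_finite_induct) auto

lemma degree_pos_of_prime:
  fixes P :: "'a::field_gcd poly"
  assumes "prime P"
  shows "degree P > 0"
proof (rule ccontr)
  have "P \<noteq> 0" using assms by auto
  moreover have "\<not> is_unit P" using assms not_prime_unit[of P] by fast
  ultimately show "\<not> degree P > 0 \<Longrightarrow> False"
    using is_unit_iff_degree[of P] by (simp only: not_gr0 simp_thms)
qed

lemma prime_poly_ac_root_ex:
  fixes P :: "'a::field_gcd poly"
  assumes "prime P"
  shows "\<exists>b. ac_eval P b = 0"
proof -
  have "degree P > 0" using assms by (rule degree_pos_of_prime)
  hence "degree (map_poly to_ac P) > 0" by simp
  thus ?thesis unfolding ac_eval_def by (rule alg_closed_imp_poly_has_root)
qed

text \<open>A root determines its minimal polynomial: if \<open>P\<close> did not divide \<open>W\<close>, a Bezout combination of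
  the two would equal 1 and vanish at \<open>b\<close>.\<close>

lemma prime_poly_dvd_iff_ac_root:
  fixes P W :: "'a::field_gcd poly"
  assumes "prime P" "ac_eval P b = 0"
  shows "P dvd W \<longleftrightarrow> ac_eval W b = 0"
proof
  assume "P dvd W"
  thus "ac_eval W b = 0" using assms by (auto elim!: dvdE)
next
  assume W: "ac_eval W b = 0"
  show "P dvd W"
  proof (rule ccontr)
    assume "\<not> P dvd W"
    hence "coprime P W" using assms by (metis prime_imp_coprime)
    hence "fst (bezout_coefficients P W) * P + snd (bezout_coefficients P W) * W = 1"
      by (simp add: bezout_coefficients_fst_snd)
    hence "ac_eval (fst (bezout_coefficients P W) * P + snd (bezout_coefficients P W) * W) b = 1"
      by simp
    thus False using W assms by simp
  qed
qed

lemma prime_poly_monic: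
  fixes P :: "'a::field_gcd poly"
  assumes "prime P"
  shows "lead_coeff P = 1" "degree P > 0"
proof -
  have P: "normalize P = P" "P \<noteq> 0" using assms normalize_prime[of P] by auto
  show "degree P > 0" using assms by (rule degree_pos_of_prime)
  have "lead_coeff P = lead_coeff P div unit_factor (lead_coeff P)"
    using arg_cong[OF P(1), of "\<lambda>g. coeff g (degree P)"] by (simp only: coeff_normalize)
  also have "unit_factor (lead_coeff P) = lead_coeff P"
  proof -
    have "normalize (lead_coeff P) = 1"
      by (rule is_unit_normalize) (use P in \<open>simp only: dvd_field_iff leading_coeff_0_iff simp_thms\<close>)
    thus ?thesis using unit_factor_mult_normalize[of "lead_coeff P"] by (simp only: mult_1_right)
  qed
  also have "lead_coeff P div lead_coeff P = 1" using P by simp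
  finally show "lead_coeff P = 1" .
qed

lemma mod_ring_power_card_power [simp]: "(x :: 'a::prime_card mod_ring) ^ (CARD('a) ^ n) = x"
  using finite_field_power_card_power_eq_same[of "CARD('a) ^ n" n x] by simp

lemma ac_frobenius_add:
  "(x + y :: 'a::prime_card mod_ring alg_closure) ^ (CARD('a) ^ n) = x ^ (CARD('a) ^ n) + y ^ (CARD('a) ^ n)"
  by (rule freshmans_dream') (auto simp: prime_card)

lemma ac_frobenius_sum:
  "(\<Sum>i\<in>A. f i :: 'a::prime_card mod_ring alg_closure) ^ (CARD('a) ^ n) = (\<Sum>i\<in>A. f i ^ (CARD('a) ^ n))"
  by (rule freshmans_dream_sum') (auto simp: prime_card)

lemma ac_frobenius_eval:
  fixes g :: "'a::prime_card mod_ring poly"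
  shows "ac_eval g b ^ (CARD('a) ^ n) = ac_eval g (b ^ (CARD('a) ^ n))"
proof (induction g)
  case (pCons c g)
  have "ac_eval (pCons c g) x = to_ac c + x * ac_eval g x" for x
    by (simp add: ac_eval_def hom_distribs)
  thus ?case using pCons
    by (simp add: ac_frobenius_add power_mult_distrib flip: to_ac_power)
qed auto

lemma ac_frobenius_inj:
  fixes x y :: "'a::prime_card mod_ring alg_closure"
  assumes "x ^ (CARD('a) ^ n) = y ^ (CARD('a) ^ n)"
  shows "x = y"
proof -
  have "(x - y) ^ (CARD('a) ^ n) + y ^ (CARD('a) ^ n) = x ^ (CARD('a) ^ n)"
    by (simp flip: ac_frobenius_add)
  hence "(x - y) ^ (CARD('a) ^ n) = 0" using assms by simp
  thus ?thesis by simp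
qed

lemma card_polys_degree_less:
  "finite {g :: 'a::{finite,comm_ring_1} poly. degree g < n \<or> g = 0}"
  "card {g :: 'a::{finite,comm_ring_1} poly. degree g < n \<or> g = 0} = CARD('a) ^ n"
proof -
  let ?A = "\<lambda>n. {g :: 'a poly. degree g < n \<or> g = 0}"
  have *: "?A (Suc n) = (\<lambda>(c, g). pCons c g) ` (UNIV \<times> ?A n)" for n
  proof safe
    fix g :: "'a poly" assume g: "degree g < Suc n" 
    show "g \<in> (\<lambda>(c, g). pCons c g) ` (UNIV \<times> ?A n)"
      using g by (cases g) (auto simp: image_iff split: if_splits)
  qed (auto simp: image_iff intro: exI[of _ 0] split: if_splits)
  have "finite (?A n) \<and> card (?A n) = CARD('a) ^ n"
  proof (induction n)
    case (Suc n)
    have "inj_on (\<lambda>(c, g). pCons c g) (UNIV \<times> ?A n)" by (auto simp: inj_on_def)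
    thus ?case using Suc by (simp add: * card_image card_cartesian_product)
  qed auto
  thus "finite (?A n)" "card (?A n) = CARD('a) ^ n" by auto
qed

text \<open>The values at \<open>b\<close> of the polynomials of degree below \<open>degree P\<close> are pairwise distinct, and all of
  them are fixed by the Frobenius power that fixes \<open>b\<close>. Such fixed points are zeros of a polynomial
  of degree \<open>p ^ s\<close>, so there are at most \<open>p ^ s\<close> of them.\<close>

lemma prime_poly_root_fixed_degree:
  fixes P :: "'a::prime_card mod_ring poly"
  assumes P: "prime P" "ac_eval P b = 0" and s: "s > 0" "b ^ (CARD('a) ^ s) = b"
  shows "degree P \<le> s"
proof -
  let ?A = "{g :: 'a mod_ring poly. degree g < degree P \<or> g = 0}"
  have p: "CARD('a) > 1" using prime_card[where ?'a='a] prime_gt_1_nat by blast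
  have "inj_on (\<lambda>g. ac_eval g b) ?A"
  proof (rule inj_onI)
    fix g h assume gh: "g \<in> ?A" "h \<in> ?A" "ac_eval g b = ac_eval h b"
    hence "P dvd g - h" using prime_poly_dvd_iff_ac_root[OF P, of "g - h"] by simp
    moreover have "g - h = 0 \<or> degree (g - h) < degree P"
      using gh degree_diff_less[of g "degree P" h] by auto
    ultimately have "g - h = 0" using dvd_imp_degree_le[of P "g - h"] by fastforce
    thus "g = h" by simp
  qed
  hence "card ((\<lambda>g. ac_eval g b) ` ?A) = CARD('a) ^ degree P"
    by (simp add: card_image card_polys_degree_less)
  moreover let ?X = "monom 1 (CARD('a) ^ s) - [:0, 1:] :: 'a mod_ring alg_closure poly"
  have ps: "1 < CARD('a) ^ s" using one_less_power[OF p s(1)] .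
  have cX: "coeff ?X (CARD('a) ^ s) = 1"
    using ps by (simp add: coeff_eq_0 del: one_less_power One_nat_def)
  have "?X \<noteq> 0" using cX by (metis coeff_0 zero_neq_one)
  moreover have "degree ?X \<le> CARD('a) ^ s"
    by (rule order.trans[OF degree_diff_le_max]) (use ps in \<open>auto simp: degree_monom_eq\<close>)
  moreover have "(\<lambda>g. ac_eval g b) ` ?A \<subseteq> {x. poly ?X x = 0}"
    using s by (auto simp: poly_monom ac_frobenius_eval)
  hence "card ((\<lambda>g. ac_eval g b) ` ?A) \<le> card {x. poly ?X x = 0}"
    by (intro card_mono poly_roots_finite \<open>?X \<noteq> 0\<close>)
  ultimately have "CARD('a) ^ degree P \<le> CARD('a) ^ s"
    using card_poly_roots_bound[of ?X] by simp
  thus ?thesis using p by simp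
qed

text \<open>The roots of \<open>P\<close> are the Frobenius conjugates of one root. Since \<open>P\<close> has at most \<open>degree P\<close>
  roots, the first \<open>degree P + 1\<close> conjugates contain a repetition; by the previous lemma the only
  possible one is the return to \<open>b\<close> itself, so the first \<open>degree P\<close> conjugates are distinct.\<close>

lemma prime_poly_conjugates:
  fixes P :: "'a::prime_card mod_ring poly"
  assumes P: "prime P" "ac_eval P b = 0"
  shows "b ^ (CARD('a) ^ degree P) = b"
    and "map_poly to_ac P = (\<Prod>j<degree P. [:- (b ^ (CARD('a) ^ j)), 1:])"
proof -
  define r where "r = degree P"
  have r: "r > 0" unfolding r_def using prime_poly_monic[OF P(1)] by auto
  have min: "j - i \<ge> r" if "i < j" "b ^ (CARD('a) ^ i) = b ^ (CARD('a) ^ j)" for i j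
  proof -
    have "(b ^ (CARD('a) ^ (j - i))) ^ (CARD('a) ^ i) = b ^ (CARD('a) ^ ((j - i) + i))"
      unfolding power_add power_mult ..
    also have "(j - i) + i = j" using that(1) by simp
    also note that(2)[symmetric]
    finally have "b ^ (CARD('a) ^ (j - i)) = b" by (rule ac_frobenius_inj)
    thus ?thesis unfolding r_def using prime_poly_root_fixed_degree[OF P, of "j - i"] that by simp
  qed
  have root: "poly (map_poly to_ac P) (b ^ (CARD('a) ^ j)) = 0" for j
    using ac_frobenius_eval[of P b j] P by (simp add: ac_eval_def zero_power)
  have P0: "map_poly to_ac P \<noteq> 0" using P by auto
  have "\<not> inj_on (\<lambda>j. b ^ (CARD('a) ^ j)) {..r}"
  proof
    assume "inj_on (\<lambda>j. b ^ (CARD('a) ^ j)) {..r}"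
    hence "card ((\<lambda>j. b ^ (CARD('a) ^ j)) ` {..r}) = Suc r" by (simp add: card_image)
    moreover have "card ((\<lambda>j. b ^ (CARD('a) ^ j)) ` {..r}) \<le> card {x. poly (map_poly to_ac P) x = 0}"
      by (intro card_mono poly_roots_finite P0) (auto simp: root)
    ultimately show False using card_poly_roots_bound[OF P0] by (simp add: r_def)
  qed
  then obtain i' j' where "i' \<noteq> j'" "i' \<le> r" "j' \<le> r" "b ^ (CARD('a) ^ i') = b ^ (CARD('a) ^ j')"
    unfolding inj_on_def by auto
  hence "\<exists>i j. i < j \<and> j \<le> r \<and> b ^ (CARD('a) ^ i) = b ^ (CARD('a) ^ j)"
    by (metis linorder_neqE_nat)
  then obtain i j where ij: "i < j" "j \<le> r" "b ^ (CARD('a) ^ i) = b ^ (CARD('a) ^ j)" by blast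
  have "i = 0" "j = r" using min[OF ij(1,3)] ij(1,2) by linarith+
  with ij(3) have "b = b ^ (CARD('a) ^ r)" by (simp only: power_0 power_one_right)
  thus "b ^ (CARD('a) ^ degree P) = b" unfolding r_def by (rule sym)
  have inj: "inj_on (\<lambda>j. b ^ (CARD('a) ^ j)) {..<r}"
  proof (rule inj_onI)
    fix i j assume ij: "i \<in> {..<r}" "j \<in> {..<r}" "b ^ (CARD('a) ^ i) = b ^ (CARD('a) ^ j)"
    have "\<not> i < j" using min[OF _ ij(3)] ij(2) by fastforce
    moreover have "\<not> j < i" using min[OF _ ij(3)[symmetric]] ij(1) by fastforce
    ultimately show "i = j" by simp
  qed
  let ?R = "\<Prod>j<r. [:- (b ^ (CARD('a) ^ j)), 1:]"
  have degR: "degree ?R = r" by (subst degree_prod_eq_sum_degree) auto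
  have lR: "lead_coeff ?R = 1" by (simp add: lead_coeff_prod)
  show "map_poly to_ac P = (\<Prod>j<degree P. [:- (b ^ (CARD('a) ^ j)), 1:])"
  proof (rule ccontr)
    assume neq: "map_poly to_ac P \<noteq> (\<Prod>j<degree P. [:- (b ^ (CARD('a) ^ j)), 1:])"
    (* Both sides are monic of degree r, so a nonzero difference has degree below r, yet it
       vanishes at r distinct conjugates. *)
    let ?D = "map_poly to_ac P - ?R"
    have D: "?D \<noteq> 0" using neq by (simp add: r_def)
    have lP: "lead_coeff P = 1" using prime_poly_monic[OF P(1)] by simp
    have "degree ?D < r"
    proof (rule degree_lessI)
      show "?D \<noteq> 0 \<or> 0 < r" using r by simp
      show "\<forall>k\<ge>r. coeff ?D k = 0"
      proof safe
        fix k assume "k \<ge> r"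
        show "coeff ?D k = 0"
        proof (cases "k = r")
          case True thus ?thesis using lP lR degR by (simp add: coeff_map_poly r_def)
        next
          case False hence "k > r" using \<open>k \<ge> r\<close> by simp
          thus ?thesis using degR by (simp add: coeff_map_poly coeff_eq_0 r_def)
        qed
      qed
    qed
    moreover have "(\<lambda>j. b ^ (CARD('a) ^ j)) ` {..<r} \<subseteq> {x. poly ?D x = 0}"
      by (auto simp: root poly_prod)
    hence "card ((\<lambda>j. b ^ (CARD('a) ^ j)) ` {..<r}) \<le> card {x. poly ?D x = 0}"
      by (intro card_mono poly_roots_finite D)
    ultimately show False using card_poly_roots_bound[OF D] inj by (simp add: card_image)
  qed
qed

section \<open>The quadratic character\<close>

definition qchar :: "'a::prime_card mod_ring \<Rightarrow> int" where
  "qchar v = Legendre (to_int_mod_ring v) (int CARD('a))"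

lemma of_int_to_int_mod_ring [simp]: "of_int (to_int_mod_ring v) = (v :: 'a::prime_card mod_ring)"
  by (simp add: of_int_of_int_mod_ring)

lemma mod_ring_of_int_eq_iff:
  "of_int x = (of_int y :: 'a::prime_card mod_ring) \<longleftrightarrow> [x = y] (mod int CARD('a))"
  using of_int_eq_iff_cong_CHAR[where ?'a="'a mod_ring", of x y] by simp

lemma qchar_cases: "qchar v \<in> {-1, 0, 1}"
  by (auto simp: qchar_def Legendre_def)

lemma of_int_qchar:
  fixes v :: "'a::prime_card mod_ring"
  assumes "CARD('a) > 2"
  shows "of_int (qchar v) = v ^ ((CARD('a) - 1) div 2)"
proof -
  have "[qchar v = to_int_mod_ring v ^ ((CARD('a) - 1) div 2)] (mod int CARD('a))"
    unfolding qchar_def by (rule euler_criterion[OF prime_card assms])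
  hence "of_int (qchar v) = (of_int (to_int_mod_ring v ^ ((CARD('a) - 1) div 2)) :: 'a mod_ring)"
    by (simp only: mod_ring_of_int_eq_iff)
  thus ?thesis by simp
qed

text \<open>Euler's criterion evaluates the character only inside the field; since the characteristic exceeds
  2, an integer from \<open>{-1, 0, 1}\<close> can be read off from its residue class.\<close>

lemma mod_ring_of_int_inj_unit:
  assumes "CARD('a::prime_card) > 2" "x \<in> {-1, 0, 1}" "y \<in> {-1, 0, 1}"
    "of_int x = (of_int y :: 'a mod_ring)"
  shows "x = (y :: int)"
proof -
  have "int CARD('a) dvd x - y" using assms(4) by (simp only: mod_ring_of_int_eq_iff cong_iff_dvd_diff)
  moreover have "\<bar>x - y\<bar> < int CARD('a)" using assms(1-3) by auto
  ultimately show ?thesis using dvd_imp_le_int[of "x - y" "int CARD('a)"] by force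
qed

lemma qchar_mult:
  fixes v w :: "'a::prime_card mod_ring"
  assumes "CARD('a) > 2"
  shows "qchar (v * w) = qchar v * qchar w"
proof (rule mod_ring_of_int_inj_unit[OF assms])
  show "of_int (qchar (v * w)) = (of_int (qchar v * qchar w) :: 'a mod_ring)"
    by (simp add: of_int_qchar[OF assms] power_mult_distrib)
  show "qchar v * qchar w \<in> {-1, 0, 1}" using qchar_cases[of v] qchar_cases[of w] by auto
qed (rule qchar_cases)

lemma qchar_0 [simp]: "qchar (0 :: 'a::prime_card mod_ring) = 0"
  by (simp add: qchar_def Legendre_def)

lemma qchar_eq_0_iff [simp]: "qchar (v :: 'a::prime_card mod_ring) = 0 \<longleftrightarrow> v = 0"
proof -
  have "[to_int_mod_ring v = 0] (mod int CARD('a)) \<longleftrightarrow> v = 0"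
    using mod_ring_of_int_eq_iff[of "to_int_mod_ring v" 0, where ?'a='a] by simp
  thus ?thesis by (simp add: qchar_def Legendre_def)
qed

lemma qchar_1 [simp]:
  assumes "CARD('a::prime_card) > 2"
  shows "qchar (1 :: 'a mod_ring) = 1"
  by (rule mod_ring_of_int_inj_unit[OF assms qchar_cases]) (simp_all add: of_int_qchar[OF assms])

lemma odd_CARD: "CARD('a::prime_card) > 2 \<Longrightarrow> odd CARD('a)"
  using prime_odd_nat[OF prime_card[where ?'a='a]] by simp

text \<open>Otherwise the \<open>p - 1\<close> nonzero elements would all be roots of \<open>x ^ ((p - 1) / 2) - 1\<close>.\<close>

lemma qchar_nonresidue_ex:
  assumes "CARD('a::prime_card) > 2"
  shows "\<exists>w :: 'a mod_ring. qchar w = -1"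
proof (rule ccontr)
  assume neg: "\<nexists>w :: 'a mod_ring. qchar w = -1"
  define h where "h = (CARD('a) - 1) div 2"
  have h: "h > 0" "h < CARD('a) - 1" using assms by (auto simp: h_def)
  let ?X = "monom 1 h - 1 :: 'a mod_ring poly"
  have ch: "coeff ?X h = 1" using h by simp
  hence X0: "?X \<noteq> 0" by (metis coeff_0 zero_neq_one)
  have deg: "degree ?X \<le> h" by (rule degree_diff_le) (auto simp: degree_monom_le)
  have "UNIV - {0} \<subseteq> {x. poly ?X x = 0}"
  proof
    fix x :: "'a mod_ring" assume "x \<in> UNIV - {0}"
    hence "qchar x = 1" using neg qchar_cases[of x] by auto
    thus "x \<in> {x. poly ?X x = 0}" using of_int_qchar[OF assms, of x] by (simp add: poly_monom h_def)
  qed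
  hence "card (UNIV - {0 :: 'a mod_ring}) \<le> card {x. poly ?X x = 0}"
    by (intro card_mono poly_roots_finite X0)
  thus False using card_poly_roots_bound[OF X0] deg h by (simp add: card_Diff_subset)
qed

lemma sum_qchar:
  assumes "CARD('a::prime_card) > 2"
  shows "(\<Sum>v\<in>UNIV. qchar (v :: 'a mod_ring)) = 0"
proof -
  obtain w :: "'a mod_ring" where w: "qchar w = -1" using qchar_nonresidue_ex[OF assms] by auto
  have w0: "w \<noteq> 0" using w by auto
  have "(\<Sum>v\<in>UNIV. qchar (v :: 'a mod_ring)) = (\<Sum>v\<in>UNIV. qchar (w * v))"
    by (rule sum.reindex_bij_witness[of _ "\<lambda>v. w * v" "\<lambda>v. v / w"]) (use w0 in auto)
  also have "\<dots> = - (\<Sum>v\<in>UNIV. qchar (v :: 'a mod_ring))"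
    by (simp add: qchar_mult[OF assms] w sum_negf)
  finally show ?thesis by simp
qed

section \<open>Traces and norms of roots\<close>

text \<open>Reflection turns the coefficient below the leading one, which is the negated sum of the roots, into
  the linear coefficient; this spares a case distinction for constant polynomials.\<close>

lemma coeff_1_prod_reflected_linear:
  "coeff (\<Prod>i<(n::nat). [:1, c i:] :: 'a::comm_ring_1 poly) 1 = (\<Sum>i<n. c i)"
proof -
  have "coeff (\<Prod>i<n. [:1, c i:]) 1 = (\<Sum>i<n. c i) \<and> coeff (\<Prod>i<n. [:1, c i:]) 0 = 1"
    by (induction n) (simp_all add: coeff_mult coeff_pCons atMost_Suc algebra_simps)
  thus ?thesis ..
qed

lemma reflect_linear: "reflect_poly [:c, 1:] = [:1, c :: 'a::comm_ring_1:]"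
  by (rule poly_eqI) (auto simp: coeff_reflect_poly coeff_pCons split: nat.splits)

lemma sum_conjugates_period:
  fixes g :: "nat \<Rightarrow> 'b::comm_semiring_1"
  assumes "\<And>i. g (i + r) = g i"
  shows "(\<Sum>i<j * r. g i) = of_nat j * (\<Sum>i<r. g i)"
proof -
  have g: "g (i + k * r) = g i" for i k
    by (induction k) (simp_all add: assms flip: add.assoc add: add.commute[of r])
  have "(\<Sum>i\<in>{k * r..<k * r + r}. g i) = (\<Sum>i<r. g i)" for k
  proof (rule sum.reindex_bij_witness[of _ "\<lambda>i. i + k * r" "\<lambda>i. i - k * r"])
    fix i assume "i \<in> {k * r..<k * r + r}"
    thus "g (i - k * r) = g i" using g[of "i - k * r" k] by simp
  qed auto
  thus ?thesis by (simp flip: sum.nat_group)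
qed

lemma prod_conjugates_period:
  fixes g :: "nat \<Rightarrow> 'b::comm_semiring_1"
  assumes "\<And>i. g (i + r) = g i"
  shows "(\<Prod>i<j * r. g i) = (\<Prod>i<r. g i) ^ j"
proof -
  have g: "g (i + k * r) = g i" for i k
    by (induction k) (simp_all add: assms flip: add.assoc add: add.commute[of r])
  have "(\<Prod>i\<in>{k * r..<k * r + r}. g i) = (\<Prod>i<r. g i)" for k
  proof (rule prod.reindex_bij_witness[of _ "\<lambda>i. i + k * r" "\<lambda>i. i - k * r"])
    fix i assume "i \<in> {k * r..<k * r + r}"
    thus "g (i - k * r) = g i" using g[of "i - k * r" k] by simp
  qed auto
  thus ?thesis by (simp flip: prod.nat_group)
qed

lemma geometric_sum_half:
  fixes p n :: nat
  assumes "p > 1" "odd p"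
  shows "((p - 1) div 2) * (\<Sum>i<n. p ^ i) = (p ^ n - 1) div 2"
proof -
  have e: "even (p - 1)" using assms by simp
  have "(p - 1) * (\<Sum>i<n. p ^ i) = p ^ n - 1"
  proof (induction n)
    case (Suc n)
    have "p ^ n \<ge> 1" using assms by simp
    thus ?case using Suc assms by (simp add: algebra_simps)
  qed auto
  hence "(p ^ n - 1) div 2 = ((p - 1) * (\<Sum>i<n. p ^ i)) div 2" by simp
  also have "\<dots> = (p - 1) div 2 * (\<Sum>i<n. p ^ i)" using e by (rule dvd_div_mult[symmetric])
  finally show ?thesis by simp
qed

text \<open>A root \<open>b\<close> of \<open>P\<close> lies in the field with \<open>p ^ n\<close> elements, and its orbit under Frobenius is run
  through \<open>j\<close> times by \<open>n\<close> applications of Frobenius. Trace and norm to the prime field are therefore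
  \<open>j\<close>-fold sums and \<open>j\<close>-th powers of symmetric functions of the roots of \<open>P\<close>, that is, of
  coefficients and values of \<open>P\<close>.\<close>

context
  fixes P :: "'a::prime_card mod_ring poly" and b :: "'a mod_ring alg_closure" and j n :: nat
  assumes P: "prime P" "ac_eval P b = 0" and jn: "j * degree P = n"
begin

lemma prime_poly_root_period: "b ^ (CARD('a) ^ (i + degree P)) = b ^ (CARD('a) ^ i)"
proof -
  have "b ^ (CARD('a) ^ (i + degree P)) = (b ^ (CARD('a) ^ degree P)) ^ (CARD('a) ^ i)"
    by (simp only: power_add power_mult mult.commute flip: power_mult)
  thus ?thesis using prime_poly_conjugates(1)[OF P] by (simp only:)
qed

lemma prime_poly_root_frobenius: "b ^ (CARD('a) ^ n) = b"
proof -
  have "b ^ (CARD('a) ^ (k * degree P)) = b" for k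
  proof (induction k)
    case (Suc k)
    thus ?case using prime_poly_root_period[of "k * degree P"] by (simp add: add.commute)
  qed auto
  thus ?thesis using jn by metis
qed

lemma prime_poly_root_trace:
  "(\<Sum>i<n. b ^ (CARD('a) ^ i)) = to_ac (of_nat j * - coeff (reflect_poly P) 1)"
proof -
  have "coeff (reflect_poly (map_poly to_ac P)) 1 = to_ac (coeff (reflect_poly P) 1)"
    by (simp add: coeff_reflect_poly)
  also have "reflect_poly (map_poly to_ac P) = (\<Prod>i<degree P. [:1, - (b ^ (CARD('a) ^ i)):])"
    unfolding prime_poly_conjugates(2)[OF P] by (simp only: reflect_poly_prod reflect_linear)
  also have "coeff \<dots> 1 = - (\<Sum>i<degree P. b ^ (CARD('a) ^ i))"
    by (simp only: coeff_1_prod_reflected_linear sum_negf)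
  finally have *: "(\<Sum>i<degree P. b ^ (CARD('a) ^ i)) = to_ac (- coeff (reflect_poly P) 1)"
    by (metis add.inverse_inverse to_ac_minus)
  have "(\<Sum>i<n. b ^ (CARD('a) ^ i)) = of_nat j * (\<Sum>i<degree P. b ^ (CARD('a) ^ i))"
    unfolding jn[symmetric] by (rule sum_conjugates_period) (rule prime_poly_root_period)
  thus ?thesis by (simp add: *)
qed

text \<open>The exponent on the left factors as \<open>(p - 1) / 2\<close> times \<open>1 + p + \<dots> + p ^ (n - 1)\<close>. The second factor
  produces the norm of \<open>b + s\<close>, which is \<open>(\<Prod>i<degree P. b_i + s) ^ j\<close> for the conjugates \<open>b_i\<close>, and the
  first one applies Euler's criterion to it.\<close>

lemma prime_poly_root_norm:
  assumes "CARD('a) > 2"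
  shows "(b + to_ac s) ^ ((CARD('a) ^ n - 1) div 2) = to_ac (of_int (qchar ((-1) ^ degree P * poly P (-s)) ^ j))"
proof -
  have "to_ac ((-1) ^ degree P * poly P (-s)) = (-1) ^ degree P * poly (map_poly to_ac P) (to_ac (- s))"
    by (simp only: to_ac_hom.poly_map_poly to_ac_mult to_ac_power to_ac_minus[of 1] to_ac_1)
  also have "\<dots> = (\<Prod>i<degree P. b ^ (CARD('a) ^ i) + to_ac s)"
  proof -
    have "(-1) ^ degree P * (\<Prod>i<degree P. - (to_ac s) - b ^ (CARD('a) ^ i)) = 
      (\<Prod>i<degree P. (-1) * (- (to_ac s) - b ^ (CARD('a) ^ i)))"
      by (simp only: prod.distrib prod_constant card_lessThan)
    also have "(\<lambda>i. (-1) * (- (to_ac s) - b ^ (CARD('a) ^ i))) = (\<lambda>i. b ^ (CARD('a) ^ i) + to_ac s)"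
      by (auto simp: algebra_simps)
    finally show ?thesis
      by (simp add: prime_poly_conjugates(2)[OF P] poly_prod algebra_simps)
  qed
  finally have *: "(\<Prod>i<degree P. b ^ (CARD('a) ^ i) + to_ac s) = to_ac ((-1) ^ degree P * poly P (-s))" ..
  have "(b + to_ac s) ^ (\<Sum>i<n. CARD('a) ^ i) = (\<Prod>i<n. (b + to_ac s) ^ (CARD('a) ^ i))"
    by (simp only: power_sum)
  also have "\<dots> = (\<Prod>i<n. b ^ (CARD('a) ^ i) + to_ac s)"
    by (simp add: ac_frobenius_add flip: to_ac_power)
  also have "\<dots> = (\<Prod>i<degree P. b ^ (CARD('a) ^ i) + to_ac s) ^ j"
    unfolding jn[symmetric] by (rule prod_conjugates_period) (simp only: prime_poly_root_period)
  also note *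
  finally have **: "(b + to_ac s) ^ (\<Sum>i<n. CARD('a) ^ i) = to_ac ((-1) ^ degree P * poly P (-s)) ^ j" .
  have "(b + to_ac s) ^ ((CARD('a) ^ n - 1) div 2) = ((b + to_ac s) ^ (\<Sum>i<n. CARD('a) ^ i)) ^ ((CARD('a) - 1) div 2)"
    using assms odd_CARD[OF assms]
    by (subst geometric_sum_half[symmetric]) (simp_all only: power_mult[symmetric] mult.commute, simp)
  also have "\<dots> = to_ac ((((-1) ^ degree P * poly P (-s)) ^ ((CARD('a) - 1) div 2)) ^ j)"
    unfolding ** by (simp only: to_ac_power power_mult[symmetric] mult.commute)
  also have "\<dots> = to_ac (of_int (qchar ((-1) ^ degree P * poly P (-s)) ^ j))"
    by (simp only: of_int_qchar[OF assms, symmetric] of_int_power)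
  finally show ?thesis .
qed

end

section \<open>Leading forms\<close>

text \<open>This says that \<open>h\<close> has degree at most \<open>D - d\<close>. It is stated through coefficients because \<open>d\<close> may be
  negative or exceed \<open>D\<close>, and because the zero polynomial must be included.\<close>

definition lower_than :: "int \<Rightarrow> nat \<Rightarrow> 'a::comm_ring_1 poly \<Rightarrow> bool" where
  "lower_than d D h \<longleftrightarrow> (\<forall>k. int k + d > int D \<longrightarrow> coeff h k = 0)"

lemma lower_than_mono: "lower_than d D h \<Longrightarrow> d' \<le> d \<Longrightarrow> lower_than d' D h"
  by (auto simp: lower_than_def)

lemma lower_than_add: "lower_than d D h \<Longrightarrow> lower_than d D h' \<Longrightarrow> lower_than d D (h + h')"
  by (auto simp: lower_than_def)

lemma lower_than_sum: "(\<And>i. i \<in> A \<Longrightarrow> lower_than d D (h i)) \<Longrightarrow> lower_than d D (\<Sum>i\<in>A. h i)"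
  by (auto simp: lower_than_def coeff_sum intro!: sum.neutral)

lemma lower_than_mult:
  assumes "lower_than d D h" "lower_than d' D' h'"
  shows "lower_than (d + d') (D + D') (h * h')"
  unfolding lower_than_def
proof safe
  fix k assume k: "int k + (d + d') > int (D + D')"
  have "coeff h i * coeff h' (k - i) = 0" if "i \<le> k" for i
  proof (cases "int i + d > int D")
    case False
    hence "int (k - i) + d' > int D'" using k that by (simp add: of_nat_diff)
    thus ?thesis using assms(2) by (simp add: lower_than_def)
  qed (use assms(1) in \<open>simp add: lower_than_def\<close>)
  thus "coeff (h * h') k = 0" by (simp add: coeff_mult)
qed

lemma lower_than_monom_mult: "degree g \<le> a \<Longrightarrow> lower_than (- int a) D (monom 1 D * g)"
  by (auto simp: lower_than_def coeff_monom_mult coeff_eq_0)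

text \<open>The polynomial \<open>G\<close> is \<open>x ^ D * g\<close> up to terms of degree at most \<open>D - d\<close>. For positive \<open>d\<close> this fixes
  all coefficients of \<open>G\<close> from index \<open>D\<close> on: they are those of \<open>g\<close>. Products of such polynomials
  are governed by the products of their forms \<open>g\<close>, at the cost of a smaller gap \<open>d\<close>.\<close>

definition leading_form :: "int \<Rightarrow> nat \<Rightarrow> 'a::comm_ring_1 poly \<Rightarrow> 'a poly \<Rightarrow> bool" where
  "leading_form d D g G \<longleftrightarrow> lower_than d D (G - monom 1 D * g)"

lemma leading_form_self: "leading_form d 0 g g" "leading_form d D 1 (monom 1 D)"
  by (simp_all add: leading_form_def lower_than_def)

lemma leading_form_mult:
  assumes "leading_form d D g G" "leading_form d' D' g' G'"
    and "degree g \<le> a" "degree g' \<le> a'"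
    and "e \<le> d - int a'" "e \<le> d' - int a" "e \<le> d + d'"
  shows "leading_form e (D + D') (g * g') (G * G')"
proof -
  let ?h = "G - monom 1 D * g" and ?h' = "G' - monom 1 D' * g'"
  have "lower_than e (D + D') (?h * ?h')"
    using lower_than_mult[of d D ?h d' D' ?h'] assms by (auto simp: leading_form_def intro: lower_than_mono)
  moreover have "lower_than e (D + D') (?h * (monom 1 D' * g'))"
    using lower_than_mult[of d D ?h "- int a'" D' "monom 1 D' * g'"] assms
    by (auto simp: leading_form_def intro: lower_than_mono lower_than_monom_mult)
  moreover have "lower_than e (D + D') ((monom 1 D * g) * ?h')"
    using lower_than_mult[of "- int a" D "monom 1 D * g" d' D' ?h'] assms
    by (auto simp: leading_form_def intro: lower_than_mono lower_than_monom_mult)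
  ultimately have "lower_than e (D + D') (?h * ?h' + ?h * (monom 1 D' * g') + (monom 1 D * g) * ?h')"
    by (intro lower_than_add)
  also have "?h * ?h' + ?h * (monom 1 D' * g') + (monom 1 D * g) * ?h' =
    G * G' - monom 1 (D + D') * (g * g')"
  proof -
    have "monom 1 (D + D') = monom (1 :: 'a) D * monom 1 D'" by (simp add: mult_monom)
    thus ?thesis by (simp add: algebra_simps)
  qed
  finally show ?thesis by (simp add: leading_form_def)
qed

lemma leading_form_power_monic:
  assumes "leading_form d D 1 G" "0 \<le> d"
  shows "leading_form d (k * D) 1 (G ^ k)"
proof (induction k)
  case (Suc k)
  from leading_form_mult[OF assms(1) Suc, of 0 0 d] show ?case using assms(2) by simp
qed (use leading_form_self(1)[of d 1] in simp)

lemma leading_form_prod_monic: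
  assumes "finite A" "\<And>i. i \<in> A \<Longrightarrow> leading_form d D 1 (G i)" "0 \<le> d"
  shows "leading_form d (card A * D) 1 (\<Prod>i\<in>A. G i)"
  using assms(1,2)
proof (induction A rule: finite_induct)
  case (insert x A)
  have "leading_form d (D + card A * D) (1 * 1) (G x * (\<Prod>i\<in>A. G i))"
    using insert assms(3) by (intro leading_form_mult[where a = 0 and a' = 0]) auto
  thus ?case using insert by simp
qed (use leading_form_self(1)[of d 1] in simp)

text \<open>If the exponents of the basis elements \<open>Y K\<close> are spaced by \<open>E\<close> and the coefficients are short
  compared with \<open>E\<close>, then the terms of the sum do not interfere at the top, and the highest
  nonzero coefficient \<open>a K0\<close> is the form of the sum.\<close>

lemma leading_form_sum:
  fixes a :: "nat \<Rightarrow> 'a::comm_ring_1 poly"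
  assumes Y: "\<And>K. K < n \<Longrightarrow> leading_form d (K * E) 1 (Y K)"
    and a: "\<And>K. K < n \<Longrightarrow> degree (a K) \<le> t"
    and K0: "K0 < n" "\<And>K. K0 < K \<Longrightarrow> K < n \<Longrightarrow> a K = 0"
    and d: "0 \<le> d" "d \<le> int E"
  shows "leading_form (d - int t) (K0 * E) (a K0) (\<Sum>K<n. a K * Y K)"
proof -
  have l: "leading_form (d - int t) (K * E) (a K) (a K * Y K)" if "K < n" for K
    using leading_form_mult[OF leading_form_self(1)[of "d + int t" "a K"] Y[OF that] a[OF that], of 0 "d - int t"]
      d by simp
  have "lower_than (d - int t) (K0 * E) (a K * Y K)" if "K < n" "K \<noteq> K0" for K
  proof (cases "K < K0")
    case True
    have "lower_than (- int t) (K * E) (a K * Y K)"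
    proof -
      have "lower_than (- int t) (K * E) (a K * Y K - monom 1 (K * E) * a K)"
        using l[OF that(1)] d unfolding leading_form_def by (auto intro: lower_than_mono)
      from lower_than_add[OF this lower_than_monom_mult[OF a[OF that(1)]]] show ?thesis by simp
    qed
    moreover have "int (K * E) + int E \<le> int (K0 * E)"
    proof -
      have "Suc K * E \<le> K0 * E" using True by (intro mult_right_mono) auto
      thus ?thesis by (simp flip: of_nat_add of_nat_mult)
    qed
    ultimately show ?thesis using d unfolding lower_than_def by auto
  next
    case False
    hence "a K = 0" using K0(2) that by simp
    thus ?thesis by (simp add: lower_than_def)
  qed
  hence "lower_than (d - int t) (K0 * E) (\<Sum>K\<in>{..<n} - {K0}. a K * Y K)"
    by (intro lower_than_sum) auto
  moreover have "(\<Sum>K<n. a K * Y K) - monom 1 (K0 * E) * a K0 =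
    (\<Sum>K\<in>{..<n} - {K0}. a K * Y K) + (a K0 * Y K0 - monom 1 (K0 * E) * a K0)"
    using K0(1) by (simp add: sum.remove[of "{..<n}" K0])
  ultimately show ?thesis using l[OF K0(1)] unfolding leading_form_def by (simp only: lower_than_add)
qed

lemma leading_form_coeff:
  "leading_form d D g G \<Longrightarrow> d > 0 \<Longrightarrow> coeff G (D + k) = coeff g k"
  by (auto simp: leading_form_def lower_than_def coeff_monom_mult dest!: spec[of _ "D + k"])

lemma leading_form_degree:
  assumes "leading_form d D g G" "d > 0" "g \<noteq> 0"
  shows "degree G = D + degree g" "G \<noteq> 0"
proof -
  have c: "coeff G (D + degree g) \<noteq> 0" using leading_form_coeff[OF assms(1,2)] assms(3) by simp
  have "coeff G k = 0" if "k > D + degree g" for k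
    using leading_form_coeff[OF assms(1,2), of "k - D"] that by (simp add: coeff_eq_0)
  hence "degree G \<le> D + degree g" by (intro degree_le) auto
  thus "degree G = D + degree g" using le_degree[OF c] by simp
  show "G \<noteq> 0" using c by auto
qed

text \<open>Both descriptions give the degree of \<open>G\<close>; since the forms are shorter than \<open>E\<close>, division by \<open>E\<close>
  with remainder recovers the same multiple of \<open>E\<close> from it.\<close>

lemma leading_form_unique:
  assumes "leading_form d (u * E) g G" "leading_form d' (u' * E) g' G" "d > 0" "d' > 0"
    and "g \<noteq> 0" "g' \<noteq> 0" "degree g < E" "degree g' < E"
  shows "g = g'"
proof -
  have eq: "u * E + degree g = u' * E + degree g'"
    using leading_form_degree(1)[OF assms(1,3,5)] leading_form_degree(1)[OF assms(2,4,6)] by simp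
  have "u = (u * E + degree g) div E" using assms(7) by simp
  also have "\<dots> = u'" unfolding eq using assms(8) by simp
  finally have "u = u'" .
  show ?thesis
    by (rule poly_eqI) (metis assms(1,2,3,4) \<open>u = u'\<close> leading_form_coeff)
qed

text \<open>The order of vanishing at \<open>- s\<close> is odd on the left and even on the right.\<close>

lemma separable_times_square_neq_square:
  fixes S :: "'a::field set"
  assumes "finite S" "S \<noteq> {}" "a \<noteq> 0" "a' \<noteq> 0"
  shows "(\<Prod>s\<in>S. [:s, 1:]) * a\<^sup>2 \<noteq> a'\<^sup>2"
proof
  assume eq: "(\<Prod>s\<in>S. [:s, 1:]) * a\<^sup>2 = a'\<^sup>2"
  obtain s where s: "s \<in> S" using assms by auto
  have r: "(\<Prod>s\<in>S. [:s, 1:]) = [:- (-s), 1:] * (\<Prod>s\<in>S - {s}. [:s, 1:])"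
    using s assms by (simp add: prod.remove)
  have nz: "(\<Prod>s\<in>S - {s}. [:s, 1:]) \<noteq> 0" using assms(1) by auto
  have "poly (\<Prod>s\<in>S - {s}. [:s, 1:]) (-s) \<noteq> 0"
    using assms(1) by (auto simp: poly_prod)
  hence o0: "order (-s) (\<Prod>s\<in>S - {s}. [:s, 1:]) = 0" by (rule order_0I)
  have o1: "order (-s) [:- (-s), 1:] = 1" using order_power_n_n[of "-s" 1] by simp
  have "order (-s) (L * R * a\<^sup>2) = order (-s) L + order (-s) R + 2 * order (-s) a"
    if "L \<noteq> 0" "R \<noteq> 0" for L R
    using that assms(3) by (simp add: order_mult power2_eq_square)
  from this[OF _ nz, of "[:- (-s), 1:]"]
  have "order (-s) ((\<Prod>s\<in>S. [:s, 1:]) * a\<^sup>2) = 1 + 2 * order (-s) a"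
    unfolding r o0 o1 by (simp del: minus_minus)
  moreover have "order (-s) (a'\<^sup>2) = 2 * order (-s) a'"
    using assms(4) by (simp add: order_mult power2_eq_square)
  ultimately have "1 + 2 * order (-s) a = 2 * order (-s) a'" using eq by simp
  thus False by presburger
qed

section \<open>The auxiliary polynomial\<close>

definition linear_prod :: "'a::comm_ring_1 set \<Rightarrow> 'a poly" where
  "linear_prod S = (\<Prod>s\<in>S. [:s, 1:])"

text \<open>The first half of the trace from the field with \<open>p ^ (2 * e)\<close> elements: with \<open>Q = p ^ e\<close>, the
  trace of \<open>b\<close> is \<open>u + u ^ Q\<close>, where \<open>u\<close> is the value at \<open>b\<close>. So on elements of trace \<open>c\<close> the
  \<open>Q\<close>-th power of \<open>u\<close> is \<open>c - u\<close>.\<close>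

definition trace_poly :: "nat \<Rightarrow> 'a::prime_card mod_ring poly" where
  "trace_poly e = (\<Sum>i<e. monom 1 (CARD('a) ^ i))"

text \<open>These polynomials have degree \<open>K * p ^ (e - 1)\<close>, so that they are spread out evenly. Their
  \<open>Q\<close>-th powers, on the elements \<open>b\<close> with \<open>b ^ (Q * Q) = b\<close> and trace \<open>c\<close>, are values of
  \<open>(c - trace_poly e) ^ (K mod p) * x ^ (K div p)\<close>, which have a much smaller degree. This collapse
  is what makes the method work.\<close>

definition step_basis :: "nat \<Rightarrow> nat \<Rightarrow> 'a::prime_card mod_ring poly" where
  "step_basis e K = trace_poly e ^ (K mod CARD('a)) * monom 1 (CARD('a) ^ e * (K div CARD('a)))"

text \<open>Bombieri's form of the auxiliary polynomial, \<open>A + f ^ ((Q - 1) / 2) * B\<close> with \<open>f = linear_prod S\<close>,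
  where \<open>A\<close> and \<open>B\<close> have the coefficients \<open>a (False, K)\<close> and \<open>a (True, K)\<close> in the basis above.\<close>

definition step_poly ::
  "'a::prime_card mod_ring set \<Rightarrow> nat \<Rightarrow> nat \<Rightarrow> (bool \<times> nat \<Rightarrow> 'a mod_ring poly) \<Rightarrow> 'a mod_ring poly" where
  "step_poly S e n a = (\<Sum>K<n. a (False, K) * step_basis e K) +
     linear_prod S ^ ((CARD('a) ^ e - 1) div 2) * (\<Sum>K<n. a (True, K) * step_basis e K)"

lemma degree_linear_prod: "degree (linear_prod S) = card (S :: 'a::idom set)"
  by (simp add: linear_prod_def degree_prod_eq_sum_degree)

lemma linear_prod_nonzero [simp]: "linear_prod (S :: 'a::idom set) \<noteq> 0"
  by (cases "finite S") (simp_all add: linear_prod_def)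

lemma leading_form_sum_ex:
  fixes a :: "nat \<Rightarrow> 'a::comm_ring_1 poly"
  assumes Y: "\<And>K. K < n \<Longrightarrow> leading_form d (K * E) 1 (Y K)"
    and a: "\<And>K. K < n \<Longrightarrow> degree (a K) \<le> t"
    and nz: "\<exists>K<n. a K \<noteq> 0"
    and d: "0 \<le> d" "d \<le> int E"
  obtains K0 a0 where "a0 \<noteq> 0" "degree a0 \<le> t"
    "leading_form (d - int t) (K0 * E) a0 (\<Sum>K<n. a K * Y K)"
proof -
  let ?M = "{K. K < n \<and> a K \<noteq> 0}"
  have fin: "finite ?M" "?M \<noteq> {}" using nz by auto
  define K0 where "K0 = Max ?M"
  have K0: "K0 \<in> ?M" unfolding K0_def by (rule Max_in[OF fin])
  have mx: "a K = 0" if "K0 < K" "K < n" for K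
  proof (rule ccontr)
    assume "a K \<noteq> 0"
    hence "K \<le> K0" unfolding K0_def using that by (intro Max_ge fin) auto
    thus False using that by simp
  qed
  show ?thesis
    by (rule that[of "a K0" K0]) (use K0 a mx leading_form_sum[OF Y a _ mx d] in auto)
qed

lemma leading_form_trace_poly:
  assumes "e \<ge> 2"
  shows "leading_form (int (CARD('a) ^ (e - 1)) - int (CARD('a) ^ (e - 2))) (CARD('a) ^ (e - 1)) 1
    (trace_poly e :: 'a::prime_card mod_ring poly)"
proof -
  have p: "CARD('a) > 1" using prime_card[where ?'a='a] prime_gt_1_nat by blast
  obtain e' where e': "e = Suc (Suc e')" using assms by (metis Suc_le_D numeral_2_eq_2 Suc_le_mono)
  have "trace_poly e - monom 1 (CARD('a) ^ (e - 1)) = (\<Sum>i<Suc e'. monom 1 (CARD('a) ^ i) :: 'a mod_ring poly)"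
    unfolding trace_poly_def e' by simp
  moreover have "lower_than (int (CARD('a) ^ (e - 1)) - int (CARD('a) ^ (e - 2))) (CARD('a) ^ (e - 1))
    (\<Sum>i<Suc e'. monom 1 (CARD('a) ^ i) :: 'a mod_ring poly)"
  proof (rule lower_than_sum)
    fix i assume "i \<in> {..<Suc e'}"
    hence "CARD('a) ^ i \<le> CARD('a) ^ (e - 2)" using p unfolding e' by (intro power_increasing) auto
    thus "lower_than (int (CARD('a) ^ (e - 1)) - int (CARD('a) ^ (e - 2))) (CARD('a) ^ (e - 1))
      (monom 1 (CARD('a) ^ i) :: 'a mod_ring poly)"
      by (auto simp: lower_than_def)
  qed
  ultimately show ?thesis by (simp add: leading_form_def)
qed

lemma leading_form_step_basis:
  assumes "e \<ge> 2"
  shows "leading_form (int (CARD('a) ^ (e - 1)) - int (CARD('a) ^ (e - 2))) (K * CARD('a) ^ (e - 1)) 1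
    (step_basis e K :: 'a::prime_card mod_ring poly)"
proof -
  define d where "d = int (CARD('a) ^ (e - 1)) - int (CARD('a) ^ (e - 2))"
  have p: "CARD('a) > 1" using prime_card[where ?'a='a] prime_gt_1_nat by blast
  have "CARD('a) ^ (e - 2) \<le> CARD('a) ^ (e - 1)" using p by (intro power_increasing) auto
  hence d: "d \<ge> 0" unfolding d_def by (simp only: diff_ge_0_iff_ge of_nat_le_iff)
  have t: "leading_form d (K mod CARD('a) * CARD('a) ^ (e - 1)) 1 (trace_poly e ^ (K mod CARD('a)) :: 'a mod_ring poly)"
    unfolding d_def by (rule leading_form_power_monic[OF leading_form_trace_poly[OF assms]]) (use d in \<open>simp add: d_def\<close>)
  from leading_form_mult[OF t leading_form_self(2)[of d], of 0 0 d] d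
  have "leading_form d (K mod CARD('a) * CARD('a) ^ (e - 1) + CARD('a) ^ e * (K div CARD('a))) 1
    (step_basis e K :: 'a mod_ring poly)"
    by (simp add: step_basis_def)
  also have "CARD('a) ^ e = CARD('a) * CARD('a) ^ (e - 1)"
    using assms by (cases e) auto
  also have "K mod CARD('a) * CARD('a) ^ (e - 1) + CARD('a) * CARD('a) ^ (e - 1) * (K div CARD('a)) = 
    (K mod CARD('a) + CARD('a) * (K div CARD('a))) * CARD('a) ^ (e - 1)"
  proof -
    have "u * x + q * x * w = (u + q * w) * x" for u x q w :: nat by (simp add: algebra_simps)
    thus ?thesis .
  qed
  also have "K mod CARD('a) + CARD('a) * (K div CARD('a)) = K" by simp
  finally show ?thesis by (simp add: d_def)
qed

text \<open>The \<open>Q\<close>-th power of \<open>x + s\<close> is \<open>x ^ Q + s\<close>, which is close to a pure power of \<open>x\<close>.\<close>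

lemma leading_form_linear_prod_power:
  assumes "finite S" "0 \<le> d" "d \<le> int (CARD('a) ^ e)"
  shows "leading_form d (card S * CARD('a) ^ e) 1 (linear_prod S ^ (CARD('a) ^ e) :: 'a::prime_card mod_ring poly)"
proof -
  have "[:s, 1:] ^ (CARD('a) ^ e) = [:s:] + monom 1 (CARD('a) ^ e)" for s :: "'a mod_ring"
  proof -
    have "([:s:] + monom 1 1) ^ (CARD('a) ^ e) = [:s:] ^ (CARD('a) ^ e) + monom 1 1 ^ (CARD('a) ^ e)"
      by (rule freshmans_dream') (auto simp: prime_card)
    thus ?thesis by (simp add: monom_power poly_const_pow monom_altdef)
  qed
  moreover have "leading_form d (CARD('a) ^ e) 1 ([:s:] + monom 1 (CARD('a) ^ e))" for s :: "'a mod_ring"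
    using assms by (auto simp: leading_form_def lower_than_def coeff_pCons split: nat.splits)
  ultimately show ?thesis
    unfolding linear_prod_def prod_power_distrib
    by (intro leading_form_prod_monic assms) simp
qed

text \<open>If \<open>A + f ^ ((Q - 1) / 2) * B = 0\<close>, squaring and multiplying by \<open>f\<close> give \<open>f * A\<^sup>2 = f ^ Q * B\<^sup>2\<close>.
  Let \<open>a0\<close> and \<open>a1\<close> be the highest nonzero coefficients of \<open>A\<close> and \<open>B\<close> in the basis. Since \<open>f ^ Q\<close> is
  nearly \<open>x ^ (Q * card S)\<close>, comparing leading forms gives \<open>f * a0\<^sup>2 = a1\<^sup>2\<close>, which is impossible
  because \<open>f\<close> is squarefree and not constant.\<close>

lemma step_poly_nonzero:
  fixes S :: "'a::prime_card mod_ring set" and a :: "bool \<times> nat \<Rightarrow> 'a mod_ring poly"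
  assumes p: "CARD('a) > 2" and e: "e \<ge> 2" and S: "S \<noteq> {}"
    and deg: "\<And>j K. K < n \<Longrightarrow> degree (a (j, K)) \<le> t"
    and t: "card S + 2 * t + CARD('a) ^ (e - 2) < CARD('a) ^ (e - 1)"
    and nz: "K < n" "a (j, K) \<noteq> 0"
  shows "step_poly S e n a \<noteq> 0"
proof
  assume W: "step_poly S e n a = 0"
  define E where "E = CARD('a) ^ (e - 1)"
  define d where "d = int E - int (CARD('a) ^ (e - 2))"
  define f where "f = linear_prod S"
  define A where "A = (\<lambda>j. \<Sum>K<n. a (j, K) * step_basis e K)"
  define phi where "phi = f ^ ((CARD('a) ^ e - 1) div 2)"
  have fS: "finite S" by simp
  have d: "0 \<le> d" "d \<le> int E" "d > card S + 2 * t" 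
  proof -
    have "int (card S + 2 * t + CARD('a) ^ (e - 2)) < int E" using t unfolding E_def by (simp only: of_nat_less_iff)
    thus "0 \<le> d" "d > card S + 2 * t" unfolding d_def by linarith+
    show "d \<le> int E" unfolding d_def by linarith
  qed
  have eE: "CARD('a) ^ e = CARD('a) * E" using e unfolding E_def by (cases e) auto
  have "odd (CARD('a) ^ e)" using odd_CARD[OF p] by simp
  hence half: "Suc ((CARD('a) ^ e - 1) div 2 * 2) = CARD('a) ^ e" by presburger
  have "phi\<^sup>2 * f = f ^ Suc ((CARD('a) ^ e - 1) div 2 * 2)"
    unfolding phi_def by (simp only: power_Suc2 power_mult)
  hence phi2: "phi\<^sup>2 * f = f ^ (CARD('a) ^ e)" unfolding half .
  have A01: "A False = - phi * A True"
    using W by (simp add: step_poly_def A_def phi_def f_def add_eq_0_iff)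
  have sq: "f * (A False)\<^sup>2 = f ^ (CARD('a) ^ e) * (A True)\<^sup>2"
    unfolding A01 phi2[symmetric] by (simp add: power_mult_distrib mult_ac)
  have Y: "leading_form d (K * E) 1 (step_basis e K :: 'a mod_ring poly)" for K
    unfolding d_def E_def by (rule leading_form_step_basis[OF e])
  have ex: "\<exists>K0 a0. a0 \<noteq> 0 \<and> degree a0 \<le> t \<and> leading_form (d - int t) (K0 * E) a0 (A j)"
    if nzj: "\<exists>K<n. a (j, K) \<noteq> 0" for j
  proof -
    obtain K0 a0 where "a0 \<noteq> 0" "degree a0 \<le> t" "leading_form (d - int t) (K0 * E) a0 (A j)"
      unfolding A_def by (rule leading_form_sum_ex[OF Y deg nzj d(1,2)])
    thus ?thesis by (intro exI conjI)
  qed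
  have Anz: "A j \<noteq> 0" if nzj: "\<exists>K<n. a (j, K) \<noteq> 0" for j
  proof -
    obtain K0 a0 where a0: "a0 \<noteq> 0" "leading_form (d - int t) (K0 * E) a0 (A j)" using ex[OF nzj] by (elim exE conjE)
    have "d - int t > 0" using d(3) by linarith
    from leading_form_degree(2)[OF a0(2) this a0(1)] show ?thesis .
  qed
  have f0: "f \<noteq> 0" by (simp add: f_def)
  have "A j \<noteq> 0" by (rule Anz) (use nz in auto)
  have "A False = 0 \<longleftrightarrow> f * (A False)\<^sup>2 = 0" using f0 by simp
  also have "\<dots> \<longleftrightarrow> f ^ (CARD('a) ^ e) * (A True)\<^sup>2 = 0" unfolding sq ..
  also have "\<dots> \<longleftrightarrow> A True = 0" using f0 by simp
  finally have "A j' \<noteq> 0" for j' using \<open>A j \<noteq> 0\<close> by (cases j; cases j') simp_all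
  moreover have "A j' = 0" if "\<not> (\<exists>K<n. a (j', K) \<noteq> 0)" for j'
    unfolding A_def by (rule sum.neutral) (use that in simp)
  ultimately have all: "\<exists>K<n. a (j', K) \<noteq> 0" for j' by metis
  note ex' = ex[OF all]
  obtain K0 a0 where a0: "a0 \<noteq> 0" "degree a0 \<le> t" "leading_form (d - int t) (K0 * E) a0 (A False)"
    using ex'[of False] by (elim exE conjE)
  obtain K1 a1 where a1: "a1 \<noteq> 0" "degree a1 \<le> t" "leading_form (d - int t) (K1 * E) a1 (A True)"
    using ex'[of True] by (elim exE conjE)
  have df: "degree f = card S" by (simp add: f_def degree_linear_prod)
  have da0: "degree (a0\<^sup>2) \<le> 2 * t" and da1: "degree (a1\<^sup>2) \<le> 2 * t"
    using a0 a1 by (auto simp: degree_power_eq)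
  have sqform: "leading_form (d - 2 * int t) (2 * k * E) (g\<^sup>2) (G\<^sup>2)"
    if "degree g \<le> t" "leading_form (d - int t) (k * E) g G" for k g G
  proof -
    have "leading_form (d - 2 * int t) (k * E + k * E) (g * g) (G * G)"
      by (rule leading_form_mult[OF that(2) that(2) that(1) that(1)]) (use d(1) in linarith)+
    thus ?thesis by (simp only: power2_eq_square mult_2 add_mult_distrib)
  qed
  have "leading_form (d - 2 * int t - int (card S)) (0 + 2 * K0 * E) (f * a0\<^sup>2) (f * (A False)\<^sup>2)"
    by (rule leading_form_mult[OF leading_form_self(1)[of d f] sqform[OF a0(2,3)] eq_refl[OF df] da0])
       (use d(1) in simp_all)
  hence L: "leading_form (d - 2 * int t - int (card S)) (2 * K0 * E) (f * a0\<^sup>2) (f * (A False)\<^sup>2)"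
    by (simp only: add_0)
  have fp: "leading_form d (card S * CARD('a) ^ e) 1 (f ^ (CARD('a) ^ e))"
    unfolding f_def
  proof (rule leading_form_linear_prod_power[OF fS d(1)])
    have "E \<le> CARD('a) ^ e" unfolding eE using p by simp
    thus "d \<le> int (CARD('a) ^ e)" using d(2) by linarith
  qed
  have "leading_form (d - 2 * int t) (card S * CARD('a) ^ e + 2 * K1 * E) (1 * a1\<^sup>2)
    (f ^ (CARD('a) ^ e) * (A True)\<^sup>2)"
    by (rule leading_form_mult[OF fp sqform[OF a1(2,3)] _ da1, of 0]) (use d(1) in simp_all)
  hence R: "leading_form (d - 2 * int t) ((card S * CARD('a) + 2 * K1) * E) (a1\<^sup>2) (f ^ (CARD('a) ^ e) * (A True)\<^sup>2)"
    unfolding eE by (simp only: mult_1 add_mult_distrib mult.assoc)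
  have "f * a0\<^sup>2 = a1\<^sup>2"
  proof (rule leading_form_unique[OF L R[folded sq]])
    have "degree (f * a0\<^sup>2) \<le> card S + 2 * t"
      using degree_mult_le[of f "a0\<^sup>2"] df da0 by simp
    thus "degree (f * a0\<^sup>2) < E" using d by simp
    show "degree (a1\<^sup>2) < E" using da1 d by simp
  qed (use d f0 a0 a1 in auto)
  thus False using separable_times_square_neq_square[OF fS S a0(1) a1(1)] by (simp add: f_def linear_prod_def)
qed

section \<open>Stepanov's method on a class of given character and trace\<close>

lemma poly_frobenius_add:
  "(x + y :: 'a::prime_card mod_ring poly) ^ (CARD('a) ^ n) = x ^ (CARD('a) ^ n) + y ^ (CARD('a) ^ n)"
  by (rule freshmans_dream') (auto simp: prime_card)

lemma poly_frobenius_diff: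
  "(x - y :: 'a::prime_card mod_ring poly) ^ (CARD('a) ^ n) = x ^ (CARD('a) ^ n) - y ^ (CARD('a) ^ n)"
proof -
  have "(x - y) ^ (CARD('a) ^ n) + y ^ (CARD('a) ^ n) = x ^ (CARD('a) ^ n)"
    by (simp only: poly_frobenius_add[symmetric] diff_add_cancel)
  thus ?thesis by (simp only: eq_diff_eq)
qed

text \<open>A polynomial of small degree that takes the value \<open>step_poly S e n a ^ Q * f ^ ((Q - 1) / 2)\<close> at the
  elements of trace \<open>c\<close> on which \<open>f ^ ((Q * Q - 1) / 2)\<close> is \<open>\<epsilon>\<close>. It is additive in \<open>a\<close>, because \<open>Q\<close> is a
  power of the characteristic.\<close>

definition step_image ::
  "'a::prime_card mod_ring set \<Rightarrow> nat \<Rightarrow> nat \<Rightarrow> 'a mod_ring \<Rightarrow> int \<Rightarrow> (bool \<times> nat \<Rightarrow> 'a mod_ring poly) \<Rightarrow> 'a mod_ring poly" where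
  "step_image S e n c \<epsilon> a =
     (\<Sum>K<n. (a (False, K) ^ (CARD('a) ^ e) * linear_prod S ^ ((CARD('a) ^ e - 1) div 2)
             + smult (of_int \<epsilon>) (a (True, K) ^ (CARD('a) ^ e))) *
       (([:c:] - trace_poly e) ^ (K mod CARD('a)) * monom 1 (K div CARD('a))))"

lemma step_image_diff:
  "step_image S e n c \<epsilon> (\<lambda>i. a i - a' i) = step_image S e n c \<epsilon> a - step_image S e n c \<epsilon> a'"
  unfolding step_image_def poly_frobenius_diff sum_subtractf[symmetric]
  by (intro sum.cong refl) (simp only: smult_diff_right algebra_simps)

lemma degree_trace_poly:
  assumes "e \<ge> 1"
  shows "degree (trace_poly e :: 'a::prime_card mod_ring poly) \<le> CARD('a) ^ (e - 1)"
  unfolding trace_poly_def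
proof (rule degree_sum_le)
  fix i assume "i \<in> {..<e}"
  hence "CARD('a) ^ i \<le> CARD('a) ^ (e - 1)"
    using prime_card[where ?'a='a] prime_gt_0_nat by (intro power_increasing) (auto simp: Suc_le_eq)
  thus "degree (monom 1 (CARD('a) ^ i) :: 'a mod_ring poly) \<le> CARD('a) ^ (e - 1)"
    using degree_monom_le order.trans by blast
qed auto

lemma degree_step_image:
  fixes a :: "bool \<times> nat \<Rightarrow> 'a::prime_card mod_ring poly"
  assumes e: "e \<ge> 1" and deg: "\<And>j K. K < CARD('a) * n \<Longrightarrow> degree (a (j, K)) \<le> t" and n: "n \<ge> 1"
  shows "degree (step_image S e (CARD('a) * n) c \<epsilon> a) \<le>
    CARD('a) ^ e * t + card S * ((CARD('a) ^ e - 1) div 2) + CARD('a) ^ (e - 1) * (CARD('a) - 1) + (n - 1)"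
  unfolding step_image_def
proof (rule degree_sum_le)
  fix K assume K: "K \<in> {..<CARD('a) * n}"
  let ?Q = "CARD('a) ^ e"
  have p0: "CARD('a) > 0" by simp
  have aQ: "degree (a (j, K) ^ ?Q) \<le> ?Q * t" for j
    using degree_power_le[of "a (j, K)" ?Q] deg[of K j] K
    by (metis lessThan_iff mult.commute mult_le_mono2 order.trans)
  have l: "degree (linear_prod S ^ ((?Q - 1) div 2)) \<le> card S * ((?Q - 1) div 2)"
    using degree_power_le[of "linear_prod S" "(?Q - 1) div 2"] by (simp add: degree_linear_prod)
  have 1: "degree (a (False, K) ^ ?Q * linear_prod S ^ ((?Q - 1) div 2) + smult (of_int \<epsilon>) (a (True, K) ^ ?Q))
    \<le> ?Q * t + card S * ((?Q - 1) div 2)"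
  proof (rule degree_add_le)
    show "degree (a (False, K) ^ ?Q * linear_prod S ^ ((?Q - 1) div 2)) \<le> ?Q * t + card S * ((?Q - 1) div 2)"
      by (rule order.trans[OF degree_mult_le add_mono[OF aQ l]])
    show "degree (smult (of_int \<epsilon>) (a (True, K) ^ ?Q)) \<le> ?Q * t + card S * ((?Q - 1) div 2)"
      by (rule order.trans[OF degree_smult_le order.trans[OF aQ le_add1]])
  qed
  have "degree ([:c:] - trace_poly e) \<le> CARD('a) ^ (e - 1)"
    by (rule degree_diff_le) (use degree_trace_poly[OF e] in auto)
  hence "degree (([:c:] - trace_poly e) ^ (K mod CARD('a))) \<le> CARD('a) ^ (e - 1) * (K mod CARD('a))"
    using degree_power_le order.trans mult_le_mono1 by blast
  also have "\<dots> \<le> CARD('a) ^ (e - 1) * (CARD('a) - 1)"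
  proof (rule mult_le_mono2)
    show "K mod CARD('a) \<le> CARD('a) - 1" using mod_less_divisor[OF p0, of K] by linarith
  qed
  finally have 2: "degree (([:c:] - trace_poly e) ^ (K mod CARD('a))) \<le> CARD('a) ^ (e - 1) * (CARD('a) - 1)" .
  have "K div CARD('a) < n" using K by (simp add: less_mult_imp_div_less mult.commute)
  hence 3: "degree (monom (1 :: 'a mod_ring) (K div CARD('a))) \<le> n - 1" by (simp add: degree_monom_eq)
  have 23: "degree (([:c:] - trace_poly e) ^ (K mod CARD('a)) * monom 1 (K div CARD('a))) \<le>
    CARD('a) ^ (e - 1) * (CARD('a) - 1) + (n - 1)"
    by (rule order.trans[OF degree_mult_le add_mono[OF 2 3]])
  show "degree ((a (False, K) ^ ?Q * linear_prod S ^ ((?Q - 1) div 2) + smult (of_int \<epsilon>) (a (True, K) ^ ?Q)) *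
       (([:c:] - trace_poly e) ^ (K mod CARD('a)) * monom 1 (K div CARD('a)))) \<le>
    ?Q * t + card S * ((?Q - 1) div 2) + CARD('a) ^ (e - 1) * (CARD('a) - 1) + (n - 1)"
    using order.trans[OF degree_mult_le add_mono[OF 1 23]] by (simp only: add.assoc)
qed auto

lemma ac_eval_trace_poly: "ac_eval (trace_poly e) b = (\<Sum>i<e. b ^ (CARD('a) ^ i))"
  for b :: "'a::prime_card mod_ring alg_closure"
  by (simp add: trace_poly_def ac_eval_sum)

text \<open>Three relations hold at \<open>b\<close>, with \<open>Q = p ^ e\<close>, \<open>\<theta>\<close> the value of \<open>trace_poly e\<close> and \<open>\<phi>\<close> that of
  \<open>f ^ ((Q - 1) / 2)\<close>: \<open>b ^ (Q * Q) = b\<close>, \<open>\<theta> ^ Q = c - \<theta>\<close> and \<open>\<phi> ^ Q * \<phi> = \<epsilon>\<close>. The last one explains the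
  extra factor \<open>\<phi>\<close>: it removes \<open>\<phi> ^ Q\<close>, whose degree is too large, from the second half.\<close>

lemma ac_eval_step_image:
  fixes b :: "'a::prime_card mod_ring alg_closure"
  assumes p: "CARD('a) > 2"
    and b: "b ^ (CARD('a) ^ (2 * e)) = b"
    and norm: "ac_eval (linear_prod S) b ^ ((CARD('a) ^ (2 * e) - 1) div 2) = to_ac (of_int \<epsilon>)"
    and trace: "(\<Sum>i<2 * e. b ^ (CARD('a) ^ i)) = to_ac c"
  shows "ac_eval (step_image S e n c \<epsilon> a) b =
    ac_eval (step_poly S e n a) b ^ (CARD('a) ^ e) * ac_eval (linear_prod S ^ ((CARD('a) ^ e - 1) div 2)) b"
proof -
  define Q where "Q = CARD('a) ^ e"
  define \<theta> where "\<theta> = ac_eval (trace_poly e) b"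
  define \<phi> where "\<phi> = ac_eval (linear_prod S ^ ((CARD('a) ^ e - 1) div 2)) b"
  have QQ: "CARD('a) ^ (2 * e) = Q * Q" by (simp only: Q_def mult_2 power_add)
  have frob_sum: "(\<Sum>i\<in>A. g i) ^ Q = (\<Sum>i\<in>A. g i ^ Q)" for g :: "nat \<Rightarrow> 'a mod_ring alg_closure" and A
    unfolding Q_def by (rule ac_frobenius_sum)
  have frob_add: "(x + y) ^ Q = x ^ Q + y ^ Q" for x y :: "'a mod_ring alg_closure"
    unfolding Q_def by (rule ac_frobenius_add)
  have "\<theta> ^ Q = (\<Sum>i<e. b ^ (CARD('a) ^ (i + e)))"
    unfolding \<theta>_def ac_eval_trace_poly Q_def ac_frobenius_sum by (simp only: power_add power_mult)
  moreover have "(\<Sum>i<2 * e. b ^ (CARD('a) ^ i)) = \<theta> + (\<Sum>i<e. b ^ (CARD('a) ^ (i + e)))"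
    unfolding \<theta>_def ac_eval_trace_poly mult_2 lessThan_atLeast0
    by (subst sum.atLeastLessThan_concat[of 0 e "e + e", symmetric]) (simp_all add: sum.shift_bounds_nat_ivl[of _ 0 e e, simplified])
  ultimately have \<theta>Q: "\<theta> ^ Q = to_ac c - \<theta>" using trace by (simp add: algebra_simps)
  have bas: "ac_eval (step_basis e K) b ^ Q = (to_ac c - \<theta>) ^ (K mod CARD('a)) * b ^ (K div CARD('a))" for K
  proof -
    have "ac_eval (step_basis e K) b = \<theta> ^ (K mod CARD('a)) * b ^ (Q * (K div CARD('a)))"
      by (simp add: step_basis_def \<theta>_def Q_def)
    hence "ac_eval (step_basis e K) b ^ Q = (\<theta> ^ Q) ^ (K mod CARD('a)) * (b ^ (Q * Q)) ^ (K div CARD('a))"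
      by (simp only: power_mult_distrib power_mult[symmetric] mult_ac)
    thus ?thesis unfolding \<theta>Q using b by (simp only: QQ)
  qed
  have "odd Q" using odd_CARD[OF p] by (simp add: Q_def)
  then obtain h where h: "Q = 2 * h + 1" by (metis oddE)
  have "(Q - 1) div 2 * (Q + 1) = (Q * Q - 1) div 2"
    unfolding h by (simp add: algebra_simps)
  hence "\<phi> ^ (Q + 1) = to_ac (of_int \<epsilon>)"
    using norm unfolding \<phi>_def QQ Q_def[symmetric] by (simp only: ac_eval_simps power_mult[symmetric])
  hence \<phi>Q: "\<phi> ^ Q * \<phi> = to_ac (of_int \<epsilon>)" by (simp only: power_add power_one_right)
  have A: "ac_eval (\<Sum>K<n. a (j, K) * step_basis e K) b ^ Q =
    (\<Sum>K<n. ac_eval (a (j, K)) b ^ Q * ((to_ac c - \<theta>) ^ (K mod CARD('a)) * b ^ (K div CARD('a))))" for j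
    by (simp only: ac_eval_sum frob_sum ac_eval_simps power_mult_distrib bas)
  have "ac_eval (step_poly S e n a) b ^ Q * \<phi> =
    ac_eval (\<Sum>K<n. a (False, K) * step_basis e K) b ^ Q * \<phi> +
    (\<phi> ^ Q * \<phi>) * ac_eval (\<Sum>K<n. a (True, K) * step_basis e K) b ^ Q"
    unfolding step_poly_def ac_eval_simps(6,9) frob_add power_mult_distrib \<phi>_def by (simp only: algebra_simps)
  also have "\<dots> = (\<Sum>K<n. (ac_eval (a (False, K)) b ^ Q * \<phi> + to_ac (of_int \<epsilon>) * ac_eval (a (True, K)) b ^ Q) *
      ((to_ac c - \<theta>) ^ (K mod CARD('a)) * b ^ (K div CARD('a))))"
    unfolding \<phi>Q A by (simp only: sum_distrib_left sum_distrib_right sum.distrib[symmetric])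
      (intro sum.cong refl, simp only: algebra_simps)
  also have "\<dots> = ac_eval (step_image S e n c \<epsilon> a) b"
    unfolding step_image_def ac_eval_sum Q_def[symmetric]
    by (intro sum.cong refl) (simp only: ac_eval_simps \<phi>_def \<theta>_def to_ac_1 mult_1 Q_def)
  finally show ?thesis unfolding \<phi>_def Q_def ..
qed

text \<open>The number of free coefficients, \<open>2 * (p * J) * I\<close>, has to exceed the number of coefficients of the
  image. Here \<open>E\<close> stands for \<open>p ^ (e - 2)\<close> and \<open>m\<close> for the number of shifts. The coefficients of the
  auxiliary polynomial have length \<open>I\<close>, which is close to the largest value that the
  nonvanishing criterion permits, and \<open>p * J\<close> basis elements are used, where \<open>J\<close> exceeds \<open>p * E / 2\<close> by enough
  to absorb the terms with \<open>m\<close>.\<close>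

lemma stepanov_parameters:
  fixes p m E h I J :: nat
  assumes "p = 2 * h + 1" "h \<ge> 1" "E \<ge> 2 * m + 2" "I = E * h - m" "2 * J = p * E + 1 + 2 * m * p"
  shows "I \<ge> 1" "2 * (p * J) * I > p * p * E * (I - 1) + m * ((p * p * E - 1) div 2) + p * E * (p - 1) + J"
proof -
  have Eh: "E * h \<ge> E" using assms(2) by simp
  hence Im: "I + m = E * h" using assms(3,4) by linarith
  thus I1: "I \<ge> 1" using assms(3) Eh by linarith
  have "2 * I \<ge> E" using Im assms(3) Eh by linarith
  hence I: "2 * int I \<ge> int E" by linarith
  have "2 * (p * p * E * (I - 1) + m * ((p * p * E - 1) div 2) + p * E * (p - 1) + J)
    \<le> 2 * (p * p * E * (I - 1)) + m * (p * p * E) + 2 * (p * E * (p - 1)) + 2 * J"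
  proof -
    have "2 * ((p * p * E - 1) div 2) \<le> p * p * E" by linarith
    hence "m * (2 * ((p * p * E - 1) div 2)) \<le> m * (p * p * E)" by (rule mult_le_mono2)
    moreover have "2 * (x + m * z + y + J) = 2 * x + m * (2 * z) + 2 * y + 2 * J" for x y z
      by (simp add: algebra_simps)
    ultimately show ?thesis by (simp only: add_le_mono le_refl)
  qed
  hence "int (2 * (p * p * E * (I - 1) + m * ((p * p * E - 1) div 2) + p * E * (p - 1) + J))
    \<le> int (2 * (p * p * E * (I - 1)) + m * (p * p * E) + 2 * (p * E * (p - 1)) + 2 * J)"
    by (simp only: of_nat_le_iff)
  also have "\<dots> = 2 * (int p * int p * int E * (int I - 1)) + int m * (int p * int p * int E)
    + 2 * (int p * int E * (int p - 1)) + (int p * int E + 1 + 2 * int m * int p)"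
  proof -
    have "int (I - 1) = int I - 1" "int (p - 1) = int p - 1" using I1 assms(1) by linarith+
    thus ?thesis unfolding assms(5) by (simp only: of_nat_add of_nat_mult of_nat_1 of_nat_numeral)
  qed
  also have "\<dots> < 2 * (int p * (2 * int J) * int I)"
  proof -
    have "2 * (int p * (2 * int J) * int I) = 2 * (int p * (int p * int E + 1 + 2 * int m * int p) * int I)"
      using arg_cong[OF assms(5), of int] by simp
    moreover have "2 * int p * int I \<ge> int p * int E" using mult_left_mono[OF I, of "int p"] by simp
    moreover have "(2 * int I) * (2 * (int m * int p * int p)) \<ge> int E * (2 * (int m * int p * int p))"
      by (rule mult_right_mono[OF I]) simp
    moreover have "int m * int p * 2 \<le> int m * int p * (int p * int E)"
    proof (rule mult_left_mono)
      have "1 * 2 \<le> int p * int E" by (rule mult_mono) (use assms in auto)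
      thus "2 \<le> int p * int E" by simp
    qed simp
    moreover have "int p * int E \<ge> 1 * 2" by (rule mult_mono) (use assms in auto)
    ultimately show ?thesis by (simp add: algebra_simps)
  qed
  also have "\<dots> = int (2 * (2 * (p * J) * I))" by simp
  finally show "2 * (p * J) * I > p * p * E * (I - 1) + m * ((p * p * E - 1) div 2) + p * E * (p - 1) + J"
    by (simp only: of_nat_less_iff) simp
qed

text \<open>The pigeonhole principle over a finite field replaces linear algebra: there are more coefficient
  families than possible images, and the difference of two families with the same image is mapped
  to zero.\<close>

lemma stepanov_kernel:
  fixes S :: "'a::prime_card mod_ring set"
  assumes e: "e \<ge> 1" and n: "n \<ge> 1" and t: "I \<ge> 1"
    and big: "2 * (CARD('a) * n) * I > CARD('a) ^ e * (I - 1) + card S * ((CARD('a) ^ e - 1) div 2)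
      + CARD('a) ^ (e - 1) * (CARD('a) - 1) + n"
  obtains a :: "bool \<times> nat \<Rightarrow> 'a mod_ring poly" and j K
    where "\<And>j K. K < CARD('a) * n \<Longrightarrow> degree (a (j, K)) \<le> I - 1"
      "K < CARD('a) * n" "a (j, K) \<noteq> 0" "step_image S e (CARD('a) * n) c \<epsilon> a = 0"
proof -
  define N where "N = CARD('a) * n"
  define T where "T = CARD('a) ^ e * (I - 1) + card S * ((CARD('a) ^ e - 1) div 2)
      + CARD('a) ^ (e - 1) * (CARD('a) - 1) + n"
  let ?P = "\<lambda>k. {g :: 'a mod_ring poly. degree g < k \<or> g = 0}"
  define D where "D = (UNIV :: bool set) \<times> {..<N}"
  (* Families of coefficients are functions on the finite index set D; outside D they are
     undefined, so the two families found below differ at an index inside D. *)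
  let ?F = "D \<rightarrow>\<^sub>E ?P I"
  have fP: "finite (?P k)" "card (?P k) = CARD('a) ^ k" for k
    using card_polys_degree_less[of k, where ?'a="'a mod_ring"] by simp_all
  have fD: "finite D" "card D = 2 * N" by (simp_all add: D_def card_cartesian_product card_UNIV_bool)
  have p1: "CARD('a) > 1" using prime_card[where ?'a='a] prime_gt_1_nat by blast
  have cF: "card ?F = CARD('a) ^ (2 * N * I)"
    using fD fP by (simp add: card_PiE power_mult[symmetric] mult.commute)
  have dF: "degree (a (j, K)) \<le> I - 1" if "a \<in> ?F" "K < N" for a j K
  proof -
    have "a (j, K) \<in> ?P I" using that by (intro PiE_mem[OF that(1)]) (simp add: D_def)
    thus ?thesis using t by auto
  qed
  have "step_image S e N c \<epsilon> ` ?F \<subseteq> ?P T"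
  proof safe
    fix a assume a: "a \<in> ?F"
    have "degree (step_image S e N c \<epsilon> a) \<le> CARD('a) ^ e * (I - 1) + card S * ((CARD('a) ^ e - 1) div 2)
      + CARD('a) ^ (e - 1) * (CARD('a) - 1) + (n - 1)"
      unfolding N_def by (rule degree_step_image[OF e _ n]) (use dF[OF a] in \<open>simp add: N_def\<close>)
    thus "degree (step_image S e N c \<epsilon> a) < T" using n unfolding T_def by linarith
  qed
  hence "card (step_image S e N c \<epsilon> ` ?F) \<le> card (?P T)" by (rule card_mono[OF fP(1)])
  also have "card (?P T) = CARD('a) ^ T" by (rule fP(2))
  also have "\<dots> < card ?F"
    unfolding cF using big p1 by (intro power_strict_increasing) (simp_all add: T_def N_def)
  finally have less: "card (step_image S e N c \<epsilon> ` ?F) < card ?F" .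
  have "\<not> inj_on (step_image S e N c \<epsilon>) ?F"
  proof
    assume "inj_on (step_image S e N c \<epsilon>) ?F"
    from card_image[OF this] less show False by (simp only: less_irrefl)
  qed
  then obtain a a' where a: "a \<in> ?F" "a' \<in> ?F" "a \<noteq> a'" "step_image S e N c \<epsilon> a = step_image S e N c \<epsilon> a'"
    unfolding inj_on_def by auto
  have "\<exists>i\<in>D. a i \<noteq> a' i"
  proof (rule ccontr)
    assume "\<not> (\<exists>i\<in>D. a i \<noteq> a' i)"
    hence "a = a'" by (intro PiE_ext[OF a(1,2)]) simp
    thus False using a(3) by contradiction
  qed
  then obtain j K where jK: "K < N" "a (j, K) \<noteq> a' (j, K)" by (auto simp: D_def)
  show ?thesis
  proof (rule that[of "\<lambda>i. a i - a' i" K j])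
    show "degree (a (j, K) - a' (j, K)) \<le> I - 1" if "K < CARD('a) * n" for j K
      using dF[OF a(1)] dF[OF a(2)] that by (intro degree_diff_le) (simp_all add: N_def)
    show "step_image S e (CARD('a) * n) c \<epsilon> (\<lambda>i. a i - a' i) = 0"
      using a(4) by (simp add: step_image_diff N_def)
  qed (use jK in \<open>simp_all add: N_def\<close>)
qed

lemma degree_step_poly:
  fixes a :: "bool \<times> nat \<Rightarrow> 'a::prime_card mod_ring poly"
  assumes e: "e \<ge> 2" and deg: "\<And>j K. K < n \<Longrightarrow> degree (a (j, K)) \<le> t"
  shows "degree (step_poly S e n a) \<le> card S * ((CARD('a) ^ e - 1) div 2) + (t + n * CARD('a) ^ (e - 1))"
proof -
  have p: "CARD('a) > 1" using prime_card[where ?'a='a] prime_gt_1_nat by blast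
  have "CARD('a) ^ (e - 2) < CARD('a) ^ (e - 1)" using p e by (intro power_strict_increasing) auto
  hence d: "int (CARD('a) ^ (e - 1)) - int (CARD('a) ^ (e - 2)) > 0" by (simp only: of_nat_less_iff diff_gt_0_iff_gt)
  have bas: "degree (step_basis e K :: 'a mod_ring poly) = K * CARD('a) ^ (e - 1)" for K
    using leading_form_degree(1)[OF leading_form_step_basis[OF e] d] by simp
  have A: "degree (\<Sum>K<n. a (j, K) * step_basis e K) \<le> t + n * CARD('a) ^ (e - 1)" for j
  proof (rule degree_sum_le)
    fix K assume K: "K \<in> {..<n}"
    have "degree (a (j, K) * step_basis e K) \<le> t + K * CARD('a) ^ (e - 1)"
      using order.trans[OF degree_mult_le add_mono[OF deg[of K j] eq_refl[OF bas]]] K by simp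
    also have "\<dots> \<le> t + n * CARD('a) ^ (e - 1)" using K by simp
    finally show "degree (a (j, K) * step_basis e K) \<le> t + n * CARD('a) ^ (e - 1)" .
  qed auto
  have l: "degree (linear_prod S ^ ((CARD('a) ^ e - 1) div 2)) \<le> card S * ((CARD('a) ^ e - 1) div 2)"
    using degree_power_le[of "linear_prod S"] by (simp add: degree_linear_prod)
  show ?thesis unfolding step_poly_def
    by (rule degree_add_le[OF order.trans[OF A le_add2] order.trans[OF degree_mult_le add_mono[OF l A]]])
qed

text \<open>Choose the coefficients so that the image vanishes identically. At every element of the class
  the \<open>Q\<close>-th power of the auxiliary polynomial times a nonzero value is then zero. The degree is
  half of \<open>p ^ (2 * e - 1)\<close> up to \<open>O(p ^ e)\<close>, which is the expected size of the class.\<close>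

theorem stepanov_polynomial:
  fixes S :: "'a::prime_card mod_ring set"
  defines "p \<equiv> CARD('a)" and "m \<equiv> card S"
  assumes p: "p > 2" and S: "S \<noteq> {}" and e: "e \<ge> 2" "p ^ (e - 2) \<ge> 2 * m + 2" and \<epsilon>: "\<epsilon> \<in> {1, -1}"
  obtains W :: "'a mod_ring poly" where "W \<noteq> 0"
    "2 * degree W \<le> p ^ (2 * e - 1) + p ^ e * (m + 2 + 2 * m * p)"
    "\<And>b. b ^ (p ^ (2 * e)) = b \<Longrightarrow>
       ac_eval (linear_prod S) b ^ ((p ^ (2 * e) - 1) div 2) = to_ac (of_int \<epsilon>) \<Longrightarrow>
       (\<Sum>i<2 * e. b ^ (p ^ i)) = to_ac c \<Longrightarrow> ac_eval W b = 0"
proof -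
  define E where "E = p ^ (e - 2)"
  define h where "h = (p - 1) div 2"
  define I where "I = E * h - m"
  define J where "J = (p * E + 1) div 2 + m * p"
  have op: "odd p" using odd_CARD p by (simp add: p_def)
  have h: "p = 2 * h + 1" "h \<ge> 1" using op p unfolding h_def by presburger+
  have Em: "E \<ge> 2 * m + 2" using e(2) by (simp add: E_def)
  have "odd (p * E)" using op by (simp add: E_def)
  hence "2 * ((p * E + 1) div 2) = p * E + 1" by presburger
  hence J: "2 * J = p * E + 1 + 2 * m * p" by (simp add: J_def)
  hence J1: "J \<ge> 1" by simp
  obtain e' where e': "e = Suc (Suc e')" using e(1) by (metis Suc_le_D numeral_2_eq_2 Suc_le_mono)
  have pe: "p ^ (e - 1) = p * E" "p ^ e = p * p * E" "p ^ (2 * e - 1) = p * p * E * (p * E)"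
  proof -
    have "2 * e - 1 = e' + e' + 3" by (simp add: e')
    moreover have "e - 2 = e'" by (simp add: e')
    moreover have "x * x * p ^ 3 = p * p * x * (p * x)" for x
      by (simp add: power3_eq_cube mult_ac)
    ultimately show "p ^ (2 * e - 1) = p * p * E * (p * E)"
      unfolding E_def by (simp only: power_add)
  qed (simp_all add: E_def e' mult_ac)
  note par = stepanov_parameters[OF h Em I_def J]
  have big: "2 * (CARD('a) * J) * I > CARD('a) ^ e * (I - 1) + card S * ((CARD('a) ^ e - 1) div 2)
      + CARD('a) ^ (e - 1) * (CARD('a) - 1) + J"
    using par(2) unfolding p_def[symmetric] m_def[symmetric] pe .
  have e1: "e \<ge> 1" using e(1) by simp
  obtain a :: "bool \<times> nat \<Rightarrow> 'a mod_ring poly" and j K where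
    a': "\<And>j K. K < CARD('a) * J \<Longrightarrow> degree (a (j, K)) \<le> I - 1"
      "K < CARD('a) * J" "a (j, K) \<noteq> 0" "step_image S e (CARD('a) * J) c \<epsilon> a = 0"
    by (rule stepanov_kernel[OF e1 J1 par(1) big, where c = c and \<epsilon> = \<epsilon>]) (rule that)
  note a = a'[folded p_def]
  show ?thesis
  proof (rule that[of "step_poly S e (p * J) a"])
    have Eh: "E * h \<ge> E" using h(2) by simp
    hence "I + m = E * h" using Em unfolding I_def by linarith
    hence "2 * I + 2 * m + E = p * E" unfolding h(1) by (simp add: algebra_simps)
    hence small: "card S + 2 * (I - 1) + p ^ (e - 2) < p ^ (e - 1)"
      using par(1) unfolding pe E_def[symmetric] m_def[symmetric] by linarith
    show "step_poly S e (p * J) a \<noteq> 0"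
      unfolding p_def
      by (rule step_poly_nonzero[where a = a and t = "I - 1" and K = K and j = j, OF p[unfolded p_def] e(1) S a'(1) small[unfolded p_def] a'(2,3)])
    have "degree (step_poly S e (p * J) a) \<le> m * ((p ^ e - 1) div 2) + (I - 1 + p * J * p ^ (e - 1))"
      unfolding p_def m_def by (rule degree_step_poly[where a = a and t = "I - 1", OF e(1) a'(1)])
    hence "2 * degree (step_poly S e (p * J) a) \<le> m * (2 * ((p ^ e - 1) div 2)) + 2 * I + p * (2 * J) * p ^ (e - 1)"
      by simp
    also have "\<dots> \<le> m * p ^ e + p ^ e + p * (2 * J) * p ^ (e - 1)"
    proof -
      have "2 * ((p ^ e - 1) div 2) \<le> p ^ e" by linarith
      moreover have "2 * I \<le> 1 * (p * E)" using \<open>2 * I + 2 * m + E = p * E\<close> by simp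
      moreover have "1 * (p * E) \<le> p * (p * E)" using p by (intro mult_right_mono) auto
      ultimately show ?thesis unfolding pe
        by (intro add_mono mult_le_mono2 le_refl) (simp_all only: mult.assoc mult_1)
    qed
    also have "\<dots> = p ^ (2 * e - 1) + p ^ e * (m + 2 + 2 * m * p)"
      unfolding J pe by (simp add: algebra_simps)
    finally show "2 * degree (step_poly S e (p * J) a) \<le> p ^ (2 * e - 1) + p ^ e * (m + 2 + 2 * m * p)" .
  next
    fix b :: "'a mod_ring alg_closure"
    assume b: "b ^ (p ^ (2 * e)) = b"
       "ac_eval (linear_prod S) b ^ ((p ^ (2 * e) - 1) div 2) = to_ac (of_int \<epsilon>)"
       "(\<Sum>i<2 * e. b ^ (p ^ i)) = to_ac c"
    have "ac_eval (step_image S e (p * J) c \<epsilon> a) b =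
      ac_eval (step_poly S e (p * J) a) b ^ (p ^ e) * ac_eval (linear_prod S ^ ((p ^ e - 1) div 2)) b"
      unfolding p_def by (rule ac_eval_step_image[OF p[unfolded p_def] b[unfolded p_def]])
    hence *: "ac_eval (step_poly S e (p * J) a) b ^ (p ^ e) * ac_eval (linear_prod S) b ^ ((p ^ e - 1) div 2) = 0"
      unfolding a(4) by simp
    have "p ^ 1 \<le> p ^ (2 * e)" using p e by (intro power_increasing) auto
    hence pos: "(p ^ (2 * e) - 1) div 2 > 0" using p by simp
    (* A positive power of this value is a unit. *)
    have "ac_eval (linear_prod S) b \<noteq> 0"
    proof
      assume "ac_eval (linear_prod S) b = 0"
      hence "(0 :: 'a mod_ring alg_closure) = to_ac (of_int \<epsilon>)"
        using b(2) zero_power[OF pos, where ?'a="'a mod_ring alg_closure"] by simp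
      hence "to_ac (of_int \<epsilon> :: 'a mod_ring) = 0" by (rule sym)
      thus False using \<epsilon> by auto
    qed
    thus "ac_eval (step_poly S e (p * J) a) b = 0" using * by simp
  qed
qed

section \<open>Monic polynomials and prime powers\<close>

definition monics :: "nat \<Rightarrow> 'a::prime_card mod_ring poly set" where
  "monics n = {g. lead_coeff g = 1 \<and> degree g = n}"

text \<open>A prime power is stored as a pair of base and exponent, because it is weighted by the degree of
  its base.\<close>

definition prime_powers_of_degree :: "nat \<Rightarrow> ('a::prime_card mod_ring poly \<times> nat) set" where
  "prime_powers_of_degree k = {(P, j). prime P \<and> j \<ge> 1 \<and> j * degree P = k}"

lemma finite_polys_degree_le: "finite {g :: 'a::prime_card mod_ring poly. degree g \<le> n}"
  by (rule finite_subset[OF _ card_polys_degree_less(1)[of "Suc n"]]) auto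

lemma finite_monics [simp]: "finite (monics n)"
  by (rule finite_subset[OF _ finite_polys_degree_le[of n]]) (auto simp: monics_def)

lemma finite_prime_powers_of_degree [simp]:
  "finite (prime_powers_of_degree k :: ('a::prime_card mod_ring poly \<times> nat) set)"
proof (rule finite_subset)
  show "prime_powers_of_degree k \<subseteq> {g :: 'a mod_ring poly. degree g \<le> k} \<times> {..k}"
  proof safe
    fix P :: "'a mod_ring poly" and j assume "(P, j) \<in> prime_powers_of_degree k"
    hence P: "prime P" "j \<ge> 1" "j * degree P = k" by (auto simp: prime_powers_of_degree_def)
    have "degree P \<ge> 1" using degree_pos_of_prime[OF P(1)] by simp
    have "1 * degree P \<le> j * degree P" using P(2) by (rule mult_right_mono) simp
    thus "degree P \<le> k" using P(3) by simp
    have "j * 1 \<le> j * degree P" using \<open>degree P \<ge> 1\<close> by (rule mult_left_mono) simp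
    thus "j \<le> k" using P(3) by simp
  qed
qed (intro finite_cartesian_product finite_polys_degree_le finite_atMost)

lemma monics_0: "monics 0 = {1 :: 'a::prime_card mod_ring poly}"
  by (auto simp: monics_def elim!: degree_eq_zeroE)

lemma card_monics: "card (monics n :: 'a::prime_card mod_ring poly set) = CARD('a) ^ n"
proof (induction n)
  case (Suc n)
  have "monics (Suc n) = (\<lambda>(c, g). pCons c g) ` (UNIV \<times> (monics n :: 'a mod_ring poly set))"
  proof safe
    fix g :: "'a mod_ring poly" assume g: "g \<in> monics (Suc n)"
    obtain c h where ch: "g = pCons c h" by (cases g) auto
    have "h \<noteq> 0" using g ch by (auto simp: monics_def)
    hence "h \<in> monics n" using g ch by (auto simp: monics_def)
    thus "g \<in> (\<lambda>(c, g). pCons c g) ` (UNIV \<times> monics n)" using ch by force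
  next
    fix c and g :: "'a mod_ring poly" assume "g \<in> monics n"
    thus "pCons c g \<in> monics (Suc n)" by (cases "g = 0") (auto simp: monics_def)
  qed
  moreover have "inj_on (\<lambda>(c, g). pCons c g) (UNIV \<times> (monics n :: 'a mod_ring poly set))"
    by (auto simp: inj_on_def)
  ultimately show ?case using Suc by (simp add: card_image card_cartesian_product)
qed (simp add: monics_0)

text \<open>The analogue of the identity \<open>log n = (\<Sum>d | d dvd n. \<Lambda> d)\<close> for the von Mangoldt function: the powers
  of \<open>P\<close> that divide \<open>g\<close> contribute \<open>degree P\<close> once for each exponent up to the multiplicity.\<close>

lemma degree_eq_sum_prime_powers:
  fixes g :: "'a::prime_card mod_ring poly"
  assumes g: "g \<in> monics n"
  shows "n = (\<Sum>k=1..n. \<Sum>(P, j)\<in>prime_powers_of_degree k. if P ^ j dvd g then degree P else 0)"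
proof -
  have g0: "g \<noteq> 0" and dg: "degree g = n" and lg: "lead_coeff g = 1" using g by (auto simp: monics_def)
  let ?M = "SIGMA P:prime_factors g. {1..multiplicity P g}"
  have "g = (\<Prod>P\<in>prime_factors g. P ^ multiplicity P g)"
    using prod_prime_factors[OF g0] normalize_monic[OF lg] by simp
  hence "n = degree (\<Prod>P\<in>prime_factors g. P ^ multiplicity P g)" using dg by simp
  also have "\<dots> = (\<Sum>P\<in>prime_factors g. multiplicity P g * degree P)"
  proof (subst degree_prod_eq_sum_degree)
    show "(\<Sum>P\<in>prime_factors g. degree (P ^ multiplicity P g)) = (\<Sum>P\<in>prime_factors g. multiplicity P g * degree P)"
    proof (rule sum.cong[OF refl])
      fix P assume "P \<in> prime_factors g"
      hence "P \<noteq> 0" by auto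
      thus "degree (P ^ multiplicity P g) = multiplicity P g * degree P"
        by (simp add: degree_power_eq mult.commute)
    qed
  qed auto
  also have "\<dots> = (\<Sum>P\<in>prime_factors g. \<Sum>j\<in>{1..multiplicity P g}. degree P)" by simp
  also have "\<dots> = (\<Sum>(P, j)\<in>?M. degree P)"
    by (rule sum.Sigma) auto
  also have "?M = {(P, j) \<in> (\<Union>k\<in>{1..n}. prime_powers_of_degree k). P ^ j dvd g}"
  proof safe
    fix P j assume P: "P \<in> prime_factors g" and j: "j \<in> {1..multiplicity P g}"
    have pP: "prime P" using P by auto
    have dv: "P ^ j dvd g" using j by (auto intro: multiplicity_dvd')
    thus "P ^ j dvd g" .
    have "P \<noteq> 0" using pP by auto
    hence "j * degree P \<le> n"
      using dvd_imp_degree_le[OF dv g0] dg degree_power_eq[of P j] by (simp add: mult.commute)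
    moreover have "j * degree P \<ge> 1" using degree_pos_of_prime[OF pP] j by (simp add: Suc_le_eq)
    ultimately show "(P, j) \<in> (\<Union>k\<in>{1..n}. prime_powers_of_degree k)"
      using pP j by (auto simp: prime_powers_of_degree_def)
  next
    fix P j k assume Pj: "(P, j) \<in> prime_powers_of_degree k" "P ^ j dvd g"
    have pP: "prime P" "j \<ge> 1" using Pj by (auto simp: prime_powers_of_degree_def)
    have "P dvd P ^ j" using pP(2) by (intro dvd_power) simp
    hence "P dvd g" using Pj(2) by (rule dvd_trans)
    thus "P \<in> prime_factors g" using pP g0 by (simp add: prime_factors_dvd)
    have "\<not> is_unit P" using pP(1) not_prime_unit[of P] by fast
    thus "j \<in> {1..multiplicity P g}" using Pj(2) pP(2) g0 by (simp add: power_dvd_iff_le_multiplicity)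
  qed
  also have "(\<Sum>(P, j)\<in>\<dots>. degree P) =
    (\<Sum>(P, j)\<in>(\<Union>k\<in>{1..n}. prime_powers_of_degree k). if P ^ j dvd g then degree P else 0)"
    by (rule sum.mono_neutral_cong_left) (auto split: if_splits)
  also have "\<dots> = (\<Sum>k=1..n. \<Sum>(P, j)\<in>prime_powers_of_degree k. if P ^ j dvd g then degree P else 0)"
    by (rule sum.UNION_disjoint) (simp, simp, auto simp: prime_powers_of_degree_def)
  finally show ?thesis .
qed

definition coeff_sum :: "('a::prime_card mod_ring poly \<Rightarrow> complex) \<Rightarrow> nat \<Rightarrow> complex" where
  "coeff_sum \<Lambda> n = (\<Sum>g\<in>monics n. \<Lambda> g)"

definition prime_power_sum :: "('a::prime_card mod_ring poly \<Rightarrow> complex) \<Rightarrow> nat \<Rightarrow> complex" where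
  "prime_power_sum \<Lambda> k = (\<Sum>(P, j)\<in>prime_powers_of_degree k. of_nat (degree P) * \<Lambda> P ^ j)"

lemma lead_coeff_power_eq_1: "lead_coeff P = 1 \<Longrightarrow> lead_coeff (P ^ j) = 1"
  for P :: "'a::prime_card mod_ring poly"
  by (simp add: lead_coeff_power)

text \<open>For the generating function \<open>L\<close> of the sums over monic polynomials this is the identity
  \<open>T * L' = H * L\<close>, where \<open>H\<close> is the generating function of the prime power sums. It follows from the
  preceding expansion of the degree: a monic multiple of \<open>P ^ j\<close> is \<open>P ^ j\<close> times a monic cofactor.\<close>

lemma euler_product_identity:
  fixes \<Lambda> :: "'a::prime_card mod_ring poly \<Rightarrow> complex"
  assumes one: "\<Lambda> 1 = 1"
    and mult: "\<And>g h. lead_coeff g = 1 \<Longrightarrow> lead_coeff h = 1 \<Longrightarrow> \<Lambda> (g * h) = \<Lambda> g * \<Lambda> h"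
  shows "of_nat n * coeff_sum \<Lambda> n = (\<Sum>k=1..n. prime_power_sum \<Lambda> k * coeff_sum \<Lambda> (n - k))"
proof -
  have pow: "\<Lambda> (P ^ j) = \<Lambda> P ^ j" if "lead_coeff P = 1" for P j
    by (induction j) (simp_all add: one mult that lead_coeff_power_eq_1)
  have inner: "(\<Sum>g\<in>{g\<in>monics n. P ^ j dvd g}. \<Lambda> g) = \<Lambda> P ^ j * coeff_sum \<Lambda> (n - k)"
    if k: "k \<in> {1..n}" "(P, j) \<in> prime_powers_of_degree k" for P j k
  proof -
    have P: "prime P" "j * degree P = k" using k by (auto simp: prime_powers_of_degree_def)
    have lP: "lead_coeff P = 1" "P \<noteq> 0" using prime_poly_monic[OF P(1)] by auto
    have lPj: "lead_coeff (P ^ j) = 1" "P ^ j \<noteq> 0" "degree (P ^ j) = k"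
      using lead_coeff_power_eq_1[OF lP(1), of j] lP(2) degree_power_eq[OF lP(2), of j] P(2) by (simp_all add: mult.commute)
    have "{g\<in>monics n. P ^ j dvd g} = (\<lambda>h. P ^ j * h) ` monics (n - k)"
    proof safe
      fix g assume g: "g \<in> monics n" "P ^ j dvd g"
      then obtain h where h: "g = P ^ j * h" by (elim dvdE)
      have "h \<noteq> 0" using g h by (auto simp: monics_def)
      hence "degree g = k + degree h" using degree_mult_eq[OF lPj(2)] unfolding h lPj(3)[symmetric] by simp
      moreover have "degree g = n" using g by (simp add: monics_def)
      ultimately have "degree h = n - k" by linarith
      moreover have "lead_coeff h = 1"
        using g lead_coeff_mult[of "P ^ j" h] unfolding h monics_def mem_Collect_eq lPj(1) by simp
      ultimately have "h \<in> monics (n - k)" by (simp add: monics_def)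
      thus "g \<in> (\<lambda>h. P ^ j * h) ` monics (n - k)" using h by blast
    next
      fix h :: "'a mod_ring poly" assume h: "h \<in> monics (n - k)"
      hence h': "h \<noteq> 0" "degree h = n - k" "lead_coeff h = 1" by (auto simp: monics_def)
      have "degree (P ^ j * h) = n" using degree_mult_eq[OF lPj(2) h'(1)] lPj(3) h'(2) k(1) by simp
      moreover have "lead_coeff (P ^ j * h) = 1" by (simp only: lead_coeff_mult lPj(1) h'(3) mult_1)
      ultimately show "P ^ j * h \<in> monics n" by (simp only: monics_def mem_Collect_eq)
    qed auto
    moreover have "inj_on (\<lambda>h. P ^ j * h) (monics (n - k))"
      by (rule inj_onI) (use lPj(2) in \<open>simp only: mult_cancel_left simp_thms\<close>)
    ultimately have "(\<Sum>g\<in>{g\<in>monics n. P ^ j dvd g}. \<Lambda> g) = (\<Sum>h\<in>monics (n - k). \<Lambda> (P ^ j * h))"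
      by (simp add: sum.reindex)
    also have "\<dots> = (\<Sum>h\<in>monics (n - k). \<Lambda> P ^ j * \<Lambda> h)"
    proof (rule sum.cong[OF refl])
      fix h :: "'a mod_ring poly" assume "h \<in> monics (n - k)"
      hence "lead_coeff h = 1" unfolding monics_def by blast
      from mult[OF lPj(1) this] show "\<Lambda> (P ^ j * h) = \<Lambda> P ^ j * \<Lambda> h" by (simp only: pow[OF lP(1)])
    qed
    finally show ?thesis by (simp add: coeff_sum_def sum_distrib_left)
  qed
  have "of_nat n * coeff_sum \<Lambda> n = (\<Sum>g\<in>monics n. \<Lambda> g * of_nat n)"
    by (simp add: coeff_sum_def sum_distrib_left mult.commute)
  also have "\<dots> = (\<Sum>g\<in>monics n. \<Lambda> g * (\<Sum>k=1..n. \<Sum>(P, j)\<in>prime_powers_of_degree k. if P ^ j dvd g then of_nat (degree P) else 0))"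
  proof (rule sum.cong[OF refl])
    fix g :: "'a mod_ring poly" assume "g \<in> monics n"
    from arg_cong[OF degree_eq_sum_prime_powers[OF this], of "of_nat :: nat \<Rightarrow> complex"]
    have "(of_nat n :: complex) = (\<Sum>k=1..n. \<Sum>(P, j)\<in>prime_powers_of_degree k. if P ^ j dvd g then of_nat (degree P) else 0)"
      by (simp add: case_prod_unfold if_distrib cong: if_cong)
    thus "\<Lambda> g * of_nat n = \<Lambda> g * (\<Sum>k=1..n. \<Sum>(P, j)\<in>prime_powers_of_degree k. if P ^ j dvd g then of_nat (degree P) else 0)"
      by simp
  qed
  also have "\<dots> = (\<Sum>k=1..n. \<Sum>x::'a mod_ring poly \<times> nat\<in>prime_powers_of_degree k. \<Sum>g\<in>monics n.
      \<Lambda> g * (if fst x ^ snd x dvd g then of_nat (degree (fst x)) else 0))"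
    unfolding sum_distrib_left case_prod_unfold
    by (subst sum.swap, intro sum.cong refl, subst sum.swap) (rule refl)
  also have "\<dots> = (\<Sum>k=1..n. \<Sum>x\<in>prime_powers_of_degree k. of_nat (degree (fst x)) * \<Lambda> (fst x) ^ snd x * coeff_sum \<Lambda> (n - k))"
  proof (intro sum.cong refl)
    fix k and x :: "'a mod_ring poly \<times> nat" assume k: "k \<in> {1..n}" and x: "x \<in> prime_powers_of_degree k"
    obtain P j where Pj: "x = (P, j)" by (cases x)
    have "(\<Sum>g\<in>monics n. \<Lambda> g * (if P ^ j dvd g then of_nat (degree P) else 0)) =
      (\<Sum>g\<in>{g\<in>monics n. P ^ j dvd g}. \<Lambda> g) * of_nat (degree P)"
      unfolding sum_distrib_right by (rule sum.mono_neutral_cong_right) auto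
    also note inner[OF k x[unfolded Pj]]
    finally show "(\<Sum>g\<in>monics n. \<Lambda> g * (if fst x ^ snd x dvd g then of_nat (degree (fst x)) else 0)) =
      of_nat (degree (fst x)) * \<Lambda> (fst x) ^ snd x * coeff_sum \<Lambda> (n - k)"
      unfolding Pj fst_conv snd_conv by (simp only: mult.commute mult.left_commute mult.assoc)
  qed
  also have "\<dots> = (\<Sum>k=1..n. prime_power_sum \<Lambda> k * coeff_sum \<Lambda> (n - k))"
    by (simp add: prime_power_sum_def sum_distrib_right case_prod_unfold)
  finally show ?thesis .
qed

text \<open>Elements of the field with \<open>p ^ k\<close> elements grouped by minimal polynomial. The count falls out of
  the Euler product of the constant function 1, whose sum over monic polynomials of degree \<open>n\<close> is \<open>p ^ n\<close>.\<close>

lemma sum_degree_prime_powers: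
  assumes "k \<ge> 1"
  shows "(\<Sum>(P, j)\<in>prime_powers_of_degree k. degree (P :: 'a::prime_card mod_ring poly)) = CARD('a) ^ k"
proof -
  let ?s = "prime_power_sum (\<lambda>_ :: 'a mod_ring poly. 1)"
  have c: "coeff_sum (\<lambda>_ :: 'a mod_ring poly. 1) n = of_nat CARD('a) ^ n" for n
    by (simp add: coeff_sum_def card_monics)
  have "?s k = of_nat CARD('a) ^ k" if "k \<ge> 1" for k
    using that
  proof (induction k rule: less_induct)
    case (less n)
    have "{1..n} = insert n {1..<n}" using less.prems by auto
    hence "of_nat n * of_nat CARD('a) ^ n = ?s n + (\<Sum>k=1..<n. ?s k * of_nat CARD('a) ^ (n - k))"
      using euler_product_identity[of "\<lambda>_ :: 'a mod_ring poly. 1" n] by (simp add: c)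
    also have "(\<Sum>k=1..<n. ?s k * of_nat CARD('a) ^ (n - k)) = (\<Sum>k=1..<n. of_nat CARD('a) ^ n)"
      by (intro sum.cong refl) (simp add: less.IH flip: power_add)
    also have "\<dots> = (of_nat n - 1) * of_nat CARD('a) ^ n" using less.prems by (simp add: of_nat_diff)
    finally show ?case by (simp add: algebra_simps)
  qed
  from this[OF assms] have "of_nat (\<Sum>(P, j)\<in>prime_powers_of_degree k. degree (P :: 'a mod_ring poly)) = (of_nat (CARD('a) ^ k) :: complex)"
    by (simp add: prime_power_sum_def case_prod_unfold)
  thus ?thesis by (simp only: of_nat_eq_iff)
qed

section \<open>The L-function of a hybrid character sum\<close>

text \<open>For a monic \<open>g\<close> with roots \<open>x_i\<close> the argument of the character is the product of the \<open>x_i + s\<close>; the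
  sign accounts for \<open>g\<close> being the product of the \<open>x - x_i\<close> rather than of the \<open>x_i - x\<close>.\<close>

definition quad_part :: "'a::prime_card mod_ring set \<Rightarrow> 'a mod_ring poly \<Rightarrow> int" where
  "quad_part S g = (\<Prod>s\<in>S. qchar ((-1) ^ degree g * poly g (- s)))"

text \<open>The sum of the roots of a monic polynomial. Through the reflected polynomial it is 0, as it should
  be, for the constant polynomial 1.\<close>

definition add_part :: "'a::prime_card mod_ring poly \<Rightarrow> 'a mod_ring" where
  "add_part g = - coeff (reflect_poly g) 1"

lemma quad_part_cases: "quad_part S g \<in> {-1, 0, 1}"
  unfolding quad_part_def
proof (induction S rule: infinite_finite_induct)
  case (insert x S)
  thus ?case using qchar_cases[of "(-1) ^ degree g * poly g (- x)"] by auto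
qed auto

lemma quad_part_power_cases: "quad_part S g ^ j \<in> {-1, 0, 1}"
proof (induction j)
  case (Suc j)
  thus ?case using quad_part_cases[of S g] by auto
qed auto

lemma quad_part_mult:
  assumes "CARD('a::prime_card) > 2" "g \<noteq> 0" "h \<noteq> (0 :: 'a mod_ring poly)"
  shows "quad_part S (g * h) = quad_part S g * quad_part S h"
proof -
  have "qchar ((-1) ^ degree (g * h) * poly (g * h) (- s)) =
    qchar ((-1) ^ degree g * poly g (- s)) * qchar ((-1) ^ degree h * poly h (- s))" for s
    unfolding degree_mult_eq[OF assms(2,3)] qchar_mult[OF assms(1), symmetric] poly_mult power_add
    by (simp only: mult.assoc mult.left_commute)
  thus ?thesis unfolding quad_part_def by (simp only: prod.distrib)
qed

lemma add_part_mult: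
  assumes "lead_coeff g = 1" "lead_coeff h = 1"
  shows "add_part (g * h) = add_part g + add_part h"
proof -
  have "coeff (reflect_poly g) 0 = 1" "coeff (reflect_poly h) 0 = 1"
    using assms by (simp_all add: coeff_0_reflect_poly)
  thus ?thesis by (simp add: add_part_def reflect_poly_mult coeff_mult atMost_Suc)
qed

lemma quad_part_linear: "quad_part S [:- x, 1:] = (\<Prod>s\<in>S. qchar (x + s))"
  by (simp add: quad_part_def add.commute)

lemma add_part_linear: "add_part [:- x, 1:] = x"
  by (simp add: add_part_def reflect_linear coeff_pCons)

lemma prime_divisors_degree:
  fixes W :: "'a::prime_card mod_ring poly"
  assumes "finite A" "\<And>P. P \<in> A \<Longrightarrow> prime P" "\<And>P. P \<in> A \<Longrightarrow> P dvd W" "W \<noteq> 0"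
  shows "(\<Sum>P\<in>A. degree P) \<le> degree W"
  using assms
proof (induction A arbitrary: W rule: finite_induct)
  case (insert P A)
  obtain V where V: "W = P * V" using insert.prems(2)[of P] unfolding dvd_def by auto
  have P: "prime P" using insert.prems by auto
  have nz: "P \<noteq> 0" "V \<noteq> 0" using insert.prems(3) V by auto
  have "(\<Sum>P\<in>A. degree P) \<le> degree V"
  proof (rule insert.IH)
    fix R assume R: "R \<in> A"
    have pR: "prime R" using R insert.prems by auto
    show "prime R" by fact
    have "R dvd P * V" using insert.prems(2)[of R] R V by auto
    moreover have "\<not> R dvd P" using primes_dvd_imp_eq[OF pR P] R insert.hyps by auto
    ultimately show "R dvd V" using pR by (simp add: prime_dvd_mult_iff)
  qed fact
  thus ?case using insert.hyps nz by (simp add: V degree_mult_eq)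
qed auto

lemma prime_poly_with_rational_root:
  fixes P :: "'a::prime_card mod_ring poly"
  assumes "prime P" "poly P (- s) = 0"
  shows "P = [:s, 1:]"
proof -
  have r: "ac_eval P (to_ac (- s)) = 0" using assms(2) unfolding ac_eval_def by (simp only: to_ac_hom.poly_map_poly to_ac_0)
  have "to_ac (- s) ^ (CARD('a) ^ 1) = to_ac (- s)" by (simp only: to_ac_power[symmetric] mod_ring_power_card_power)
  hence "degree P \<le> 1" using prime_poly_root_fixed_degree[OF assms(1) r, of 1] by simp
  hence d: "degree P = 1" using degree_pos_of_prime[OF assms(1)] by simp
  then obtain a b where P: "P = [:a, b:]" by (rule degree1_coeffs)
  have "b = 1" using prime_poly_monic(1)[OF assms(1)] d P by simp
  thus ?thesis using assms(2) P by simp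
qed

text \<open>By grouping according to minimal polynomials, this is the number of elements \<open>b\<close> of the field with
  \<open>p ^ k\<close> elements for which the norm of \<open>\<Prod>s\<in>S. b + s\<close> has quadratic character \<open>\<epsilon>\<close> and the trace of \<open>b\<close>
  is \<open>c\<close>.\<close>

definition class_weight :: "'a::prime_card mod_ring set \<Rightarrow> nat \<Rightarrow> int \<Rightarrow> 'a mod_ring \<Rightarrow> nat" where
  "class_weight S k \<epsilon> c = (\<Sum>(P, j)\<in>{(P, j) \<in> prime_powers_of_degree k.
      quad_part S P ^ j = \<epsilon> \<and> of_nat j * add_part P = c}. degree P)"

lemma prime_powers_of_degree_inj: "inj_on fst (prime_powers_of_degree k)"
proof (rule inj_onI)
  fix x y :: "'a mod_ring poly \<times> nat"
  assume "x \<in> prime_powers_of_degree k" "y \<in> prime_powers_of_degree k" "fst x = fst y"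
  then obtain P j i where x: "x = (P, j)" "y = (P, i)" "prime P" "j * degree P = k" "i * degree P = k"
    by (cases x; cases y) (auto simp: prime_powers_of_degree_def)
  have "degree P > 0" using x(3) by (rule degree_pos_of_prime)
  moreover have "j * degree P = i * degree P" unfolding x(4,5) ..
  ultimately show "x = y" unfolding x(1,2) by (simp only: mult_cancel2 neq0_conv prod.inject simp_thms) simp
qed

text \<open>Each prime polynomial that contributes has a root of the given character and trace, at which the
  polynomial of Stepanov's method vanishes. So this polynomial is divisible by all of them, and its
  degree is at least the sum of their degrees.\<close>

lemma class_weight_bound:
  fixes S :: "'a::prime_card mod_ring set"
  defines "p \<equiv> CARD('a)" and "m \<equiv> card S"
  assumes p: "p > 2" and S: "S \<noteq> {}" and e: "e \<ge> 2" "p ^ (e - 2) \<ge> 2 * m + 2" and \<epsilon>: "\<epsilon> \<in> {1, -1}"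
  shows "2 * class_weight S (2 * e) \<epsilon> c \<le> p ^ (2 * e - 1) + p ^ e * (m + 2 + 2 * m * p)"
proof -
  obtain W :: "'a mod_ring poly" where W: "W \<noteq> 0"
    "2 * degree W \<le> p ^ (2 * e - 1) + p ^ e * (m + 2 + 2 * m * p)"
    "\<And>b. b ^ (p ^ (2 * e)) = b \<Longrightarrow>
       ac_eval (linear_prod S) b ^ ((p ^ (2 * e) - 1) div 2) = to_ac (of_int \<epsilon>) \<Longrightarrow>
       (\<Sum>i<2 * e. b ^ (p ^ i)) = to_ac c \<Longrightarrow> ac_eval W b = 0"
    unfolding p_def m_def
    by (rule stepanov_polynomial[OF p[unfolded p_def] S e[unfolded p_def m_def] \<epsilon>, where c = c]) (rule that[unfolded p_def m_def])
  define A where "A = {(P, j) \<in> prime_powers_of_degree (2 * e). quad_part S P ^ j = \<epsilon> \<and> of_nat j * add_part P = c}"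
  have A: "A \<subseteq> prime_powers_of_degree (2 * e)" by (auto simp: A_def)
  have "class_weight S (2 * e) \<epsilon> c = (\<Sum>x\<in>A. degree (fst x))"
    by (simp add: class_weight_def A_def case_prod_unfold)
  also have "\<dots> = (\<Sum>P\<in>fst ` A. degree P)"
    by (rule sum.reindex[symmetric, unfolded comp_def]) (rule inj_on_subset[OF prime_powers_of_degree_inj A])
  also have "\<dots> \<le> degree W"
  proof (rule prime_divisors_degree[OF _ _ _ W(1)])
    show "finite (fst ` A)" by (rule finite_imageI[OF finite_subset[OF A finite_prime_powers_of_degree]])
    fix P assume "P \<in> fst ` A"
    then obtain j where Pj: "prime P" "j * degree P = 2 * e" "quad_part S P ^ j = \<epsilon>" "of_nat j * add_part P = c"
      by (auto simp: A_def prime_powers_of_degree_def)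
    show "prime P" by fact
    obtain b where b: "ac_eval P b = 0" using prime_poly_ac_root_ex[OF Pj(1)] by (elim exE)
    have "ac_eval W b = 0"
    proof (rule W(3))
      show "b ^ (p ^ (2 * e)) = b" unfolding p_def by (rule prime_poly_root_frobenius[OF Pj(1) b Pj(2)])
      show "(\<Sum>i<2 * e. b ^ (p ^ i)) = to_ac c"
        using prime_poly_root_trace[OF Pj(1) b Pj(2)] unfolding p_def Pj(4)[symmetric] add_part_def .
      have "ac_eval (linear_prod S) b ^ ((p ^ (2 * e) - 1) div 2) = (\<Prod>s\<in>S. (b + to_ac s) ^ ((p ^ (2 * e) - 1) div 2))"
        unfolding linear_prod_def ac_eval_prod prod_power_distrib by (simp only: ac_eval_simps add.commute)
      also have "\<dots> = (\<Prod>s\<in>S. to_ac (of_int (qchar ((-1) ^ degree P * poly P (-s)) ^ j)))"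
        using prime_poly_root_norm[OF Pj(1) b Pj(2) p[unfolded p_def]] unfolding p_def by (simp only:)
      also have "\<dots> = to_ac (of_int (quad_part S P ^ j))"
        by (simp only: to_ac_prod[symmetric] of_int_prod[symmetric] quad_part_def prod_power_distrib)
      finally show "ac_eval (linear_prod S) b ^ ((p ^ (2 * e) - 1) div 2) = to_ac (of_int \<epsilon>)" unfolding Pj(3) .
    qed
    thus "P dvd W" by (simp only: prime_poly_dvd_iff_ac_root[OF Pj(1) b])
  qed
  finally show ?thesis using W(2) by linarith
qed

text \<open>The classes exhaust all elements except the at most \<open>card S\<close> ones of the form \<open>- s\<close>, where the quadratic
  character vanishes; these belong to the prime polynomials \<open>x + s\<close>.\<close>

lemma class_weight_total:
  fixes S :: "'a::prime_card mod_ring set"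
  assumes k: "k \<ge> 1"
  shows "CARD('a) ^ k \<le> (\<Sum>\<epsilon>\<in>{1, -1}. \<Sum>c\<in>UNIV. class_weight S k \<epsilon> c) + card S"
proof -
  let ?PJ = "prime_powers_of_degree k :: ('a mod_ring poly \<times> nat) set"
  let ?q = "\<lambda>x :: 'a mod_ring poly \<times> nat. quad_part S (fst x) ^ snd x"
  have "CARD('a) ^ k = (\<Sum>x\<in>?PJ. degree (fst x))"
    using sum_degree_prime_powers[OF k, where ?'a='a] by (simp add: case_prod_unfold)
  also have "\<dots> = (\<Sum>x\<in>{x\<in>?PJ. ?q x \<noteq> 0}. degree (fst x)) + (\<Sum>x\<in>{x\<in>?PJ. ?q x = 0}. degree (fst x))"
    by (subst sum.union_disjoint[symmetric]) (auto intro: sum.cong)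
  also have "(\<Sum>x\<in>{x\<in>?PJ. ?q x = 0}. degree (fst x)) \<le> card S"
  proof -
    have sub: "{x\<in>?PJ. ?q x = 0} \<subseteq> (\<lambda>s. ([:s, 1:], k)) ` S"
    proof
      fix x assume "x \<in> {x\<in>?PJ. ?q x = 0}"
      then obtain P j where x: "x = (P, j)" "prime P" "j \<ge> 1" "j * degree P = k" "quad_part S P = 0"
        by (cases x) (auto simp: prime_powers_of_degree_def)
      then obtain s where s: "s \<in> S" "poly P (- s) = 0" by (auto simp: quad_part_def)
      have "P = [:s, 1:]" by (rule prime_poly_with_rational_root[OF x(2) s(2)])
      thus "x \<in> (\<lambda>s. ([:s, 1:], k)) ` S" using x s by auto
    qed
    hence "(\<Sum>x\<in>{x\<in>?PJ. ?q x = 0}. degree (fst x)) = (\<Sum>x\<in>{x\<in>?PJ. ?q x = 0}. 1)"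
      by (intro sum.cong refl) auto
    also have "\<dots> = card {x\<in>?PJ. ?q x = 0}" by simp
    also have "\<dots> \<le> card ((\<lambda>s. ([:s, 1:], k)) ` S)" using sub by (rule card_mono[rotated]) simp
    also have "\<dots> \<le> card S" by (rule card_image_le) simp
    finally show ?thesis .
  qed
  also have "(\<Sum>x\<in>{x\<in>?PJ. ?q x \<noteq> 0}. degree (fst x)) = (\<Sum>\<epsilon>\<in>{1, -1}. \<Sum>x\<in>{x\<in>?PJ. ?q x = \<epsilon>}. degree (fst x))"
  proof -
    have split: "{x\<in>A. q x \<noteq> 0} = {x\<in>A. q x = 1} \<union> {x\<in>A. q x = -1}"
      if "\<And>x. q x \<in> {-1, 0, 1 :: int}" for q and A :: "('a mod_ring poly \<times> nat) set"
      using that by auto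
    have "{x\<in>?PJ. ?q x \<noteq> 0} = {x\<in>?PJ. ?q x = 1} \<union> {x\<in>?PJ. ?q x = -1}"
      by (rule split) (rule quad_part_power_cases)
    thus ?thesis by (simp add: sum.union_disjoint Int_def)
  qed
  also have "\<dots> = (\<Sum>\<epsilon>\<in>{1, -1}. \<Sum>c\<in>UNIV. class_weight S k \<epsilon> c)"
  proof (rule sum.cong[OF refl])
    fix \<epsilon> :: int
    have "(\<Sum>c\<in>UNIV. class_weight S k \<epsilon> c) =
      (\<Sum>c\<in>UNIV. \<Sum>x\<in>{x \<in> {x\<in>?PJ. ?q x = \<epsilon>}. of_nat (snd x) * add_part (fst x) = c}. degree (fst x))"
      by (simp add: class_weight_def case_prod_unfold)
    also have "\<dots> = (\<Sum>x\<in>{x\<in>?PJ. ?q x = \<epsilon>}. degree (fst x))"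
      by (rule sum.group) auto
    finally show "(\<Sum>x\<in>{x\<in>?PJ. ?q x = \<epsilon>}. degree (fst x)) = (\<Sum>c\<in>UNIV. class_weight S k \<epsilon> c)" ..
  qed
  finally show ?thesis by simp
qed

text \<open>The shifts \<open>S\<close> determine the multiplicative part and the additive character \<open>\<psi>\<close>, possibly trivial,
  the other part of a hybrid sum. Extended to monic polynomials through \<open>quad_part\<close> and \<open>add_part\<close>, the
  summand is completely multiplicative, and the polynomials \<open>X - x\<close> recover the original sum.\<close>

locale hybrid_sum =
  fixes S :: "'a::prime_card mod_ring set" and \<psi> :: "'a mod_ring \<Rightarrow> complex"
  assumes p2: "CARD('a) > 2" and S_nonempty: "S \<noteq> {}"
    and psi_add: "\<psi> (u + v) = \<psi> u * \<psi> v" and norm_psi: "norm (\<psi> u) = 1"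
begin

lemma psi_0 [simp]: "\<psi> 0 = 1"
  using psi_add[of 0 0] norm_psi[of 0] by auto

lemma psi_of_nat_mult: "\<psi> (of_nat j * u) = \<psi> u ^ j"
  by (induction j) (simp_all add: psi_add ring_distribs)

definition hybrid :: "'a mod_ring poly \<Rightarrow> complex" where
  "hybrid g = of_int (quad_part S g) * \<psi> (add_part g)"

lemma hybrid_1: "hybrid 1 = 1"
  using p2 by (simp add: hybrid_def quad_part_def add_part_def)

lemma hybrid_mult:
  assumes "lead_coeff g = 1" "lead_coeff h = 1"
  shows "hybrid (g * h) = hybrid g * hybrid h"
proof -
  have "g \<noteq> 0" "h \<noteq> 0" using assms by auto
  thus ?thesis using add_part_mult[OF assms]
    by (simp add: hybrid_def quad_part_mult[OF p2] psi_add)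
qed

lemma coeff_sum_hybrid_0: "coeff_sum hybrid 0 = 1"
  by (simp add: coeff_sum_def monics_0 hybrid_1)

lemma coeff_sum_hybrid_1: "coeff_sum hybrid 1 = (\<Sum>x\<in>UNIV. of_int (\<Prod>s\<in>S. qchar (x + s)) * \<psi> x)"
proof -
  have "monics 1 = range (\<lambda>x. [:- x, 1:] :: 'a mod_ring poly)"
  proof safe
    fix g :: "'a mod_ring poly" assume g: "g \<in> monics 1"
    hence "degree g = 1" unfolding monics_def by blast
    then obtain a b where P: "g = [:a, b:]" by (rule degree1_coeffs)
    have "g = [:- (- a), 1:]" using g P by (auto simp: monics_def)
    thus "g \<in> range (\<lambda>x. [:- x, 1:])" by (rule range_eqI)
  qed (auto simp: monics_def)
  moreover have "inj (\<lambda>x. [:- x, 1:] :: 'a mod_ring poly)" by (auto simp: inj_def)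
  ultimately show ?thesis
    by (simp add: coeff_sum_def sum.reindex hybrid_def quad_part_linear add_part_linear)
qed

text \<open>Fix \<open>s \<in> S\<close> and let \<open>B\<close> be the product of \<open>x + r\<close> over the other shifts \<open>r\<close>. Adding multiples of \<open>B\<close> to a
  monic \<open>g\<close> of degree \<open>n\<close> leaves its two leading coefficients and its values at all \<open>- r\<close> unchanged,
  because \<open>degree B \<le> n - 2\<close>, while its value at \<open>- s\<close> runs through the whole field. So averaging over
  these multiples gives the sum of the quadratic character, which is zero.\<close>

lemma coeff_sum_hybrid_eq_0:
  assumes n: "n > card S"
  shows "coeff_sum hybrid n = 0"
proof -
  obtain s where s: "s \<in> S" using S_nonempty by auto
  define B where "B = linear_prod (S - {s})"
  have dB: "degree B \<le> n - 2" and n2: "n \<ge> 2"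
    using s n card_gt_0_iff[of S] by (auto simp: B_def degree_linear_prod)
  have B0: "poly B (- r) = 0" if "r \<in> S" "r \<noteq> s" for r
    using that by (auto simp: B_def linear_prod_def poly_prod)
  have Bs: "poly B (- s) \<noteq> 0"
    by (auto simp: B_def linear_prod_def poly_prod)
  have dtB: "degree (smult t B) \<le> n - 2" for t using dB by (rule order.trans[OF degree_smult_le])
  have cB: "coeff (smult t B) n = 0" "coeff (smult t B) (n - 1) = 0" for t
    using dtB[of t] n2 by (auto intro!: coeff_eq_0 simp del: coeff_smult)
  have mon: "g + smult t B \<in> monics n" if "g \<in> monics n" for g t
  proof -
    have "degree (smult t B) < degree g" using that dtB[of t] n2 by (auto simp: monics_def)
    hence "degree (g + smult t B) = degree g" by (rule degree_add_eq_left)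
    moreover have "coeff (g + smult t B) n = coeff g n" unfolding coeff_add cB(1) by simp
    ultimately show ?thesis using that by (auto simp: monics_def simp del: coeff_add coeff_smult)
  qed
  have shift: "(\<Sum>g\<in>monics n. hybrid (g + smult t B)) = coeff_sum hybrid n" for t
    unfolding coeff_sum_def
  proof (rule sum.reindex_bij_witness[of _ "\<lambda>g. g + smult (- t) B" "\<lambda>g. g + smult t B"])
    fix g :: "'a mod_ring poly" assume g: "g \<in> monics n"
    show "g + smult (- t) B + smult t B = g" "g + smult t B + smult (- t) B = g" by simp_all
    show "g + smult t B \<in> monics n" "g + smult (- t) B \<in> monics n" using mon[OF g] by blast+
  qed simp
  have zero: "(\<Sum>t\<in>UNIV. hybrid (g + smult t B)) = 0" if g: "g \<in> monics n" for g
  proof -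
    define u where "u = (\<Prod>r\<in>S - {s}. qchar ((-1) ^ n * poly g (- r)))"
    have "hybrid (g + smult t B) = of_int (qchar ((-1) ^ n * poly g (- s) + (-1) ^ n * poly B (- s) * t)) * (of_int u * \<psi> (add_part g))" for t
    proof -
      have d: "degree (g + smult t B) = n" "degree g = n" using mon[OF g, of t] g by (simp_all add: monics_def)
      have "add_part (g + smult t B) = add_part g"
        using d n2 cB(2)[of t] by (simp add: add_part_def coeff_reflect_poly)
      moreover have "quad_part S (g + smult t B) = qchar ((-1) ^ n * poly g (- s) + (-1) ^ n * poly B (- s) * t) * u"
        unfolding quad_part_def d u_def using s
        by (simp add: prod.remove B0 algebra_simps)
      ultimately show ?thesis by (simp add: hybrid_def)
    qed
    hence "(\<Sum>t\<in>UNIV. hybrid (g + smult t B)) =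
      of_int (\<Sum>t\<in>UNIV. qchar ((-1) ^ n * poly g (- s) + (-1) ^ n * poly B (- s) * t)) * (of_int u * \<psi> (add_part g))"
      by (simp add: sum_distrib_right)
    also have "(\<Sum>t\<in>UNIV. qchar ((-1) ^ n * poly g (- s) + (-1) ^ n * poly B (- s) * t)) = (\<Sum>v\<in>UNIV. qchar (v :: 'a mod_ring))"
    proof -
      have nz: "(-1) ^ n * poly B (- s) \<noteq> 0" using Bs by simp
      show ?thesis
        by (rule sum.reindex_bij_witness[of _ "\<lambda>v. (v - (-1) ^ n * poly g (- s)) / ((-1) ^ n * poly B (- s))"
              "\<lambda>t. (-1) ^ n * poly g (- s) + (-1) ^ n * poly B (- s) * t"]) (use nz in auto)
    qed
    also have "\<dots> = 0" by (rule sum_qchar[OF p2])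
    finally show ?thesis by simp
  qed
  have "of_nat CARD('a) * coeff_sum hybrid n = (\<Sum>t\<in>(UNIV :: 'a mod_ring set). coeff_sum hybrid n)" by simp
  also have "\<dots> = (\<Sum>t\<in>UNIV. \<Sum>g\<in>monics n. hybrid (g + smult t B))" by (simp only: shift)
  also have "\<dots> = (\<Sum>g\<in>monics n. \<Sum>t\<in>UNIV. hybrid (g + smult t B))" by (rule sum.swap)
  also have "\<dots> = 0" by (simp add: zero)
  finally show ?thesis by simp
qed

lemma prime_power_sum_hybrid:
  "prime_power_sum hybrid k =
    (\<Sum>\<epsilon>\<in>{1, -1}. \<Sum>c\<in>UNIV. of_int \<epsilon> * \<psi> c * of_nat (class_weight S k \<epsilon> c))"
proof -
  let ?PJ = "prime_powers_of_degree k :: ('a mod_ring poly \<times> nat) set"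
  let ?q = "\<lambda>x :: 'a mod_ring poly \<times> nat. quad_part S (fst x) ^ snd x"
  let ?t = "\<lambda>x :: 'a mod_ring poly \<times> nat. of_nat (snd x) * add_part (fst x)"
  let ?w = "\<lambda>x :: 'a mod_ring poly \<times> nat. of_int (?q x) * \<psi> (?t x) * of_nat (degree (fst x))"
  have "prime_power_sum hybrid k = (\<Sum>x\<in>?PJ. ?w x)"
    unfolding prime_power_sum_def case_prod_unfold hybrid_def power_mult_distrib psi_of_nat_mult of_int_power
    by (intro sum.cong refl) (simp only: mult_ac)
  also have "\<dots> = (\<Sum>\<epsilon>\<in>{-1, 0, 1}. \<Sum>x\<in>{x\<in>?PJ. ?q x = \<epsilon>}. ?w x)"
  proof (rule sum.group[symmetric])
    show "?q ` ?PJ \<subseteq> {-1, 0, 1}" using quad_part_power_cases by blast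
  qed auto
  also have "\<dots> = (\<Sum>\<epsilon>\<in>{1, -1}. \<Sum>x\<in>{x\<in>?PJ. ?q x = \<epsilon>}. ?w x)"
    by (rule sum.mono_neutral_right) auto
  also have "\<dots> = (\<Sum>\<epsilon>\<in>{1, -1}. \<Sum>c\<in>UNIV. of_int \<epsilon> * \<psi> c * of_nat (class_weight S k \<epsilon> c))"
  proof (rule sum.cong[OF refl])
    fix \<epsilon> :: int
    have "(\<Sum>x\<in>{x\<in>?PJ. ?q x = \<epsilon>}. ?w x) = (\<Sum>c\<in>UNIV. \<Sum>x\<in>{x \<in> {x\<in>?PJ. ?q x = \<epsilon>}. ?t x = c}. ?w x)"
      by (rule sum.group[symmetric]) auto
    also have "\<dots> = (\<Sum>c\<in>UNIV. of_int \<epsilon> * \<psi> c * of_nat (class_weight S k \<epsilon> c))"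
      by (intro sum.cong refl) (simp add: class_weight_def case_prod_unfold sum_distrib_left)
    finally show "(\<Sum>x\<in>{x\<in>?PJ. ?q x = \<epsilon>}. ?w x) = (\<Sum>c\<in>UNIV. of_int \<epsilon> * \<psi> c * of_nat (class_weight S k \<epsilon> c))" .
  qed
  finally show ?thesis .
qed

text \<open>Subtracting the average \<open>p ^ (2 * e - 1) / 2\<close> from every class changes nothing, since the signs \<open>\<epsilon>\<close>
  cancel it. Stepanov's method bounds the deviations from above only; but their total is at
  least \<open>- m\<close>, so the sum of their absolute values is bounded as well.\<close>

lemma prime_power_sum_hybrid_bound:
  fixes p m :: nat
  defines "p \<equiv> CARD('a)" and "m \<equiv> card S"
  assumes e: "e \<ge> 2" "p ^ (e - 2) \<ge> 2 * m + 2"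
  shows "norm (prime_power_sum hybrid (2 * e)) \<le> (2 * p * (m + 2 + 2 * m * p) + m) * real p ^ e"
proof -
  define B where "B = real (p ^ (2 * e - 1)) / 2"
  define D where "D = real (p ^ e * (m + 2 + 2 * m * p)) / 2"
  let ?N = "\<lambda>\<epsilon> c. real (class_weight S (2 * e) \<epsilon> c)"
  have ub: "?N \<epsilon> c - B \<le> D" if "\<epsilon> \<in> {1, -1}" for \<epsilon> c
  proof -
    have "2 * class_weight S (2 * e) \<epsilon> c \<le> p ^ (2 * e - 1) + p ^ e * (m + 2 + 2 * m * p)"
      unfolding p_def m_def
      by (rule class_weight_bound[OF p2 S_nonempty e[unfolded p_def m_def] that])
    hence "real (2 * class_weight S (2 * e) \<epsilon> c) \<le> real (p ^ (2 * e - 1) + p ^ e * (m + 2 + 2 * m * p))"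
      by (simp only: of_nat_le_iff)
    thus ?thesis unfolding B_def D_def of_nat_add by (simp add: field_simps)
  qed
  have D0: "D \<ge> 0" by (simp add: D_def)
  have tot: "real (p ^ (2 * e)) \<le> (\<Sum>\<epsilon>\<in>{1, -1}. \<Sum>c\<in>UNIV. ?N \<epsilon> c) + real m"
  proof -
    have "p ^ (2 * e) \<le> (\<Sum>\<epsilon>\<in>{1, -1}. \<Sum>c\<in>UNIV. class_weight S (2 * e) \<epsilon> c) + m"
      unfolding p_def m_def using e(1) by (intro class_weight_total) simp
    hence "real (p ^ (2 * e)) \<le> real ((\<Sum>\<epsilon>\<in>{1, -1}. \<Sum>c\<in>UNIV. class_weight S (2 * e) \<epsilon> c) + m)"
      by (simp only: of_nat_le_iff)
    thus ?thesis by simp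
  qed
  have pB: "real (p ^ (2 * e)) = 2 * real p * B"
  proof -
    have "2 * e = Suc (2 * e - 1)" using e(1) by simp
    hence "real (p ^ (2 * e)) = real p * real (p ^ (2 * e - 1))" by (metis power_Suc of_nat_mult)
    thus ?thesis by (simp add: B_def)
  qed
  have cU: "(\<Sum>\<epsilon>\<in>{1, -1 :: int}. \<Sum>c\<in>(UNIV :: 'a mod_ring set). r) = 2 * real p * r" for r
    by (simp add: p_def)
  have split: "of_int \<epsilon> * \<psi> c * of_nat (class_weight S (2 * e) \<epsilon> c) =
    of_int \<epsilon> * \<psi> c * of_real (?N \<epsilon> c - B) + of_int \<epsilon> * \<psi> c * of_real B" for \<epsilon> c
    by (simp only: ring_distribs(1)[symmetric] of_real_add[symmetric] diff_add_cancel of_real_of_nat_eq)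
  have "(\<Sum>\<epsilon>\<in>{1, -1 :: int}. \<Sum>c\<in>UNIV. of_int \<epsilon> * \<psi> c * complex_of_real B) = 0"
    by (simp add: sum_negf)
  hence "prime_power_sum hybrid (2 * e) = (\<Sum>\<epsilon>\<in>{1, -1}. \<Sum>c\<in>UNIV. of_int \<epsilon> * \<psi> c * of_real (?N \<epsilon> c - B))"
    unfolding prime_power_sum_hybrid split sum.distrib by (simp only: add_0_right)
  also have "norm \<dots> \<le> (\<Sum>\<epsilon>\<in>{1, -1}. norm (\<Sum>c\<in>UNIV. of_int \<epsilon> * \<psi> c * of_real (?N \<epsilon> c - B)))"
    by (rule norm_sum)
  also have "\<dots> \<le> (\<Sum>\<epsilon>\<in>{1, -1}. \<Sum>c\<in>UNIV. norm (of_int \<epsilon> * \<psi> c * of_real (?N \<epsilon> c - B)))"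
    by (intro sum_mono norm_sum)
  (* If r \<le> D and D \<ge> 0, then \<bar>r\<bar> \<le> 2 * D - r. *)
  also have "\<dots> \<le> (\<Sum>\<epsilon>\<in>{1, -1}. \<Sum>c\<in>UNIV. 2 * D - (?N \<epsilon> c - B))"
  proof (intro sum_mono)
    fix \<epsilon> :: int and c :: "'a mod_ring" assume \<epsilon>: "\<epsilon> \<in> {1, -1}"
    have "norm (of_int \<epsilon> * \<psi> c * of_real (?N \<epsilon> c - B)) = \<bar>?N \<epsilon> c - B\<bar>"
    proof -
      have "norm (of_int \<epsilon> :: complex) = 1" using \<epsilon> by auto
      thus ?thesis by (simp only: norm_mult norm_psi norm_of_real mult_1)
    qed
    also have "\<dots> \<le> 2 * D - (?N \<epsilon> c - B)" using ub[OF \<epsilon>, of c] D0 unfolding abs_le_iff by (intro conjI) linarith+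
    finally show "norm (of_int \<epsilon> * \<psi> c * of_real (?N \<epsilon> c - B)) \<le> 2 * D - (?N \<epsilon> c - B)" .
  qed
  also have "\<dots> = (\<Sum>\<epsilon>\<in>{1, -1 :: int}. \<Sum>c\<in>(UNIV :: 'a mod_ring set). 2 * D + B) - (\<Sum>\<epsilon>\<in>{1, -1}. \<Sum>c\<in>UNIV. ?N \<epsilon> c)"
    by (simp only: diff_diff_eq2 sum_subtractf)
  also have "\<dots> \<le> 2 * real p * (2 * D + B) - (2 * real p * B - real m)"
    using tot unfolding cU pB by linarith
  also have "\<dots> = 2 * real p * real (m + 2 + 2 * m * p) * real p ^ e + real m"
    unfolding D_def of_nat_mult of_nat_power by (simp add: algebra_simps)
  also have "\<dots> \<le> 2 * real p * real (m + 2 + 2 * m * p) * real p ^ e + real m * real p ^ e"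
  proof -
    have "1 \<le> real p ^ e" using p2 by (intro one_le_power) (simp add: p_def)
    hence "real m * 1 \<le> real m * real p ^ e" by (intro mult_left_mono) auto
    thus ?thesis by simp
  qed
  also have "\<dots> = (2 * real p * real (m + 2 + 2 * m * p) + real m) * real p ^ e" by (simp only: distrib_right)
  finally show ?thesis by (simp only: of_nat_add of_nat_mult of_nat_numeral)
qed

end

section \<open>From power sums to the size of the inverse roots\<close>

text \<open>Such a polynomial is the product of the \<open>1 - T / z\<close> over its roots \<open>z\<close>, so its linear coefficient is
  minus the sum of the \<open>1 / z\<close>.\<close>

lemma coeff_1_le_of_large_roots:
  fixes L :: "complex poly"
  assumes "coeff L 0 = 1" "R > 0" "\<And>z. poly L z = 0 \<Longrightarrow> norm z \<ge> R"
  shows "norm (coeff L 1) \<le> real (degree L) / R"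
  using assms(1,3)
proof (induction "degree L" arbitrary: L)
  case 0
  thus ?case by (simp add: coeff_eq_0)
next
  case (Suc d)
  have "degree L > 0" using Suc.hyps(2) by simp
  then obtain z where z: "poly L z = 0" using alg_closed_imp_poly_has_root by blast
  have z0: "z \<noteq> 0" using z Suc.prems(1) by (auto simp: poly_0_coeff_0)
  obtain Q where Q: "L = [:- z, 1:] * Q" using z by (auto simp: poly_eq_0_iff_dvd dvd_def)
  define G where "G = smult (- z) Q"
  have "smult (- z) [:1, - (1 / z):] = [:- z, 1:]" using z0 by simp
  hence "L = smult (- z) [:1, - (1 / z):] * Q" unfolding Q by (simp only:)
  hence L: "L = [:1, - (1 / z):] * G" unfolding G_def by (simp only: mult_smult_left mult_smult_right)
  have G: "coeff G 0 = 1" using Suc.prems(1) by (simp add: L)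
  hence "G \<noteq> 0" by auto
  hence d: "degree L = Suc (degree G)" unfolding L using z0 by (subst degree_mult_eq) auto
  have "norm (coeff G 1) \<le> real (degree G) / R"
  proof (rule Suc.hyps(1))
    show "d = degree G" using d Suc.hyps(2) by simp
    show "norm w \<ge> R" if "poly G w = 0" for w using Suc.prems(2)[of w] that by (simp add: L)
  qed (rule G)
  moreover have "coeff L 1 = coeff G 1 - 1 / z"
    using G by (simp add: L coeff_mult atMost_Suc coeff_pCons)
  hence "norm (coeff L 1) \<le> norm (coeff G 1) + norm (1 / z)" by (simp only: norm_triangle_ineq4)
  moreover have "norm (1 / z) \<le> 1 / R"
    using Suc.prems(2)[OF z] assms(2) z0 by (simp add: norm_divide frac_le)
  ultimately show ?case by (simp add: d add_divide_distrib)
qed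

text \<open>The series \<open>H\<close> is the expansion of \<open>z * M' / M\<close>. The bound makes it analytic for \<open>norm z < 1 / r\<close>,
  whereas \<open>z * M' / M\<close> has a pole at every nonzero root of \<open>M\<close>.\<close>

lemma log_derivative_no_small_root:
  fixes M :: "complex poly" and H :: "complex fps"
  assumes M0: "coeff M 0 \<noteq> 0" and r: "r > 0"
    and bound: "\<And>n. norm (fps_nth H n) \<le> C * r ^ n"
    and eq: "fps_X * fps_deriv (fps_of_poly M) = H * fps_of_poly M"
    and root: "poly M z = 0"
  shows "norm z \<ge> 1 / r"
proof (rule ccontr)
  assume "\<not> norm z \<ge> 1 / r"
  hence zr: "norm z < 1 / r" by simp
  have Mnz: "M \<noteq> 0" using M0 by auto
  have z0: "z \<noteq> 0" using M0 root by (auto simp: poly_0_coeff_0)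
  have rad: "ereal (1 / r) \<le> fps_conv_radius H"
    unfolding fps_conv_radius_def
  proof (rule conv_radius_geI_ex)
    fix s :: real assume s: "0 < s" "ereal s < ereal (1 / r)"
    have rs: "r * s < 1" using s r by (simp add: field_simps)
    have "summable (\<lambda>n. fps_nth H n * of_real s ^ n)"
    proof (rule summable_comparison_test')
      show "summable (\<lambda>n. C * (r * s) ^ n)" using rs r s by (intro summable_mult summable_geometric) auto
      show "norm (fps_nth H n * of_real s ^ n) \<le> C * (r * s) ^ n" if "n \<ge> 0" for n
        using mult_right_mono[OF bound[of n], of "s ^ n"] s
        by (simp add: norm_mult norm_power power_mult_distrib mult_ac)
    qed
    thus "\<exists>z. norm z = s \<and> summable (\<lambda>n. fps_nth H n * z ^ n)"
      using s by (intro exI[of _ "of_real s"]) auto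
  qed
  define h where "h = eval_fps H"
  have id: "w * poly (pderiv M) w = h w * poly M w" if "norm w < 1 / r" for w
  proof -
    have "ereal (norm w) < ereal (1 / r)" using that by simp
    hence w: "ereal (norm w) < fps_conv_radius H" using rad by (rule order_less_le_trans)
    have "eval_fps (fps_X * fps_of_poly (pderiv M)) w = eval_fps (H * fps_of_poly M) w"
      using eq by (simp add: fps_of_poly_pderiv)
    also have "eval_fps (fps_X * fps_of_poly (pderiv M)) w = w * poly (pderiv M) w"
      by (subst eval_fps_mult) auto
    also have "eval_fps (H * fps_of_poly M) w = h w * poly M w"
      using w by (subst eval_fps_mult) (auto simp: h_def)
    finally show ?thesis .
  qed
  define k where "k = order z M"
  have k: "k > 0" using root Mnz unfolding k_def by (simp add: order_root)
  obtain Q where Q: "M = [:- z, 1:] ^ k * Q" "\<not> [:- z, 1:] dvd Q"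
    using order_decomp[OF Mnz, of z] unfolding k_def by auto
  have Qz: "poly Q z \<noteq> 0" using Q(2) by (simp add: poly_eq_0_iff_dvd)
  obtain k' where k': "k = Suc k'" using k by (cases k) auto
  have dM: "pderiv M = [:- z, 1:] ^ k' * (smult (of_nat k) Q + [:- z, 1:] * pderiv Q)"
    unfolding Q(1) k' pderiv_mult pderiv_power_Suc by (simp add: pderiv_pCons algebra_simps)
  (* The equation w * M' = h * M after division by (w - z) ^ k'. It holds near z by division and
     at z by continuity, where it reads 0 = z * k * Q(z). *)
  define F where "F = (\<lambda>w. h w * (w - z) * poly Q w - w * (of_nat k * poly Q w + (w - z) * poly (pderiv Q) w))"
  have F0: "F w = 0" if "norm w < 1 / r" "w \<noteq> z" for w
  proof -
    have "(w - z) ^ k' * F w = h w * poly M w - w * poly (pderiv M) w"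
      unfolding dM unfolding Q(1) k' F_def by (simp add: algebra_simps)
    also have "\<dots> = 0" using id[OF that(1)] by simp
    finally show ?thesis using that(2) by simp
  qed
  have hc: "isCont h z"
  proof -
    have "ereal (norm z) < ereal (1 / r)" using zr by simp
    hence "ereal (norm z) < fps_conv_radius H" using rad by (rule order_less_le_trans)
    thus ?thesis unfolding h_def by (intro continuous_eval_fps) auto
  qed
  have "isCont F z" unfolding F_def by (intro continuous_intros hc)
  hence "F \<midarrow>z\<rightarrow> F z" by (simp add: isCont_def)
  moreover have "F \<midarrow>z\<rightarrow> 0"
  proof (rule tendsto_eventually)
    have "open (ball 0 (1 / r) :: complex set)" "z \<in> ball 0 (1 / r)" using zr by auto
    hence "\<forall>\<^sub>F w in at z. w \<in> ball 0 (1 / r)" by (rule eventually_at_in_open')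
    moreover have "\<forall>\<^sub>F w in at z. w \<noteq> z" by (simp add: eventually_at_filter)
    ultimately show "\<forall>\<^sub>F w in at z. F w = 0" by eventually_elim (auto intro: F0)
  qed
  ultimately have "F z = 0" using LIM_unique by blast
  thus False using z0 Qz k by (simp add: F_def)
qed

context hybrid_sum
begin

text \<open>Power sums are under control for even indices only. Therefore the root estimate is applied to
  \<open>M(T) = L(T) * L(- T)\<close>: it has all roots of \<open>L\<close>, and in its logarithmic derivative the odd terms cancel
  while the even ones double.\<close>

theorem hybrid_weil:
  "norm (\<Sum>x\<in>UNIV. of_int (\<Prod>s\<in>S. qchar (x + s)) * \<psi> x) \<le> real (card S) * sqrt (real CARD('a))"
proof -
  define m where "m = card S"
  define p where "p = CARD('a)"
  define c where "c = coeff_sum hybrid"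
  define s where "s = (\<lambda>k. if k = 0 then 0 else prime_power_sum hybrid k)"
  define L where "L = (\<Sum>n\<le>m. monom (c n) n)"
  define L' where "L' = pcompose L [:0, -1:]"
  have p: "p > 2" using p2 by (simp add: p_def)
  have m1: "m \<ge> 1" using S_nonempty by (simp add: m_def Suc_le_eq card_gt_0_iff)
  have cL: "coeff L n = c n" for n
    using coeff_sum_hybrid_eq_0[of n] by (auto simp: L_def coeff_sum c_def m_def)
  have cL': "coeff L' n = (-1) ^ n * c n" for n
    by (simp add: L'_def coeff_pcompose_linear cL)
  have degL: "degree L \<le> m" by (rule degree_le) (use coeff_sum_hybrid_eq_0 in \<open>auto simp: cL c_def m_def\<close>)
  have rec: "of_nat n * c n = (\<Sum>k=0..n. s k * c (n - k))" for n
  proof -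
    have "(\<Sum>k=0..n. s k * c (n - k)) = (\<Sum>k=1..n. s k * c (n - k))"
      by (rule sum.mono_neutral_right) (auto simp: s_def)
    also have "\<dots> = (\<Sum>k=1..n. prime_power_sum hybrid k * c (n - k))"
      by (intro sum.cong refl) (auto simp: s_def)
    finally have *: "(\<Sum>k=0..n. s k * c (n - k)) = (\<Sum>k=1..n. prime_power_sum hybrid k * c (n - k))" .
    have "of_nat n * c n = (\<Sum>k=1..n. prime_power_sum hybrid k * c (n - k))"
      unfolding c_def by (rule euler_product_identity[OF hybrid_1 hybrid_mult])
    thus ?thesis unfolding * .
  qed
  have X_deriv: "fps_nth (fps_X * fps_deriv (fps_of_poly g)) n = of_nat n * coeff g n" for g :: "complex poly" and n
    by (cases n) (simp_all add: fps_X_mult_nth)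
  have e1: "fps_X * fps_deriv (fps_of_poly L) = Abs_fps s * fps_of_poly L"
  proof (rule fps_ext)
    fix n show "fps_nth (fps_X * fps_deriv (fps_of_poly L)) n = fps_nth (Abs_fps s * fps_of_poly L) n"
      unfolding X_deriv cL rec by (simp add: fps_mult_nth cL)
  qed
  have e2: "fps_X * fps_deriv (fps_of_poly L') = Abs_fps (\<lambda>k. (-1) ^ k * s k) * fps_of_poly L'"
  proof (rule fps_ext)
    fix n
    have "(\<Sum>k=0..n. (-1) ^ k * s k * ((-1) ^ (n - k) * c (n - k))) = (\<Sum>k=0..n. (-1) ^ n * (s k * c (n - k)))"
    proof (intro sum.cong refl)
      fix k assume "k \<in> {0..n}"
      hence "(-1 :: complex) ^ n = (-1) ^ k * (-1) ^ (n - k)" by (simp flip: power_add)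
      thus "(-1) ^ k * s k * ((-1) ^ (n - k) * c (n - k)) = (-1) ^ n * (s k * c (n - k))" by simp
    qed
    also have "\<dots> = (-1) ^ n * (of_nat n * c n)" by (simp only: rec sum_distrib_left)
    finally show "fps_nth (fps_X * fps_deriv (fps_of_poly L')) n = fps_nth (Abs_fps (\<lambda>k. (-1) ^ k * s k) * fps_of_poly L') n"
      unfolding X_deriv cL' by (simp add: fps_mult_nth cL')
  qed
  define M where "M = L * L'"
  define H where "H = Abs_fps s + Abs_fps (\<lambda>k. (-1) ^ k * s k)"
  have "fps_X * fps_deriv (fps_of_poly M) =
    (fps_X * fps_deriv (fps_of_poly L)) * fps_of_poly L' + (fps_X * fps_deriv (fps_of_poly L')) * fps_of_poly L"
    by (simp add: M_def fps_of_poly_mult algebra_simps)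
  also have "\<dots> = H * fps_of_poly M"
    unfolding e1 e2 by (simp add: M_def H_def fps_of_poly_mult algebra_simps)
  finally have eq: "fps_X * fps_deriv (fps_of_poly M) = H * fps_of_poly M" .
  have Hn: "fps_nth H n = (if even n then 2 * s n else 0)" for n by (simp add: H_def)
  define D where "D = 2 * real p * real (m + 2 + 2 * m * p) + real m"
  (* From e0 on, p ^ (e - 2) \<ge> 2 * m + 2, as Stepanov's method needs; the finitely many earlier
     coefficients go into the constant C. *)
  define e0 where "e0 = 2 * m + 5"
  define C where "C = 2 * D + (\<Sum>n<2 * e0. norm (fps_nth H n))"
  have D0: "D \<ge> 0" by (simp add: D_def)
  have "norm (fps_nth H n) \<le> C * sqrt (real p) ^ n" for n
  proof (cases "n < 2 * e0")
    case True
    have "norm (fps_nth H n) \<le> (\<Sum>n<2 * e0. norm (fps_nth H n))"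
      using True by (intro member_le_sum) auto
    also have "\<dots> \<le> C * 1" using D0 by (simp add: C_def)
    also have "\<dots> \<le> C * sqrt (real p) ^ n"
      using D0 p by (intro mult_left_mono one_le_power) (auto simp: C_def intro!: add_nonneg_nonneg sum_nonneg)
    finally show ?thesis .
  next
    case False
    show ?thesis
    proof (cases "even n")
      case True
      then obtain e where n: "n = 2 * e" by (elim evenE)
      have e: "e \<ge> e0" using False n by simp
      have "2 * m + 2 \<le> e - 2" using e by (simp add: e0_def)
      also have "\<dots> < 2 ^ (e - 2)" by (rule less_exp)
      also have "\<dots> \<le> p ^ (e - 2)" using p by (intro power_mono) auto
      finally have pe: "p ^ (e - 2) \<ge> 2 * m + 2" by simp
      have "norm (prime_power_sum hybrid (2 * e)) \<le> D * real p ^ e"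
        using prime_power_sum_hybrid_bound[OF _ pe[unfolded p_def m_def]] e
        unfolding D_def p_def m_def e0_def by (simp add: algebra_simps)
      hence "norm (fps_nth H n) \<le> 2 * D * real p ^ e" using e by (simp add: Hn n s_def norm_mult e0_def)
      also have "real p ^ e = sqrt (real p) ^ n" by (simp add: n power_mult)
      also have "2 * D * sqrt (real p) ^ n \<le> C * sqrt (real p) ^ n"
        by (intro mult_right_mono) (auto simp: C_def intro!: sum_nonneg)
      finally show ?thesis .
    next
      case False
      have "C \<ge> 0" using D0 by (auto simp: C_def intro!: add_nonneg_nonneg sum_nonneg)
      thus ?thesis using False by (simp add: Hn)
    qed
  qed
  note Hb = this
  have c0: "c 0 = 1" by (simp add: c_def coeff_sum_hybrid_0)
  have root: "norm z \<ge> 1 / sqrt (real p)" if "poly L z = 0" for z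
  proof (rule log_derivative_no_small_root[OF _ _ Hb eq])
    show "coeff M 0 \<noteq> 0" by (simp add: M_def coeff_mult cL cL' c0)
    show "poly M z = 0" using that by (simp add: M_def)
  qed (use p in simp)
  have "norm (coeff L 1) \<le> real (degree L) / (1 / sqrt (real p))"
    by (rule coeff_1_le_of_large_roots[OF _ _ root]) (use p in \<open>simp_all add: cL c0\<close>)
  also have "\<dots> \<le> real m * sqrt (real p)" using degL by (simp add: mult_right_mono)
  finally show ?thesis unfolding cL c_def coeff_sum_hybrid_1 m_def p_def .
qed

end

section \<open>Hybrid sums of Legendre symbols modulo an arbitrary prime\<close>

lemma Legendre_cong: "[a = b] (mod p) \<Longrightarrow> Legendre a p = Legendre b p"
proof -
  assume ab: "[a = b] (mod p)"
  have "[a = 0] (mod p) \<longleftrightarrow> [b = 0] (mod p)" using ab by (metis cong_sym cong_trans)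
  moreover have "QuadRes p a \<longleftrightarrow> QuadRes p b" unfolding QuadRes_def using ab by (metis cong_sym cong_trans)
  ultimately show ?thesis by (simp add: Legendre_def)
qed

definition add_char :: "nat \<Rightarrow> int \<Rightarrow> int \<Rightarrow> complex" where
  "add_char p a k = cis (2 * pi * (of_int (a * k) / of_nat p))"

lemma add_char_add: "add_char p a (k + l) = add_char p a k * add_char p a l"
  by (simp add: add_char_def cis_mult ring_distribs add_divide_distrib)

lemma norm_add_char [simp]: "norm (add_char p a k) = 1"
  by (simp add: add_char_def)

lemma add_char_multiple [simp]: "p > 0 \<Longrightarrow> add_char p a (int p * k) = 1"
proof -
  assume "p > 0"
  hence "of_int (a * (int p * k)) / of_nat p = (of_int (a * k) :: real)" by simp
  thus ?thesis unfolding add_char_def by (simp only: cis_multiple_2pi Ints_of_int)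
qed

lemma add_char_mod: "p > 0 \<Longrightarrow> add_char p a (k mod int p) = add_char p a k"
  using add_char_add[of p a "int p * (k div int p)" "k mod int p"] by simp

definition legendre_prod :: "nat \<Rightarrow> nat set \<Rightarrow> nat \<Rightarrow> int" where
  "legendre_prod p A x = (\<Prod>s\<in>A. Legendre (int (x + s)) (int p))"

definition hybrid_bound :: "nat \<Rightarrow> bool" where
  "hybrid_bound p \<longleftrightarrow> (\<forall>A\<subseteq>{..<p}. \<forall>a. A \<noteq> {} \<longrightarrow>
     norm (\<Sum>x<p. of_int (legendre_prod p A x) * add_char p a (int x)) \<le> real (card A) * sqrt (real p))"

text \<open>The bound above is proved for types with \<open>p\<close> elements, where \<open>p\<close> cannot be a variable bound by a
  quantifier. To reach every prime, take a closed term for a hypothetical counterexample (and 3 if there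
  is none) and let a type have that many elements. The bound for this type shows that there
  is no counterexample.\<close>

definition test_prime :: nat where
  "test_prime = (if \<exists>p. prime p \<and> p > 2 \<and> \<not> hybrid_bound p
     then SOME p. prime p \<and> p > 2 \<and> \<not> hybrid_bound p else 3)"

lemma test_prime: "prime test_prime" "test_prime > 2"
proof -
  have "prime test_prime \<and> test_prime > 2"
  proof (cases "\<exists>p. prime p \<and> p > 2 \<and> \<not> hybrid_bound p")
    case True
    have "test_prime = (SOME p. prime p \<and> p > 2 \<and> \<not> hybrid_bound p)"
      unfolding test_prime_def using True by (rule if_P)
    with someI_ex[OF True] show ?thesis by (simp only:)
  next
    case False
    have "test_prime = 3" unfolding test_prime_def using False by (rule if_not_P)
    moreover have "prime (3 :: nat)"
    proof -
      have "m = 1 \<or> m = 3" if "m dvd 3" for m :: nat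
      proof -
        have "m \<le> 3" using that by (rule dvd_imp_le) simp
        moreover have "m \<noteq> 0" using that by (cases m) auto
        moreover have "m \<noteq> 2" using that by auto
        ultimately show ?thesis by linarith
      qed
      thus ?thesis by (auto simp: prime_nat_iff)
    qed
    ultimately show ?thesis by simp
  qed
  thus "prime test_prime" "test_prime > 2" by auto
qed

typedef test_index = "{..<test_prime}"
  using test_prime(2) by (intro exI[of _ 0]) auto

lemma card_test_index: "CARD(test_index) = test_prime"
  using type_definition.card[OF type_definition_test_index] by simp

instance test_index :: prime_card
  by standard (simp add: card_test_index test_prime)

text \<open>This translates sums over the field \<open>'a mod_ring\<close> into sums over the integers below \<open>CARD('a)\<close>.\<close>

lemma hybrid_bound_CARD:
  assumes p2: "CARD('a::prime_card) > 2"
  shows "hybrid_bound CARD('a)"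
  unfolding hybrid_bound_def
proof (intro allI impI)
  fix A :: "nat set" and a :: int assume A: "A \<subseteq> {..<CARD('a)}" "A \<noteq> {}"
  define p where "p = CARD('a)"
  have p0: "p > 0" using p2 by (simp add: p_def)
  define S where "S = (of_nat ` A :: 'a mod_ring set)"
  define \<psi> where "\<psi> = (\<lambda>v :: 'a mod_ring. add_char p a (to_int_mod_ring v))"
  have ti: "to_int_mod_ring (of_nat n :: 'a mod_ring) = int n mod int p" for n
    unfolding p_def by (simp add: of_nat_of_int_mod_ring of_int_mod_ring.rep_eq to_int_mod_ring.rep_eq)
  have inj: "inj_on (of_nat :: nat \<Rightarrow> 'a mod_ring) {..<p}"
  proof (rule inj_onI)
    fix x y assume xy: "x \<in> {..<p}" "y \<in> {..<p}" "of_nat x = (of_nat y :: 'a mod_ring)"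
    have "int x mod int p = int y mod int p" using arg_cong[OF xy(3), of to_int_mod_ring] unfolding ti .
    thus "x = y" using xy(1,2) by simp
  qed
  have "of_nat ` {..<p} = (UNIV :: 'a mod_ring set)"
    by (rule card_subset_eq) (simp_all add: card_image[OF inj], simp add: p_def)
  hence bij: "bij_betw (of_nat :: nat \<Rightarrow> 'a mod_ring) {..<p} UNIV" using inj by (simp add: bij_betw_def)
  interpret hybrid_sum S \<psi>
  proof
    show "CARD('a) > 2" by fact
    show "S \<noteq> {}" using A by (simp add: S_def)
    show "norm (\<psi> u) = 1" for u by (simp add: \<psi>_def)
    show "\<psi> (u + v) = \<psi> u * \<psi> v" for u v
      unfolding \<psi>_def by (simp add: to_int_mod_ring_add add_char_mod[OF p0] add_char_add flip: p_def)
  qed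
  have injA: "inj_on (of_nat :: nat \<Rightarrow> 'a mod_ring) A"
    using inj A by (auto simp: p_def intro: inj_on_subset)
  have q: "(\<Prod>s\<in>S. qchar (of_nat x + s)) = legendre_prod p A x" for x
  proof -
    have "(\<Prod>s\<in>S. qchar (of_nat x + s)) = (\<Prod>s\<in>A. qchar (of_nat (x + s) :: 'a mod_ring))"
      by (simp add: S_def prod.reindex[OF injA])
    also have "\<dots> = legendre_prod p A x"
      unfolding legendre_prod_def
    proof (rule prod.cong[OF refl])
      fix s
      have "[int (x + s) mod int p = int (x + s)] (mod int p)" by (simp add: cong_def)
      thus "qchar (of_nat (x + s) :: 'a mod_ring) = Legendre (int (x + s)) (int p)"
        unfolding qchar_def ti p_def[symmetric] by (rule Legendre_cong)
    qed
    finally show ?thesis .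
  qed
  have "(\<Sum>x\<in>UNIV. of_int (\<Prod>s\<in>S. qchar (x + s)) * \<psi> x) =
    (\<Sum>x<p. of_int (\<Prod>s\<in>S. qchar (of_nat x + s)) * \<psi> (of_nat x))"
    by (rule sum.reindex_bij_betw[OF bij, symmetric])
  also have "\<dots> = (\<Sum>x<p. of_int (legendre_prod p A x) * add_char p a (int x))"
    unfolding q \<psi>_def ti add_char_mod[OF p0] ..
  finally have "norm (\<Sum>x<p. of_int (legendre_prod p A x) * add_char p a (int x)) \<le> real (card S) * sqrt (real CARD('a))"
    using hybrid_weil by simp
  also have "card S = card A" unfolding S_def by (rule card_image[OF injA])
  finally show "norm (\<Sum>x<CARD('a). of_int (legendre_prod CARD('a) A x) * add_char CARD('a) a (int x)) \<le> real (card A) * sqrt (real CARD('a))"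
    unfolding p_def .
qed

theorem hybrid_bound:
  assumes "prime p" "p > 2"
  shows "hybrid_bound p"
proof (rule ccontr)
  assume "\<not> hybrid_bound p"
  hence ex: "\<exists>p. prime p \<and> p > 2 \<and> \<not> hybrid_bound p" using assms by blast
  have "test_prime = (SOME p. prime p \<and> p > 2 \<and> \<not> hybrid_bound p)"
    unfolding test_prime_def using ex by (rule if_P)
  moreover have "\<not> hybrid_bound (SOME p. prime p \<and> p > 2 \<and> \<not> hybrid_bound p)"
    using someI_ex[OF ex] by (elim conjE)
  ultimately have "\<not> hybrid_bound test_prime" by (rule ssubst)
  moreover have "hybrid_bound CARD(test_index)"
    by (rule hybrid_bound_CARD) (simp add: card_test_index test_prime)
  ultimately show False by (simp add: card_test_index)
qed

section \<open>Incomplete sums\<close>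

text \<open>A crude form of Jordan's inequality, sufficient for denominators of geometric sums.\<close>

lemma sin_ge_quarter:
  fixes y :: real
  assumes "0 \<le> y" "y \<le> pi / 2"
  shows "sin y \<ge> y / 4"
proof -
  have small: "sin y \<ge> y / 2" if y: "0 < y" "y \<le> pi / 3" for y :: real
  proof -
    obtain z where z: "0 < z" "z < y" "sin y - sin 0 = (y - 0) * cos z"
      using MVT2[OF y(1), of sin cos] by auto
    have "cos (pi / 3) \<le> cos z" using z y by (intro cos_monotone_0_pi_le) auto
    hence "cos z \<ge> 1 / 2" by (simp add: cos_60)
    thus ?thesis using z y mult_left_mono[of "1 / 2" "cos z" y] by simp
  qed
  show ?thesis
  proof (cases "y \<le> pi / 3")
    case True
    thus ?thesis using small[of y] assms by (cases "y = 0") auto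
  next
    case False
    have "y / 4 \<le> (pi / 3) / 2" using assms pi_gt_zero by simp
    also have "\<dots> \<le> sin (pi / 3)" using pi_gt_zero by (intro small) auto
    also have "\<dots> \<le> sin y" using False assms pi_gt_zero by (intro sin_monotone_2pi_le) auto
    finally show ?thesis .
  qed
qed

text \<open>The geometric sum is at most \<open>2 / norm (z - 1)\<close> with \<open>norm (z - 1) = 2 * \<bar>sin (pi * a / p)\<bar>\<close>. The sine is
  bounded below by the distance of \<open>a / p\<close> to the nearest integer, which is \<open>a / p\<close> or \<open>(p - a) / p\<close>; the
  sum of the two reciprocals dominates both cases.\<close>

lemma geometric_exponential_sum_bound:
  fixes p a N :: nat
  assumes a: "0 < a" "a < p"
  shows "norm (\<Sum>y<N. add_char p (- int a) (int y)) \<le> 2 * real p * (1 / real a + 1 / real (p - a))"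
proof -
  define z where "z = add_char p (- int a) 1"
  define \<theta> where "\<theta> = pi * (real a / real p)"
  have pw: "add_char p (- int a) (int y) = z ^ y" for y
  proof (induction y)
    case 0 show ?case by (simp add: add_char_def)
  next
    case (Suc y)
    have "add_char p (- int a) (1 + int y) = z * z ^ y" by (simp add: add_char_add Suc z_def)
    thus ?case by simp
  qed
  have "norm (z - 1) = 2 * \<bar>sin \<theta>\<bar>"
  proof -
    have "z = exp (\<i> * of_real (- 2 * \<theta>))"
      by (simp add: z_def add_char_def \<theta>_def cis_conv_exp mult.assoc)
    thus ?thesis using dist_exp_i_1[of "- 2 * \<theta>"] by simp
  qed
  have \<theta>: "0 < \<theta>" "\<theta> < pi" using a by (auto simp: \<theta>_def field_simps)
  have sin: "\<bar>sin \<theta>\<bar> \<ge> min \<theta> (pi - \<theta>) / 4"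
  proof (cases "\<theta> \<le> pi / 2")
    case True
    thus ?thesis using sin_ge_quarter[of \<theta>] \<theta> by (simp add: min_def)
  next
    case False
    have "sin (pi - \<theta>) \<ge> (pi - \<theta>) / 4" using False \<theta> by (intro sin_ge_quarter) auto
    thus ?thesis using False \<theta> by (simp add: min_def)
  qed
  have sin0: "sin \<theta> \<noteq> 0" using sin_gt_zero[of \<theta>] \<theta> by simp
  hence z1: "z \<noteq> 1" using \<open>norm (z - 1) = 2 * \<bar>sin \<theta>\<bar>\<close> by auto
  have "norm (\<Sum>y<N. add_char p (- int a) (int y)) = norm (z ^ N - 1) / norm (z - 1)"
    unfolding pw geometric_sum[OF z1] by (simp add: norm_divide)
  also have "\<dots> \<le> 2 / (2 * \<bar>sin \<theta>\<bar>)"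
  proof -
    have "norm z = 1" by (simp add: z_def)
    hence "norm (z ^ N) = 1" by (simp add: norm_power)
    hence "norm (z ^ N - 1) \<le> 2" using norm_triangle_ineq4[of "z ^ N" 1] by simp
    thus ?thesis unfolding \<open>norm (z - 1) = 2 * \<bar>sin \<theta>\<bar>\<close> by (intro divide_right_mono) auto
  qed
  also have "\<dots> = 1 / \<bar>sin \<theta>\<bar>" by simp
  also have "\<dots> \<le> 1 / (min \<theta> (pi - \<theta>) / 4)" using sin \<theta> sin0 by (intro frac_le) auto
  also have "\<dots> = 4 / min \<theta> (pi - \<theta>)" by simp
  also have "\<dots> \<le> 4 / \<theta> + 4 / (pi - \<theta>)" using \<theta> by (simp add: min_def)
  also have "\<dots> = 4 / pi * real p * (1 / real a + 1 / real (p - a))"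
  proof -
    have "pi - \<theta> = pi * (real (p - a) / real p)"
      using a by (simp add: \<theta>_def of_nat_diff field_simps)
    thus ?thesis using a by (simp add: \<theta>_def field_simps)
  qed
  also have "\<dots> \<le> 2 * real p * (1 / real a + 1 / real (p - a))"
    using pi_ge_two a by (intro mult_right_mono) (auto simp: field_simps)
  finally show ?thesis .
qed

lemma harm_le: "n > 0 \<Longrightarrow> harm n \<le> 1 + ln (real n)"
proof -
  assume "n > 0"
  then obtain k where k: "n = Suc k" by (cases n) auto
  have "harm (Suc k) - ln (Suc k) \<le> harm (Suc 0) - ln (Suc 0 :: real)"
    using decseqD[OF decseq_harm_diff_ln, of 0 k] by simp
  thus ?thesis by (simp add: k harm_expand)
qed

lemma sum_inverse_symmetric:
  assumes "p \<ge> 2"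
  shows "(\<Sum>a=1..<p. 1 / real a + 1 / real (p - a)) \<le> 2 * (1 + ln (real p))"
proof -
  have "(\<Sum>a=1..<p. 1 / real (p - a)) = (\<Sum>a=1..<p. 1 / real a)"
    by (rule sum.reindex_bij_witness[of _ "\<lambda>a. p - a" "\<lambda>a. p - a"]) auto
  moreover have "(\<Sum>a=1..<p. 1 / real a) = harm (p - 1)"
  proof -
    have "{1..<p} = {1..p - 1}" using assms by auto
    thus ?thesis by (simp add: harm_def inverse_eq_divide)
  qed
  moreover have "harm (p - 1) \<le> 1 + ln (real p)"
  proof -
    have "harm (p - 1) \<le> 1 + ln (real (p - 1))" using assms by (intro harm_le) simp
    also have "ln (real (p - 1)) \<le> ln (real p)" using assms by (subst ln_le_cancel_iff) auto
    finally show ?thesis by simp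
  qed
  ultimately show ?thesis by (simp add: sum.distrib)
qed

lemma add_char_orthogonality:
  assumes "x < p" "y < p"
  shows "(\<Sum>a<p. add_char p (int a) (int x) * add_char p (- int a) (int y)) = (if x = y then of_nat p else 0)"
proof (cases "x = y")
  case True
  have "add_char p (int a) (int x) * add_char p (- int a) (int x) = 1" for a
    by (simp add: add_char_def cis_mult)
  thus ?thesis using True by simp
next
  case False
  define z where "z = cis (2 * pi * (of_int (int x - int y) / of_nat p))"
  have p: "p > 0" using assms by simp
  have t: "add_char p (int a) (int x) * add_char p (- int a) (int y) = z ^ a" for a
  proof -
    have "z ^ a = cis (real a * (2 * pi * (of_int (int x - int y) / of_nat p)))"
      unfolding z_def by (rule Complex.DeMoivre)
    thus ?thesis
      by (simp add: add_char_def cis_mult) (rule arg_cong[of _ _ cis], simp add: algebra_simps diff_divide_distrib)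
  qed
  have "z ^ p = 1"
  proof -
    have "z ^ p = cis (2 * pi * of_int (int x - int y))"
      unfolding z_def by (subst Complex.DeMoivre, rule arg_cong[of _ _ cis]) (use p in simp)
    thus ?thesis by (simp only: cis_multiple_2pi Ints_of_int)
  qed
  moreover have "z \<noteq> 1"
  proof
    assume "z = 1"
    hence "cos (2 * pi * (of_int (int x - int y) / of_nat p)) = 1" by (simp add: z_def complex_eq_iff)
    then obtain k :: int where k: "2 * pi * (of_int (int x - int y) / of_nat p) = of_int k * 2 * pi"
      by (auto simp: cos_one_2pi_int)
    have cancel: "d = e" if "2 * pi * d = e * 2 * pi" for d e :: real using that by simp
    have "of_int (int x - int y) / real p = of_int k" by (rule cancel[OF k])
    hence "(of_int (int x - int y) :: real) = of_int (k * int p)" using p by (simp add: field_simps)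
    hence "int x - int y = k * int p" by (simp only: of_int_eq_iff)
    hence "int p dvd int x - int y" by simp
    moreover have "\<bar>int x - int y\<bar> < int p" using assms by auto
    ultimately have "int x - int y = 0" using dvd_imp_le_int[of "int x - int y" "int p"] by force
    thus False using False by simp
  qed
  ultimately show ?thesis using False by (simp add: t geometric_sum)
qed

text \<open>Expand the indicator of \<open>{..<N}\<close> in additive characters modulo \<open>p\<close>. Each Fourier coefficient is a
  geometric sum, each is multiplied by a complete hybrid sum, and the sum of the absolute values of the
  geometric sums is of size \<open>p * ln p\<close>.\<close>

theorem incomplete_legendre_sum:
  fixes p N :: nat
  assumes p: "prime p" "p > 2" and A: "A \<subseteq> {..<p}" "A \<noteq> {}" and N: "N \<le> p"
  shows "\<bar>\<Sum>x<N. real_of_int (legendre_prod p A x)\<bar> \<le> real (card A) * sqrt (real p) * (5 + 4 * ln (real p))"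
proof -
  define T where "T = (\<lambda>a. \<Sum>x<p. of_int (legendre_prod p A x) * add_char p (int a) (int x))"
  define D where "D = (\<lambda>a. \<Sum>y<N. add_char p (- int a) (int y))"
  define B where "B = real (card A) * sqrt (real p)"
  have T: "norm (T a) \<le> B" for a
    using hybrid_bound[OF p] A unfolding hybrid_bound_def T_def B_def by blast
  have B0: "B \<ge> 0" by (simp add: B_def)
  have "(\<Sum>a<p. D a * T a) = (\<Sum>a<p. \<Sum>y<N. \<Sum>x<p. of_int (legendre_prod p A x) *
      (add_char p (int a) (int x) * add_char p (- int a) (int y)))"
    by (simp add: D_def T_def sum_product mult_ac)
  also have "\<dots> = (\<Sum>y<N. \<Sum>x<p. \<Sum>a<p. of_int (legendre_prod p A x) *
      (add_char p (int a) (int x) * add_char p (- int a) (int y)))"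
  proof -
    have "(\<Sum>a\<in>I. \<Sum>y\<in>J. \<Sum>x\<in>K. f a y x) = (\<Sum>y\<in>J. \<Sum>x\<in>K. \<Sum>a\<in>I. f a y x)"
      for f :: "nat \<Rightarrow> nat \<Rightarrow> nat \<Rightarrow> complex" and I J K
      by (subst sum.swap) (intro sum.cong refl sum.swap)
    thus ?thesis .
  qed
  also have "\<dots> = (\<Sum>y<N. \<Sum>x<p. of_int (legendre_prod p A x) * (if x = y then of_nat p else 0))"
  proof (intro sum.cong refl)
    fix x y assume "y \<in> {..<N}" "x \<in> {..<p}"
    hence "x < p" "y < p" using N by auto
    thus "(\<Sum>a<p. of_int (legendre_prod p A x) * (add_char p (int a) (int x) * add_char p (- int a) (int y))) =
      of_int (legendre_prod p A x) * (if x = y then of_nat p else 0)"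
      by (simp add: sum_distrib_left[symmetric] add_char_orthogonality)
  qed
  also have "\<dots> = (\<Sum>y<N. of_int (legendre_prod p A y) * of_nat p)"
  proof (rule sum.cong[OF refl])
    fix y assume "y \<in> {..<N}"
    hence "y \<in> {..<p}" using N by auto
    have "(\<Sum>x<p. of_int (legendre_prod p A x) * (if x = y then of_nat p else 0)) =
      (\<Sum>x<p. if x = y then of_int (legendre_prod p A x) * of_nat p else (0 :: complex))"
      by (intro sum.cong refl) auto
    also have "\<dots> = of_int (legendre_prod p A y) * of_nat p"
      using \<open>y \<in> {..<p}\<close> by (simp add: sum.delta)
    finally show "(\<Sum>x<p. of_int (legendre_prod p A x) * (if x = y then of_nat p else 0)) =
      (of_int (legendre_prod p A y) * of_nat p :: complex)" .
  qed
  also have "\<dots> = of_real (real p * (\<Sum>x<N. real_of_int (legendre_prod p A x)))"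
    by (simp add: sum_distrib_left mult.commute)
  finally have eq: "(\<Sum>a<p. D a * T a) = of_real (real p * (\<Sum>x<N. real_of_int (legendre_prod p A x)))" .
  have "real p * \<bar>\<Sum>x<N. real_of_int (legendre_prod p A x)\<bar> = norm (\<Sum>a<p. D a * T a)"
    by (simp only: eq norm_of_real abs_mult abs_of_nat)
  also have "\<dots> \<le> (\<Sum>a<p. norm (D a * T a))" by (rule norm_sum)
  also have "\<dots> \<le> (\<Sum>a<p. norm (D a) * B)"
    unfolding norm_mult by (intro sum_mono mult_left_mono T) auto
  also have "\<dots> = (\<Sum>a<p. norm (D a)) * B" by (simp only: sum_distrib_right)
  also have "(\<Sum>a<p. norm (D a)) = norm (D 0) + (\<Sum>a=1..<p. norm (D a))"
    using p(2) by (simp add: lessThan_atLeast0 sum.atLeast_Suc_lessThan)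
  also have "\<dots> \<le> real p + (\<Sum>a=1..<p. 2 * real p * (1 / real a + 1 / real (p - a)))"
  proof (intro add_mono sum_mono)
    have "norm (D 0) \<le> (\<Sum>y<N. norm (add_char p (- int 0) (int y)))" unfolding D_def by (rule norm_sum)
    also have "\<dots> = real N" by simp
    finally show "norm (D 0) \<le> real p" using N by simp
    show "norm (D a) \<le> 2 * real p * (1 / real a + 1 / real (p - a))" if "a \<in> {1..<p}" for a
      unfolding D_def using that by (intro geometric_exponential_sum_bound) auto
  qed
  also have "\<dots> = real p + 2 * real p * (\<Sum>a=1..<p. 1 / real a + 1 / real (p - a))"
    by (simp only: sum_distrib_left)
  also have "\<dots> \<le> real p + 2 * real p * (2 * (1 + ln (real p)))"
    using p(2) by (intro add_left_mono mult_left_mono sum_inverse_symmetric) auto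
  also have "\<dots> = real p * (5 + 4 * ln (real p))" by (simp add: algebra_simps)
  finally have "real p * \<bar>\<Sum>x<N. real_of_int (legendre_prod p A x)\<bar> \<le> real p * (5 + 4 * ln (real p)) * B"
    using B0 by (simp add: mult_right_mono)
  hence "real p * \<bar>\<Sum>x<N. real_of_int (legendre_prod p A x)\<bar> \<le> real p * (B * (5 + 4 * ln (real p)))"
    by (simp only: mult_ac)
  thus ?thesis using p(2) unfolding B_def by (subst (asm) mult_le_cancel_left_pos) auto
qed

section \<open>Runs of quadratic residues\<close>

lemma legendre_eq_1_iff:
  assumes "prime p"
  shows "Legendre (int x) (int p) = 1 \<and> x < p \<longleftrightarrow> x \<in> quad_residues p"
proof -
  have "[int x = 0] (mod int p) \<longleftrightarrow> x = 0" if "x < p"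
    using that by (auto simp: cong_0_iff dest: dvd_imp_le)
  thus ?thesis by (auto simp: Legendre_def quad_residues_def)
qed

lemma finite_quad_residues: "finite (quad_residues p)"
  by (rule finite_subset[of _ "{..<p}"]) (auto simp: quad_residues_def)

text \<open>The squares of \<open>1, \<dots>, (p - 1) / 2\<close> are distinct modulo \<open>p\<close>. The bound makes
  the indices into the list of residues valid.\<close>

lemma card_quad_residues_ge:
  assumes "prime p" "p > 2"
  shows "(p - 1) div 2 \<le> card (quad_residues p)"
proof -
  let ?f = "\<lambda>x. x\<^sup>2 mod p"
  have "inj_on ?f {1..(p - 1) div 2}"
  proof (rule inj_onI)
    fix x y assume xy: "x \<in> {1..(p - 1) div 2}" "y \<in> {1..(p - 1) div 2}" and eq: "?f x = ?f y"
    have "int x ^ 2 mod int p = int y ^ 2 mod int p"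
      using arg_cong[OF eq, of int] by (simp add: of_nat_mod)
    hence "int p dvd int x ^ 2 - int y ^ 2" by (simp add: mod_eq_dvd_iff)
    hence "int p dvd (int x - int y) * (int x + int y)" by (simp add: power2_eq_square algebra_simps)
    hence "int p dvd int x - int y \<or> int p dvd int x + int y"
      using assms(1) by (simp add: prime_dvd_mult_iff)
    moreover have "\<not> int p dvd int x + int y"
      using xy assms(2) by (intro zdvd_not_zless) auto
    moreover have "\<not> int p dvd int x - int y" if "x \<noteq> y"
      using xy assms(2) that dvd_imp_le_int[of "int x - int y" "int p"] by fastforce
    ultimately show "x = y" by blast
  qed
  moreover have "?f ` {1..(p - 1) div 2} \<subseteq> quad_residues p"
  proof
    fix z assume "z \<in> ?f ` {1..(p - 1) div 2}"
    then obtain x where x: "z = ?f x" "1 \<le> x" "x < p" by force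
    have "\<not> p dvd x" using x by (auto dest: dvd_imp_le)
    hence "\<not> p dvd x\<^sup>2" using assms(1) by (simp add: prime_dvd_power_iff)
    hence "0 < z" using x by (auto simp: dvd_eq_mod_eq_0)
    moreover have "QuadRes (int p) (int z)"
      unfolding QuadRes_def using x by (intro exI[of _ "int x"]) (simp add: cong_def of_nat_mod)
    ultimately show "z \<in> quad_residues p" using x assms(2) by (simp add: quad_residues_def)
  qed
  ultimately have "card {1..(p - 1) div 2} \<le> card (quad_residues p)"
    using finite_quad_residues by (rule card_inj_on_le)
  thus ?thesis by simp
qed

lemma qres_mem: "k < card (quad_residues p) \<Longrightarrow> qres p k \<in> quad_residues p"
  unfolding qres_def using nth_mem[of k "sorted_list_of_set (quad_residues p)"] finite_quad_residues[of p]
  by simp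

lemma qres_strict_mono:
  assumes "i < j" "j < card (quad_residues p)"
  shows "qres p i < qres p j"
  unfolding qres_def using assms sorted_wrt_nth_less[OF strict_sorted_list_of_set[of "quad_residues p"], of i j]
  by simp

lemma qres_ge_index:
  assumes "k < card (quad_residues p)"
  shows "k < qres p k"
  using assms
proof (induction k)
  case 0
  thus ?case using qres_mem[of 0 p] by (simp add: quad_residues_def)
next
  case (Suc k)
  thus ?case using qres_strict_mono[of k "Suc k" p] by simp
qed

lemma qres_surj:
  assumes "x \<in> quad_residues p"
  obtains k where "k < card (quad_residues p)" "qres p k = x"
proof -
  have "x \<in> set (sorted_list_of_set (quad_residues p))" using assms finite_quad_residues by simp
  thus ?thesis using that unfolding in_set_conv_nth qres_def by auto
qed

text \<open>Consecutive integers that are residues occupy consecutive positions in the list of residues.\<close>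

lemma qres_run:
  assumes "\<And>i. i < m \<Longrightarrow> x + i \<in> quad_residues p" and "k < card (quad_residues p)" "qres p k = x"
  shows "i < m \<Longrightarrow> k + i < card (quad_residues p) \<and> qres p (k + i) = x + i"
proof (induction i)
  case 0
  thus ?case using assms by simp
next
  case (Suc i)
  hence IH: "k + i < card (quad_residues p)" "qres p (k + i) = x + i" by auto
  obtain j where j: "j < card (quad_residues p)" "qres p j = x + Suc i"
    by (rule qres_surj[OF assms(1)[OF Suc.prems]])
  have "\<not> j < k + i" using qres_strict_mono[of j "k + i" p] IH j by auto
  moreover have "j \<noteq> k + i" using IH j by auto
  moreover have "\<not> k + i + 1 < j"
    using qres_strict_mono[of "k + i + 1" j p] qres_strict_mono[of "k + i" "k + i + 1" p] IH j by auto
  ultimately have "j = k + Suc i" by simp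
  thus ?case using j by simp
qed

text \<open>The product of the \<open>1 + Legendre (x + s) p\<close> for \<open>1 \<le> s \<le> m\<close> is nonzero only if \<open>x + 1, \<dots>, x + m\<close> are all
  residues, as none of them is divisible by \<open>p\<close>. Expanding it, the empty set of shifts
  contributes the main term \<open>L\<close>, and every other subset an incomplete sum.\<close>

lemma consecutive_residues_exist:
  assumes p: "prime p" "p > 2" and L: "L + m \<le> p"
    and large: "2 ^ m * real m * (sqrt (real p) * (5 + 4 * ln (real p))) < real L"
  obtains x where "x < L" "\<And>s. s \<in> {1..m} \<Longrightarrow> x + s \<in> quad_residues p"
proof -
  define K where "K = sqrt (real p) * (5 + 4 * ln (real p))"
  have K: "K \<ge> 0" using p by (simp add: K_def)
  have Lpos: "L > 0"
  proof (rule ccontr)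
    assume "\<not> L > 0"
    moreover have "0 \<le> 2 ^ m * real m * K" using K by simp
    ultimately show False using large by (simp add: K_def)
  qed
  have "\<exists>x<L. (\<Prod>s\<in>{1..m}. Legendre (int (x + s)) (int p) + 1) \<noteq> 0"
  proof (rule ccontr)
    assume "\<not> ?thesis"
    hence zero: "(\<Prod>s\<in>{1..m}. Legendre (int (x + s)) (int p) + 1) = 0" if "x < L" for x
      using that by blast
    have bound: "\<bar>\<Sum>x<L. real_of_int (legendre_prod p A x)\<bar> \<le> real m * K"
      if "A \<in> Pow {1..m} - {{}}" for A
    proof -
      have A: "A \<subseteq> {1..m}" "A \<noteq> {}" using that by auto
      have "A \<subseteq> {..<p}" using A(1) L Lpos by auto
      hence "\<bar>\<Sum>x<L. real_of_int (legendre_prod p A x)\<bar> \<le> real (card A) * K"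
        using incomplete_legendre_sum[OF p _ A(2)] L by (simp add: K_def mult_ac)
      also have "\<dots> \<le> real m * K"
        using card_mono[OF _ A(1)] K by (intro mult_right_mono) auto
      finally show ?thesis .
    qed
    have "0 = (\<Sum>x<L. real_of_int (\<Prod>s\<in>{1..m}. Legendre (int (x + s)) (int p) + 1))"
      by (intro sum.neutral[symmetric] ballI) (simp only: zero lessThan_iff of_int_0)
    also have "\<dots> = (\<Sum>x<L. \<Sum>A\<in>Pow {1..m}. real_of_int (legendre_prod p A x))"
      by (subst prod_add) (simp_all add: legendre_prod_def)
    also have "\<dots> = (\<Sum>A\<in>Pow {1..m}. \<Sum>x<L. real_of_int (legendre_prod p A x))"
      by (rule sum.swap)
    also have "\<dots> = real L + (\<Sum>A\<in>Pow {1..m} - {{}}. \<Sum>x<L. real_of_int (legendre_prod p A x))"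
      by (subst sum.remove[of _ "{}"]) (auto simp: legendre_prod_def)
    finally have "real L = \<bar>\<Sum>A\<in>Pow {1..m} - {{}}. \<Sum>x<L. real_of_int (legendre_prod p A x)\<bar>"
      by linarith
    also have "\<dots> \<le> (\<Sum>A\<in>Pow {1..m} - {{}}. real m * K)"
      by (rule order_trans[OF sum_abs sum_mono[OF bound]])
    also have "\<dots> \<le> (\<Sum>A\<in>Pow {1..m}. real m * K)"
      using K by (intro sum_mono2) auto
    also have "\<dots> = 2 ^ m * real m * K" by (simp add: card_Pow)
    finally show False using large by (simp add: K_def)
  qed
  then obtain x where x: "x < L" "(\<Prod>s\<in>{1..m}. Legendre (int (x + s)) (int p) + 1) \<noteq> 0" by blast
  have "x + s \<in> quad_residues p" if s: "s \<in> {1..m}" for s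
  proof -
    have "Legendre (int (x + s)) (int p) + 1 \<noteq> 0" using x(2) s by (auto simp: prod_zero_iff)
    moreover have "\<not> [int (x + s) = 0] (mod int p)" 
      using s x(1) L unfolding cong_0_iff of_nat_dvd_iff by (auto dest: dvd_imp_le)
    ultimately have "Legendre (int (x + s)) (int p) = 1" by (auto simp: Legendre_def split: if_splits)
    thus ?thesis using legendre_eq_1_iff[OF p(1), of "x + s"] s x(1) L by auto
  qed
  thus ?thesis using that x(1) by blast
qed

text \<open>The Legendre symbol is 1 on the run, so that the length is a difference of two incomplete sums with
  the single shift 0.\<close>

lemma residue_run_length:
  assumes p: "prime p" "p > 2" and run: "\<And>i. i < R \<Longrightarrow> a + i \<in> quad_residues p" and R: "R > 0"
  shows "real R \<le> 2 * (sqrt (real p) * (5 + 4 * ln (real p)))"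
proof -
  define S where "S = (\<lambda>N. \<Sum>x<N. real_of_int (legendre_prod p {0} x))"
  have bound: "\<bar>S N\<bar> \<le> sqrt (real p) * (5 + 4 * ln (real p))" if "N \<le> p" for N
    using incomplete_legendre_sum[OF p, of "{0}" N] p that by (simp add: S_def)
  have last: "a + R \<le> p" using run[of "R - 1"] R by (auto simp: quad_residues_def)
  have "real R = (\<Sum>i<R. real_of_int (legendre_prod p {0} (a + i)))"
  proof -
    have "real_of_int (legendre_prod p {0} (a + i)) = 1" if "i < R" for i
      using run[OF that] legendre_eq_1_iff[OF p(1), of "a + i"] by (simp add: legendre_prod_def)
    thus ?thesis by simp
  qed
  also have "\<dots> = S (a + R) - S a"
    unfolding S_def by (induction R) (auto simp: algebra_simps)
  also have "\<dots> \<le> 2 * (sqrt (real p) * (5 + 4 * ln (real p)))"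
    using bound[of "a + R"] bound[of a] last by linarith
  finally show ?thesis .
qed

section \<open>Maximum order complexity\<close>

text \<open>The minimum in the definition is attained, since an order of at least \<open>N\<close> imposes no condition.\<close>

lemma max_order_complexity_recurrence:
  assumes "N > 0"
  obtains f :: "bit list \<Rightarrow> bit" where "0 < max_order_complexity s N"
    "\<And>n. n + max_order_complexity s N < N \<Longrightarrow>
       s (n + max_order_complexity s N) = f (map (\<lambda>i. s (n + i)) (rev [0..<max_order_complexity s N]))"
    "max_order_complexity s N \<le> N"
proof -
  let ?P = "\<lambda>M. 0 < M \<and> (\<exists>f :: bit list \<Rightarrow> bit. \<forall>n. n + M < N \<longrightarrow>
            s (n + M) = f (map (\<lambda>i. s (n + i)) (rev [0..<M])))"
  have "?P N" using assms by simp
  hence "?P (max_order_complexity s N)" "max_order_complexity s N \<le> N"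
    unfolding max_order_complexity_def by (rule LeastI Least_le)+
  thus ?thesis using that by blast
qed

text \<open>The terms \<open>k, \<dots>, k + M\<close> show that the feedback function maps the constant state to \<open>c\<close>. From then on
  the state cannot change.\<close>

lemma constant_continuation:
  fixes f :: "'b list \<Rightarrow> 'b"
  assumes rec: "\<And>n. n + M < N \<Longrightarrow> s (n + M) = f (map (\<lambda>i. s (n + i)) (rev [0..<M]))"
    and const: "\<And>i. i \<le> M \<Longrightarrow> s (k + i) = c" and "k + M < N"
  shows "k + j < N \<Longrightarrow> s (k + j) = c"
proof (induction j rule: less_induct)
  case (less j)
  show ?case
  proof (cases "j \<le> M")
    case False
    have state: "map (\<lambda>i. s (n + i)) (rev [0..<M]) = replicate M c"
      if "\<And>i. i < M \<Longrightarrow> s (n + i) = c" for n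
      using that by (intro replicate_eqI) auto
    have "s (k + M) = f (replicate M c)"
      using rec[OF assms(3)] const by (simp add: state)
    hence fc: "f (replicate M c) = c" using const by simp
    define n where "n = k + (j - M)"
    have n: "n + M = k + j" using False by (simp add: n_def)
    have "s (n + i) = c" if "i < M" for i
      using less.IH[of "j - M + i"] less.prems that False by (simp add: n_def add.assoc)
    hence "s (n + M) = f (replicate M c)"
      using rec[of n] less.prems by (simp add: state n)
    thus ?thesis using fc by (simp add: n)
  qed (use const in auto)
qed

lemma tseq_eq_1_iff:
  assumes "n < (p - 3) div 2"
  shows "tseq p n = 1 \<longleftrightarrow> qres p (n + 1) = qres p n + 1"
  using assms by (simp add: tseq_def)

text \<open>Otherwise a run of \<open>M + 2\<close> residues starts at some \<open>x + 1 \<le> N / 2\<close>, hence at a list index \<open>k \<le> N / 2\<close>.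
  It yields \<open>M + 1\<close> ones in the sequence, these propagate to all indices from \<open>k\<close> to \<open>N - 1\<close>, and the
  residues with these indices form a run of length at least \<open>N / 2\<close>, which is too long.\<close>

lemma max_order_complexity_tseq_exp:
  assumes p: "prime p" "p \<ge> 5" and N: "1 \<le> N" "N \<le> (p - 5) div 2"
  defines "M \<equiv> max_order_complexity (tseq p) N"
  shows "real (N div 2) \<le> 2 ^ (M + 2) * real (M + 2) * (sqrt (real p) * (5 + 4 * ln (real p)))"
proof (rule ccontr)
  define K where "K = sqrt (real p) * (5 + 4 * ln (real p))"
  assume "\<not> ?thesis"
  hence large: "2 ^ (M + 2) * real (M + 2) * K < real (N div 2)" by (simp add: K_def)
  have p2: "p > 2" using p by simp
  obtain f :: "bit list \<Rightarrow> bit" where f: "0 < M" "M \<le> N"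
    "\<And>n. n + M < N \<Longrightarrow> tseq p (n + M) = f (map (\<lambda>i. tseq p (n + i)) (rev [0..<M]))"
    unfolding M_def by (rule max_order_complexity_recurrence[of N "tseq p"]) (use N in auto)
  have len: "N + 1 < card (quad_residues p)"
    using card_quad_residues_ge[OF p(1) p2] N p by linarith
  have K1: "K \<ge> 1"
    unfolding K_def using mult_mono[of 1 "sqrt (real p)" 1 "5 + 4 * ln (real p)"] p by simp
  have MK: "4 * (1 * real (M + 2) * K) \<le> 2 ^ (M + 2) * real (M + 2) * K"
    using K1 by (simp add: power_add mult_right_mono)
  have "1 * real (M + 2) * 1 \<le> 1 * real (M + 2) * K" using K1 by (intro mult_left_mono) auto
  hence "real (M + 2) \<le> 1 * real (M + 2) * K" by simp
  hence "real (M + 2) < real (N div 2)" using MK large by linarith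
  hence M_small: "M < N div 2" by linarith
  have "2 * K \<le> 1 * real (M + 2) * K" using K1 by (intro mult_right_mono) auto
  hence K_small: "2 * K < real (N div 2)" using MK large K1 by linarith
  obtain x where x: "x < N div 2" "\<And>s. s \<in> {1..M + 2} \<Longrightarrow> x + s \<in> quad_residues p"
  proof (rule consecutive_residues_exist[OF p(1) p2, of "N div 2" "M + 2"])
    show "N div 2 + (M + 2) \<le> p" using f(2) N p by linarith
    show "2 ^ (M + 2) * real (M + 2) * (sqrt (real p) * (5 + 4 * ln (real p))) < real (N div 2)"
      using large by (simp add: K_def)
  qed (use that in blast)
  obtain k where k: "k < card (quad_residues p)" "qres p k = x + 1"
    by (rule qres_surj[OF x(2)[of 1]]) auto
  have k_small: "k \<le> x" using qres_ge_index[OF k(1)] k(2) by simp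
  have run: "qres p (k + i) = x + 1 + i" if "i < M + 2" for i
  proof -
    have "x + 1 + i \<in> quad_residues p" if "i < M + 2" for i
      using x(2)[of "i + 1"] that by (simp add: add.assoc)
    thus ?thesis using qres_run[of "M + 2" "x + 1" p k i] k that by blast
  qed
  have ones: "tseq p (k + i) = 1" if "i \<le> M" for i
  proof -
    have "k + i < (p - 3) div 2" using that k_small x(1) M_small N by linarith
    thus ?thesis using run[of i] run[of "i + 1"] that by (simp add: tseq_eq_1_iff)
  qed
  have kMN: "k + M < N" using k_small x(1) M_small by linarith
  have all: "tseq p (k + j) = 1" if "k + j < N" for j
    by (rule constant_continuation[where s = "tseq p" and f = f and k = k, OF f(3) ones kMN that])
  have long: "qres p (k + j) = x + 1 + j" if "k + j \<le> N" for j
    using that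
  proof (induction j)
    case (Suc j)
    have "k + j < (p - 3) div 2" using Suc.prems N by linarith
    hence "qres p (k + j + 1) = qres p (k + j) + 1" using all[of j] Suc.prems by (simp add: tseq_eq_1_iff)
    thus ?case using Suc by simp
  qed (use k in simp)
  have "x + 1 + i \<in> quad_residues p" if "i < N - k" for i
    using qres_mem[of "k + i" p] long[of i] that len by simp
  hence "real (N - k) \<le> 2 * K"
    unfolding K_def using kMN by (intro residue_run_length[OF p(1) p2, of _ "x + 1"]) auto
  moreover have "N div 2 \<le> N - k" using k_small x(1) by linarith
  ultimately show False using K_small by linarith
qed

theorem theorem5:
  shows "\<exists>c::real. c > 0 \<and>
    (\<forall>p N :: nat. prime p \<longrightarrow> p \<ge> 5 \<longrightarrow> 1 \<le> N \<longrightarrow> N \<le> (p - 5) div 2 \<longrightarrow>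
       real (max_order_complexity (tseq p) N)
         \<ge> ln (real N / sqrt (real p)) / ln 2 - 4 * ln (ln (real p)) / ln 2 - c)"
(* 432 = 3 * 4 * 4 * 9: halving N costs a factor 3 because of rounding, 2 ^ (M + 2) contributes 4,
   M + 2 \<le> 4 * ln p another 4, and 5 + 4 * ln p \<le> 9 * ln p the factor 9. *)
proof (intro exI[of _ "ln 432 / ln 2"] conjI allI impI)
  fix p N :: nat
  assume p: "prime p" "p \<ge> 5" and N: "1 \<le> N" "N \<le> (p - 5) div 2"
  define M where "M = max_order_complexity (tseq p) N"
  define l where "l = ln (real p)"
  have l1: "l \<ge> 1"
  proof -
    have "exp 1 \<le> real p" using exp_le p(2) by (simp add: order_trans[of _ 3])
    thus ?thesis unfolding l_def using p(2) by (simp add: ln_ge_iff)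
  qed
  have ln2: "1 / 2 \<le> ln (2::real)" using ln_add_one_self_le_self2[of 0] ln2_ge_two_thirds by simp
  have lnNp: "ln (real N / sqrt (real p)) \<le> l"
  proof -
    have "real N / sqrt (real p) \<le> real N / 1" using p(2) by (intro divide_left_mono) auto
    also have "\<dots> \<le> real p" using N p(2) by simp
    finally show ?thesis unfolding l_def using N p(2) by (subst ln_le_cancel_iff) auto
  qed
  (* If M * ln 2 \<ge> ln p, the bound is trivial because N \<le> p. Otherwise the factor M + 2 of the
     exponential inequality is at most a constant times ln p. *)
  show "real (max_order_complexity (tseq p) N)
         \<ge> ln (real N / sqrt (real p)) / ln 2 - 4 * ln (ln (real p)) / ln 2 - ln 432 / ln 2"
  proof (cases "l \<le> real M * ln 2")
    case True
    have "ln (real N / sqrt (real p)) - 4 * ln l - ln 432 \<le> real M * ln 2"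
      using True lnNp ln_ge_zero[OF l1] ln_ge_zero[of "432 :: real"] by linarith
    thus ?thesis using ln2 by (simp add: M_def l_def field_simps)
  next
    case False
    have "real (M + 2) \<le> 4 * l"
    proof -
      have "real M * (1 / 2) \<le> real M * ln 2" using ln2 by (intro mult_left_mono) auto
      thus ?thesis using False l1 by simp
    qed
    define K where "K = sqrt (real p) * (5 + 4 * l)"
    have K: "1 \<le> K" "K \<le> sqrt (real p) * (9 * l)"
      unfolding K_def using mult_mono[of 1 "sqrt (real p)" 1 "5 + 4 * l"] p(2) l1
      by (auto intro!: mult_left_mono)
    have main: "real (N div 2) \<le> 2 ^ (M + 2) * real (M + 2) * K"
      using max_order_complexity_tseq_exp[OF p N] by (simp add: M_def K_def l_def)
    have one: "1 \<le> 2 ^ (M + 2) * real (M + 2) * K"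
    proof -
      have "1 * 1 * 1 \<le> 2 ^ (M + 2) * real (M + 2) * K"
        using K(1) by (intro mult_mono one_le_power) auto
      thus ?thesis by simp
    qed
    have "real N \<le> 2 * real (N div 2) + 1" by linarith
    also have "\<dots> \<le> 3 * (2 ^ (M + 2) * real (M + 2) * K)" using main one by linarith
    also have "\<dots> \<le> 3 * (2 ^ (M + 2) * (4 * l) * (sqrt (real p) * (9 * l)))"
      using \<open>real (M + 2) \<le> 4 * l\<close> K l1 by (intro mult_left_mono mult_mono) auto
    also have "\<dots> = 432 * 2 ^ M * l ^ 2 * sqrt (real p)"
      by (simp add: power_add power2_eq_square)
    finally have "real N / sqrt (real p) \<le> 432 * 2 ^ M * l ^ 2"
      using p(2) by (simp add: field_simps)
    hence "ln (real N / sqrt (real p)) \<le> ln (432 * 2 ^ M * l ^ 2)"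
      using N p(2) l1 by (subst ln_le_cancel_iff) auto
    also have "\<dots> = ln 432 + real M * ln 2 + 2 * ln l"
      using l1 by (simp add: ln_mult ln_realpow)
    finally have "ln (real N / sqrt (real p)) - 4 * ln l - ln 432 \<le> real M * ln 2"
      using ln_ge_zero[OF l1] by linarith
    thus ?thesis using ln2 by (simp add: M_def l_def field_simps)
  qed
qed simp

end
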